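(* Let $\mathcal{M}=TQ\times\mathbb{R}$. For every nonempty and compact subset $K$ of $\mathcal{M}$ and every neighborhood $S$ of $K$ in $\mathcal{M}$, the following implication holds: if $K$ is $S$-uniformly asymptotically stable for the averaged system $(\mathrm{AV})$, then $K$ is $S$-practically uniformly asymptotically stable for the closed-loop system $(\mathrm{CL}_\omega)$ in the variables $\tilde x=\phi^\omega_t(x)$ (systems, change of variables and stability notions as defined in the context).
   Context: Setting. $Q$ is a properly embedded (hence closed) smooth submanifold of some Euclidean space $\mathbb{R}^N$; $T_qQ$ is regarded as a subspace of $\mathbb{R}^N$ and $TQ=\{(q,v):q\in Q,\,v\in T_qQ\}\subset\mathbb{R}^N\times\mathbb{R}^N$. Thus $\mathcal{M}=TQ\times\mathbb{R}$ is a submanifold of $\mathbb{R}^{2N+1}$. $\nabla$ is a (smooth) affine connection on $Q$; $Y_0,Y_1,\ldots,Y_n$ are smooth vector fields on $Q$; $R$ is a smooth bundle map over $Q$, i.e. it assigns smoothly to each $q\in Q$ a linear map $R(q)\colon T_qQ\to T_qQ$; $\psi\colon Q\to\mathbb{R}$ is smooth. For a curve $q$ in $Q$, $\nabla_{\dot q}\dot q$ denotes its geometric acceleration (covariant derivative of $\dot q$ along $q$ with respect to $\nabla$). $Y_i\psi$ is the Lie derivative of $\psi$ along $Y_i$. The symmetric product of vector fields is $\langle X\colon\! Y\rangle:=\nabla_YX+\nabla_XY$. Control data. $\alpha\colon\mathbb{R}\to\mathbb{R}$ is smooth and such that the product $\alpha\alpha'$ of $\alpha$ with its derivative is positive and strictly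 increasing. $u=(u^1,\ldots,u^n)\colon\mathbb{R}\to\mathbb{R}^n$ is measurable, bounded, $T$-periodic and zero-mean for some $T>0$; $U=(U^1,\ldots,U^n)$ is its zero-mean antiderivative, and $\frac1T\int_0^TU^i(\tau)U^j(\tau)\,d\tau=1$ if $i=j$ and $=0$ if $i\neq j$. $\lambda=(\lambda^1,\ldots,\lambda^n)$ and $\mu=(\mu^1,\ldots,\mu^n)$ are constant vectors in $\mathbb{R}^n$, and $h>0$. Closed-loop system $(\mathrm{CL}_\omega)$, for a parameter $\omega>0$: $$\nabla_{\dot q}\dot q=Y_0(q)-R(q)\dot q+\sum_{i=1}^n\mu^i\alpha^2(\psi(q)-\eta)Y_i(q)+\sum_{i=1}^n\omega\,u^i(\omega t)\,\lambda^i\,\alpha(\psi(q)-\eta)\,Y_i(q),\qquad \dot\eta=-h\eta+h\psi(q).$$ Averaged system $(\mathrm{AV})$: $$\nabla_{\dot{\bar q}}\dot{\bar q}=Y_0(\bar q)-R(\bar q)\dot{\bar q}+\alpha^2(\psi(\bar q)-\bar\eta)\sum_{i=1}^n\mu^iY_i(\bar q)-\tfrac12\alpha^2(\psi(\bar q)-\bar\eta)\sum_{i=1}^n(\lambda^i)^2\langle Y_i\colon\! Y_i\rangle(\bar q)-(\alpha\alpha')(\psi(\bar q)-\bar\eta)\sum_{i=1}^n(\lambda^i)^2(Y_i\psi)(\bar q)\,Y_i(\bar q),$$ $$\dot{\bar\eta}=-h\bar\eta+h\psi(\bar q).$$ Both are regarded as first-order differential equations on $\mathcal{M}$ for the state $x=((q,v),\eta)$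 with $v=\dot q$ (respectively $\bar x=((\bar q,\bar v),\bar\eta)$ with $\bar v=\dot{\bar q}$). Since $u$ is only measurable and bounded, solutions of $(\mathrm{CL}_\omega)$ are understood in the Carathéodory sense. Change of variables. For $\omega>0$ and $t\in\mathbb{R}$, the bijection $\phi^\omega_t\colon\mathcal{M}\to\mathcal{M}$ is given by $\phi^\omega_t((q,v),\eta)=((q,\tilde v),\eta)$ with $$\tilde v=v-\sum_{i=1}^nU^i(\omega t)\,\lambda^i\,\alpha(\psi(q)-\eta)\,Y_i(q).$$ Stability notions. For a nonempty compact $K\subset\mathcal{M}$, $|x|_K$ is the Euclidean distance of $x$ to $K$. Let $S$ be a neighborhood of $K$ in $\mathcal{M}$. $K$ is $S$-practically uniformly asymptotically stable for $(\mathrm{CL}_\omega)$ in the variables $\tilde x=\phi^\omega_t(x)$ if both of the following hold. (i) For every $\varepsilon>0$ there exist $\omega_0,\delta>0$ such that, for every $\omega\geq\omega_0$, every $t_0\in\mathbb{R}$ and every $\tilde x_0\in\mathcal{M}$ with $|\tilde x_0|_K\leq\delta$, the maximal solution $x$ of $(\mathrm{CL}_\omega)$ with $x(t_0)=(\phi^\omega_{t_0})^{-1}(\tilde x_0)$ satisfies $|\phi^\omega_t(x(t))|_K\leq\varepsilon$ for every $t\geq t_0$ (in particular it exists for all $t\ge t_0$). (ii) For all $r,\varepsilon>0$ there exist $\omega_0,\Delta,\rho>0$ such that, for every $\omega\geq\omega_0$, every $t_0\in\mathbb{R}$ and every $\tilde x_0\in S$ with $|\tilde x_0|_K\leq r$,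 the maximal solution $x$ of $(\mathrm{CL}_\omega)$ with $x(t_0)=(\phi^\omega_{t_0})^{-1}(\tilde x_0)$ satisfies $|\phi^\omega_t(x(t))|_K\leq\rho$ for every $t\geq t_0$ and $|\phi^\omega_t(x(t))|_K\leq\varepsilon$ for every $t\geq t_0+\Delta$. $K$ is $S$-uniformly asymptotically stable for $(\mathrm{AV})$ if both of the following hold. (i') For every $\varepsilon>0$ there exists $\delta>0$ such that, for every $t_0\in\mathbb{R}$ and every $\bar x_0\in\mathcal{M}$ with $|\bar x_0|_K\le\delta$, the maximal solution $\bar x$ of $(\mathrm{AV})$ with $\bar x(t_0)=\bar x_0$ satisfies $|\bar x(t)|_K\leq\varepsilon$ for every $t\ge t_0$. (ii') For all $r,\varepsilon>0$ there exist $\Delta,\rho>0$ such that, for every $t_0\in\mathbb{R}$ and every $\bar x_0\in S$ with $|\bar x_0|_K\le r$, the maximal solution $\bar x$ of $(\mathrm{AV})$ with $\bar x(t_0)=\bar x_0$ satisfies $|\bar x(t)|_K\le\rho$ for every $t\ge t_0$ and $|\bar x(t)|_K\le\varepsilon$ for every $t\ge t_0+\Delta$. *)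

theory Defs
  imports "HOL-Analysis.Analysis"
begin

section \<open>Smooth maps\<close>

text \<open>\<open>C_diff k S f\<close> is meant for open \<open>S\<close>. On a Euclidean space, a map is \<open>C\<^sup>k\<^sup>+\<^sup>1\<close> iff it is
  differentiable and all its directional derivatives are \<open>C\<^sup>k\<close>; going through the directional
  derivatives keeps the codomain fixed along the recursion.\<close>

primrec C_diff ::
  "nat \<Rightarrow> 'a::real_normed_vector set \<Rightarrow> ('a \<Rightarrow> 'b::real_normed_vector) \<Rightarrow> bool" where
  "C_diff 0 S f \<longleftrightarrow> continuous_on S f"
| "C_diff (Suc k) S f \<longleftrightarrow>
     (\<forall>x\<in>S. f differentiable (at x)) \<and>
     (\<forall>w. C_diff k S (\<lambda>x. frechet_derivative f (at x) w))"

definition smooth_on_open ::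
  "'a::euclidean_space set \<Rightarrow> ('a \<Rightarrow> 'b::euclidean_space) \<Rightarrow> bool" where
  "smooth_on_open S f \<longleftrightarrow> open S \<and> (\<forall>k. C_diff k S f)"

text \<open>A map on an arbitrary subset of a Euclidean space is smooth if it extends, locally around
  each point of the subset, to a smooth map on an open set. On embedded submanifolds this is
  smoothness in charts.\<close>

definition smooth_map_on ::
  "'a::euclidean_space set \<Rightarrow> ('a \<Rightarrow> 'b::euclidean_space) \<Rightarrow> bool" where
  "smooth_map_on A f \<longleftrightarrow>
     (\<forall>x\<in>A. \<exists>W F. x \<in> W \<and> smooth_on_open W F \<and> (\<forall>y\<in>A \<inter> W. F y = f y))"


section \<open>Embedded submanifolds, tangent spaces, vector fields, connections\<close>

definition embedded_submanifold :: "nat \<Rightarrow> 'a::euclidean_space set \<Rightarrow> bool" where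
  "embedded_submanifold k Q \<longleftrightarrow>
     (\<forall>q\<in>Q. \<exists>(U::'a set) (V::'a set) \<Phi> \<Psi> L.
        q \<in> U \<and> smooth_on_open U \<Phi> \<and> smooth_on_open V \<Psi> \<and> homeomorphism U V \<Phi> \<Psi> \<and>
        subspace L \<and> dim L = k \<and> \<Phi> ` (Q \<inter> U) = V \<inter> L)"

definition smooth_curve_through ::
  "'a::euclidean_space set \<Rightarrow> 'a \<Rightarrow> 'a \<Rightarrow> (real \<Rightarrow> 'a) \<Rightarrow> bool" where
  "smooth_curve_through Q q v c \<longleftrightarrow>
     (\<exists>e>0. smooth_on_open {-e<..<e} c \<and> c ` {-e<..<e} \<subseteq> Q) \<and>
     c 0 = q \<and> (c has_vector_derivative v) (at 0)"

definition tangent_space :: "'a::euclidean_space set \<Rightarrow> 'a \<Rightarrow> 'a set" where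
  "tangent_space Q q = {v. \<exists>c. smooth_curve_through Q q v c}"

definition tangent_bundle :: "'a::euclidean_space set \<Rightarrow> ('a \<times> 'a) set" where
  "tangent_bundle Q = {(q, v). q \<in> Q \<and> v \<in> tangent_space Q q}"

definition state_space :: "'a::euclidean_space set \<Rightarrow> (('a \<times> 'a) \<times> real) set" where
  "state_space Q = tangent_bundle Q \<times> UNIV"

text \<open>Vector fields are maps on the ambient space of which only the restriction to \<open>Q\<close> matters.\<close>

definition smooth_vector_fields :: "'a::euclidean_space set \<Rightarrow> ('a \<Rightarrow> 'a) set" where
  "smooth_vector_fields Q = {X. smooth_map_on Q X \<and> (\<forall>q\<in>Q. X q \<in> tangent_space Q q)}"

definition smooth_endomorphism_field ::
  "'a::euclidean_space set \<Rightarrow> ('a \<Rightarrow> 'a \<Rightarrow> 'a) \<Rightarrow> bool" where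
  "smooth_endomorphism_field Q R \<longleftrightarrow>
     smooth_map_on (tangent_bundle Q) (\<lambda>(q, v). R q v) \<and>
     (\<forall>q\<in>Q. \<forall>v\<in>tangent_space Q q. R q v \<in> tangent_space Q q) \<and>
     (\<forall>q\<in>Q. \<forall>v\<in>tangent_space Q q. \<forall>w\<in>tangent_space Q q. \<forall>a b.
        R q (a *\<^sub>R v + b *\<^sub>R w) = a *\<^sub>R R q v + b *\<^sub>R R q w)"

text \<open>The Lie derivative \<open>X f\<close> of a smooth function \<open>f\<close> on \<open>Q\<close>: at \<open>q\<close>, the derivative of \<open>f\<close> along
  any curve in \<open>Q\<close> with velocity \<open>X q\<close>. The value is determined for \<open>q \<in> Q\<close> if \<open>X\<close> is tangent
  to \<open>Q\<close>, and is meaningless otherwise.\<close>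

definition lie_derivative ::
  "'a::euclidean_space set \<Rightarrow> ('a \<Rightarrow> 'a) \<Rightarrow> ('a \<Rightarrow> real) \<Rightarrow> 'a \<Rightarrow> real" where
  "lie_derivative Q X f q =
     (THE d. \<forall>c. smooth_curve_through Q q (X q) c \<longrightarrow> ((\<lambda>s. f (c s)) has_real_derivative d) (at 0))"

text \<open>The first condition makes \<open>nabla\<close> an operation on vector fields of \<open>Q\<close>, independent
  of their values outside \<open>Q\<close>. Homogeneity over the reals in the second argument is the product
  rule for constant functions.\<close>

definition affine_connection ::
  "'a::euclidean_space set \<Rightarrow> (('a \<Rightarrow> 'a) \<Rightarrow> ('a \<Rightarrow> 'a) \<Rightarrow> 'a \<Rightarrow> 'a) \<Rightarrow> bool" where
  "affine_connection Q nabla \<longleftrightarrow>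
     (\<forall>X\<in>smooth_vector_fields Q. \<forall>X'\<in>smooth_vector_fields Q.
      \<forall>Y\<in>smooth_vector_fields Q. \<forall>Y'\<in>smooth_vector_fields Q.
        (\<forall>q\<in>Q. X q = X' q \<and> Y q = Y' q) \<longrightarrow> (\<forall>q\<in>Q. nabla X Y q = nabla X' Y' q)) \<and>
     (\<forall>X\<in>smooth_vector_fields Q. \<forall>Y\<in>smooth_vector_fields Q.
        nabla X Y \<in> smooth_vector_fields Q) \<and>
     (\<forall>X\<in>smooth_vector_fields Q. \<forall>X'\<in>smooth_vector_fields Q. \<forall>Y\<in>smooth_vector_fields Q.
        \<forall>q\<in>Q. nabla (\<lambda>p. X p + X' p) Y q = nabla X Y q + nabla X' Y q) \<and>
     (\<forall>X\<in>smooth_vector_fields Q. \<forall>Y\<in>smooth_vector_fields Q. \<forall>f. smooth_map_on Q f \<longrightarrow>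
        (\<forall>q\<in>Q. nabla (\<lambda>p. f p *\<^sub>R X p) Y q = f q *\<^sub>R nabla X Y q)) \<and>
     (\<forall>X\<in>smooth_vector_fields Q. \<forall>Y\<in>smooth_vector_fields Q. \<forall>Y'\<in>smooth_vector_fields Q.
        \<forall>q\<in>Q. nabla X (\<lambda>p. Y p + Y' p) q = nabla X Y q + nabla X Y' q) \<and>
     (\<forall>X\<in>smooth_vector_fields Q. \<forall>Y\<in>smooth_vector_fields Q. \<forall>f. smooth_map_on Q f \<longrightarrow>
        (\<forall>q\<in>Q. nabla X (\<lambda>p. f p *\<^sub>R Y p) q =
                 f q *\<^sub>R nabla X Y q + lie_derivative Q X f q *\<^sub>R Y q))"

definition symmetric_product ::
  "(('a \<Rightarrow> 'a) \<Rightarrow> ('a \<Rightarrow> 'a) \<Rightarrow> 'a \<Rightarrow> 'a) \<Rightarrow> ('a \<Rightarrow> 'a) \<Rightarrow> ('a \<Rightarrow> 'a) \<Rightarrow> 'a \<Rightarrow> ('a::euclidean_space)" where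
  "symmetric_product nabla X Y q = nabla Y X q + nabla X Y q"

text \<open>\<open>D\<close> is the covariant derivative at time \<open>t\<close> of the vector field \<open>V\<close> along the curve \<open>c\<close>. It is
  computed, by linearity and the product rule, from any representation of \<open>V\<close> near \<open>t\<close> as a
  combination of vector fields \<open>E i\<close> on \<open>Q\<close> with coefficients differentiable at \<open>t\<close>; the
  result does not depend on the representation nor on the field \<open>X\<close> extending the velocity of \<open>c\<close>
  at \<open>t\<close>. Only differentiability of \<open>c\<close> and \<open>V\<close> at \<open>t\<close> is needed, so that the relation also makes
  sense almost everywhere along absolutely continuous curves.\<close>

definition has_covariant_derivative ::
  "'a::euclidean_space set \<Rightarrow> (('a \<Rightarrow> 'a) \<Rightarrow> ('a \<Rightarrow> 'a) \<Rightarrow> 'a \<Rightarrow> 'a) \<Rightarrow>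
   (real \<Rightarrow> 'a) \<Rightarrow> (real \<Rightarrow> 'a) \<Rightarrow> 'a \<Rightarrow> real \<Rightarrow> bool" where
  "has_covariant_derivative Q nabla c V D t \<longleftrightarrow>
     (\<exists>(m::nat) E a a' X.
        X \<in> smooth_vector_fields Q \<and> (c has_vector_derivative X (c t)) (at t) \<and>
        (\<forall>i<m. E i \<in> smooth_vector_fields Q \<and> (a i has_real_derivative a' i) (at t)) \<and>
        (\<forall>\<^sub>F s in nhds t. V s = (\<Sum>i<m. a i s *\<^sub>R E i (c s))) \<and>
        D = (\<Sum>i<m. a' i *\<^sub>R E i (c t) + a i t *\<^sub>R nabla X (E i) (c t)))"


section \<open>Solutions\<close>

definition abs_cont_on_interval :: "real \<Rightarrow> real \<Rightarrow> (real \<Rightarrow> 'b::metric_space) \<Rightarrow> bool" where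
  "abs_cont_on_interval a b f \<longleftrightarrow>
     (\<forall>\<epsilon>>0. \<exists>\<delta>>0. \<forall>(m::nat) c d.
        (\<forall>i<m. a \<le> c i \<and> c i \<le> d i \<and> d i \<le> b) \<and>
        (\<forall>i<m. \<forall>j<m. i \<noteq> j \<longrightarrow> {c i<..<d i} \<inter> {c j<..<d j} = {}) \<and>
        (\<Sum>i<m. d i - c i) < \<delta> \<longrightarrow>
        (\<Sum>i<m. dist (f (c i)) (f (d i))) < \<epsilon>)"

text \<open>\<open>x = ((q, v), \<eta>)\<close> satisfies at time \<open>t\<close> the equations \<open>q' = v\<close>, \<open>\<nabla>\<^sub>q\<^sub>' q' = G t x\<close> and
  \<open>\<eta>' = - h \<eta> + h \<psi>(q)\<close>.\<close>

definition solves_at ::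
  "'a::euclidean_space set \<Rightarrow> (('a \<Rightarrow> 'a) \<Rightarrow> ('a \<Rightarrow> 'a) \<Rightarrow> 'a \<Rightarrow> 'a) \<Rightarrow> real \<Rightarrow> ('a \<Rightarrow> real) \<Rightarrow>
   (real \<Rightarrow> ('a \<times> 'a) \<times> real \<Rightarrow> 'a) \<Rightarrow> (real \<Rightarrow> ('a \<times> 'a) \<times> real) \<Rightarrow> real \<Rightarrow> bool" where
  "solves_at Q nabla h \<psi> G x t \<longleftrightarrow>
     (let q = (\<lambda>s. fst (fst (x s))); v = (\<lambda>s. snd (fst (x s))); \<eta> = (\<lambda>s. snd (x s)) in
        (q has_vector_derivative v t) (at t) \<and>
        has_covariant_derivative Q nabla q v (G t (x t)) t \<and>
        (\<eta> has_real_derivative - h * \<eta> t + h * \<psi> (q t)) (at t))"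

definition classical_solution ::
  "'a::euclidean_space set \<Rightarrow> (('a \<Rightarrow> 'a) \<Rightarrow> ('a \<Rightarrow> 'a) \<Rightarrow> 'a \<Rightarrow> 'a) \<Rightarrow> real \<Rightarrow> ('a \<Rightarrow> real) \<Rightarrow>
   (real \<Rightarrow> ('a \<times> 'a) \<times> real \<Rightarrow> 'a) \<Rightarrow> real set \<Rightarrow> (real \<Rightarrow> ('a \<times> 'a) \<times> real) \<Rightarrow> bool" where
  "classical_solution Q nabla h \<psi> G J x \<longleftrightarrow>
     (\<forall>t\<in>J. x t \<in> state_space Q \<and> solves_at Q nabla h \<psi> G x t)"

definition caratheodory_solution ::
  "'a::euclidean_space set \<Rightarrow> (('a \<Rightarrow> 'a) \<Rightarrow> ('a \<Rightarrow> 'a) \<Rightarrow> 'a \<Rightarrow> 'a) \<Rightarrow> real \<Rightarrow> ('a \<Rightarrow> real) \<Rightarrow>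
   (real \<Rightarrow> ('a \<times> 'a) \<times> real \<Rightarrow> 'a) \<Rightarrow> real set \<Rightarrow> (real \<Rightarrow> ('a \<times> 'a) \<times> real) \<Rightarrow> bool" where
  "caratheodory_solution Q nabla h \<psi> G J x \<longleftrightarrow>
     (\<forall>t\<in>J. x t \<in> state_space Q) \<and>
     (\<forall>a b. {a..b} \<subseteq> J \<longrightarrow> abs_cont_on_interval a b x) \<and>
     (AE t in lebesgue. t \<in> J \<longrightarrow> solves_at Q nabla h \<psi> G x t)"

definition maximal_solution ::
  "(real set \<Rightarrow> (real \<Rightarrow> 's) \<Rightarrow> bool) \<Rightarrow> real \<Rightarrow> 's \<Rightarrow> real set \<Rightarrow> (real \<Rightarrow> 's) \<Rightarrow> bool" where
  "maximal_solution sol t\<^sub>0 x\<^sub>0 J x \<longleftrightarrow>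
     open J \<and> is_interval J \<and> t\<^sub>0 \<in> J \<and> x t\<^sub>0 = x\<^sub>0 \<and> sol J x \<and>
     (\<forall>J' y. open J' \<and> is_interval J' \<and> J \<subseteq> J' \<and> sol J' y \<and> (\<forall>t\<in>J. y t = x t) \<longrightarrow> J' = J)"

text \<open>``The maximal solution starting from \<open>x\<^sub>0\<close> at time \<open>t\<^sub>0\<close> satisfies \<open>P\<close>'', where \<open>P\<close> concerns
  times \<open>t \<ge> t\<^sub>0\<close> only: there is one, and any one exists for all such times and satisfies \<open>P\<close>.\<close>

definition max_solution_satisfies ::
  "(real set \<Rightarrow> (real \<Rightarrow> 's) \<Rightarrow> bool) \<Rightarrow> real \<Rightarrow> 's \<Rightarrow> ((real \<Rightarrow> 's) \<Rightarrow> bool) \<Rightarrow> bool" where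
  "max_solution_satisfies sol t\<^sub>0 x\<^sub>0 P \<longleftrightarrow>
     (\<exists>J x. maximal_solution sol t\<^sub>0 x\<^sub>0 J x) \<and>
     (\<forall>J x. maximal_solution sol t\<^sub>0 x\<^sub>0 J x \<longrightarrow> {t\<^sub>0..} \<subseteq> J \<and> P x)"


section \<open>Stability\<close>

definition neighborhood_in :: "'s::topological_space set \<Rightarrow> 's set \<Rightarrow> 's set \<Rightarrow> bool" where
  "neighborhood_in M K S \<longleftrightarrow> S \<subseteq> M \<and> (\<exists>N. openin (top_of_set M) N \<and> K \<subseteq> N \<and> N \<subseteq> S)"

text \<open>\<open>sol J x\<close> states that \<open>x\<close> is a solution on the interval \<open>J\<close>.\<close>

definition uniformly_asymptotically_stable ::
  "'s::metric_space set \<Rightarrow> (real set \<Rightarrow> (real \<Rightarrow> 's) \<Rightarrow> bool) \<Rightarrow> 's set \<Rightarrow> 's set \<Rightarrow> bool" where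
  "uniformly_asymptotically_stable M sol S K \<longleftrightarrow>
     (\<forall>\<epsilon>>0. \<exists>\<delta>>0. \<forall>t\<^sub>0. \<forall>x\<^sub>0\<in>M. infdist x\<^sub>0 K \<le> \<delta> \<longrightarrow>
        max_solution_satisfies sol t\<^sub>0 x\<^sub>0 (\<lambda>x. \<forall>t\<ge>t\<^sub>0. infdist (x t) K \<le> \<epsilon>)) \<and>
     (\<forall>r>0. \<forall>\<epsilon>>0. \<exists>\<Delta>>0. \<exists>\<rho>>0. \<forall>t\<^sub>0. \<forall>x\<^sub>0\<in>S. infdist x\<^sub>0 K \<le> r \<longrightarrow>
        max_solution_satisfies sol t\<^sub>0 x\<^sub>0
          (\<lambda>x. (\<forall>t\<ge>t\<^sub>0. infdist (x t) K \<le> \<rho>) \<and> (\<forall>t\<ge>t\<^sub>0 + \<Delta>. infdist (x t) K \<le> \<epsilon>)))"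

text \<open>Here \<open>sol\<close> and the change of variables \<open>\<phi>\<close> depend on the parameter \<open>\<omega>\<close>, and \<open>\<phi> \<omega> t\<close> is meant
  to be a bijection of \<open>M\<close>.\<close>

definition practically_uniformly_asymptotically_stable ::
  "'s::metric_space set \<Rightarrow> (real \<Rightarrow> real set \<Rightarrow> (real \<Rightarrow> 's) \<Rightarrow> bool) \<Rightarrow>
   (real \<Rightarrow> real \<Rightarrow> 's \<Rightarrow> 's) \<Rightarrow> 's set \<Rightarrow> 's set \<Rightarrow> bool" where
  "practically_uniformly_asymptotically_stable M sol \<phi> S K \<longleftrightarrow>
     (\<forall>\<epsilon>>0. \<exists>\<omega>\<^sub>0>0. \<exists>\<delta>>0. \<forall>\<omega>\<ge>\<omega>\<^sub>0. \<forall>t\<^sub>0. \<forall>x\<^sub>0\<in>M. infdist x\<^sub>0 K \<le> \<delta> \<longrightarrow>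
        max_solution_satisfies (sol \<omega>) t\<^sub>0 (inv_into M (\<phi> \<omega> t\<^sub>0) x\<^sub>0)
          (\<lambda>x. \<forall>t\<ge>t\<^sub>0. infdist (\<phi> \<omega> t (x t)) K \<le> \<epsilon>)) \<and>
     (\<forall>r>0. \<forall>\<epsilon>>0. \<exists>\<omega>\<^sub>0>0. \<exists>\<Delta>>0. \<exists>\<rho>>0. \<forall>\<omega>\<ge>\<omega>\<^sub>0. \<forall>t\<^sub>0. \<forall>x\<^sub>0\<in>S. infdist x\<^sub>0 K \<le> r \<longrightarrow>
        max_solution_satisfies (sol \<omega>) t\<^sub>0 (inv_into M (\<phi> \<omega> t\<^sub>0) x\<^sub>0)
          (\<lambda>x. (\<forall>t\<ge>t\<^sub>0. infdist (\<phi> \<omega> t (x t)) K \<le> \<rho>) \<and>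
               (\<forall>t\<ge>t\<^sub>0 + \<Delta>. infdist (\<phi> \<omega> t (x t)) K \<le> \<epsilon>)))"


section \<open>The closed-loop and averaged systems\<close>

fun cl_acceleration ::
  "nat \<Rightarrow> (nat \<Rightarrow> 'a::euclidean_space \<Rightarrow> 'a) \<Rightarrow> ('a \<Rightarrow> 'a \<Rightarrow> 'a) \<Rightarrow> ('a \<Rightarrow> real) \<Rightarrow> (real \<Rightarrow> real) \<Rightarrow>
   (nat \<Rightarrow> real \<Rightarrow> real) \<Rightarrow> (nat \<Rightarrow> real) \<Rightarrow> (nat \<Rightarrow> real) \<Rightarrow> real \<Rightarrow> real \<Rightarrow> ('a \<times> 'a) \<times> real \<Rightarrow> 'a" where
  "cl_acceleration n Y R \<psi> \<alpha> u lam mu \<omega> t ((q, v), \<eta>) =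
     Y 0 q - R q v
     + (\<Sum>i=1..n. (mu i * (\<alpha> (\<psi> q - \<eta>))\<^sup>2) *\<^sub>R Y i q)
     + (\<Sum>i=1..n. (\<omega> * u i (\<omega> * t) * lam i * \<alpha> (\<psi> q - \<eta>)) *\<^sub>R Y i q)"

fun av_acceleration ::
  "'a::euclidean_space set \<Rightarrow> (('a \<Rightarrow> 'a) \<Rightarrow> ('a \<Rightarrow> 'a) \<Rightarrow> 'a \<Rightarrow> 'a) \<Rightarrow>
   nat \<Rightarrow> (nat \<Rightarrow> 'a \<Rightarrow> 'a) \<Rightarrow> ('a \<Rightarrow> 'a \<Rightarrow> 'a) \<Rightarrow> ('a \<Rightarrow> real) \<Rightarrow> (real \<Rightarrow> real) \<Rightarrow>
   (nat \<Rightarrow> real) \<Rightarrow> (nat \<Rightarrow> real) \<Rightarrow> ('a \<times> 'a) \<times> real \<Rightarrow> 'a" where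
  "av_acceleration Q nabla n Y R \<psi> \<alpha> lam mu ((q, v), \<eta>) =
     Y 0 q - R q v
     + (\<alpha> (\<psi> q - \<eta>))\<^sup>2 *\<^sub>R (\<Sum>i=1..n. mu i *\<^sub>R Y i q)
     - (1 / 2 * (\<alpha> (\<psi> q - \<eta>))\<^sup>2) *\<^sub>R
         (\<Sum>i=1..n. (lam i)\<^sup>2 *\<^sub>R symmetric_product nabla (Y i) (Y i) q)
     - (\<alpha> (\<psi> q - \<eta>) * deriv \<alpha> (\<psi> q - \<eta>)) *\<^sub>R
         (\<Sum>i=1..n. ((lam i)\<^sup>2 * lie_derivative Q (Y i) \<psi> q) *\<^sub>R Y i q)"

fun change_of_variables ::
  "nat \<Rightarrow> (nat \<Rightarrow> 'a::euclidean_space \<Rightarrow> 'a) \<Rightarrow> ('a \<Rightarrow> real) \<Rightarrow> (real \<Rightarrow> real) \<Rightarrow>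
   (nat \<Rightarrow> real \<Rightarrow> real) \<Rightarrow> (nat \<Rightarrow> real) \<Rightarrow> real \<Rightarrow> real \<Rightarrow> ('a \<times> 'a) \<times> real \<Rightarrow> ('a \<times> 'a) \<times> real" where
  "change_of_variables n Y \<psi> \<alpha> U lam \<omega> t ((q, v), \<eta>) =
     ((q, v - (\<Sum>i=1..n. (U i (\<omega> * t) * lam i * \<alpha> (\<psi> q - \<eta>)) *\<^sub>R Y i q)), \<eta>)"

text \<open>The first condition says that \<open>U\<close> is an integral function of \<open>u\<close>; for a merely
  measurable \<open>u\<close>, this is the meaning of antiderivative.\<close>

definition zero_mean_antiderivative ::
  "real \<Rightarrow> (real \<Rightarrow> real) \<Rightarrow> (real \<Rightarrow> real) \<Rightarrow> bool" where
  "zero_mean_antiderivative T u U \<longleftrightarrow>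
     (\<forall>a b. a \<le> b \<longrightarrow> (u has_integral (U b - U a)) {a..b}) \<and>
     (U has_integral 0) {0..T}"

end

theory Submission
  imports Defs
begin

text \<open>In the variables \<open>\<phi>\<close> the input \<open>u\<close> enters only through its bounded antiderivative \<open>U\<close>: the new
  state solves an ordinary differential equation on \<open>TQ \<times> \<real>\<close> whose right-hand side is a polynomial in
  the \<open>U i (\<omega> t)\<close> with locally Lipschitz coefficients. With \<open>V 0 = 1\<close> and \<open>V i = U i\<close> for
  \<open>i \<ge> 1\<close>, the velocity is \<open>\<Sum> V i Z i\<close> and the right-hand side is \<open>\<Sum> V i V j F i j\<close>; as the \<open>V i\<close> are
  orthonormal, its average is \<open>\<Sum> F i i\<close>, which is the averaged system. On bounded time intervals the
  solutions of the two systems are therefore \<open>O(1/\<omega>)\<close>-close, uniformly in the initial time; asymptotic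
  stability of the averaged system then makes trajectories near \<open>K\<close> return to the same neighbourhood
  of \<open>K\<close> after each time span \<open>\<Delta>\<close>, and this is iterated.

  Charts are avoided by working in the ambient space with the orthogonal projection \<open>P\<close> onto the
  tangent spaces: covariant derivatives are \<open>P v' + \<Gamma>(q', v)\<close> with globally defined Christoffel
  symbols, and \<open>TQ \<times> \<real>\<close> is kept invariant by Nagumo's theorem. Absolutely continuous solutions are
  recovered from differentiable ones, since \<open>U' = u\<close> almost everywhere.\<close>

text \<open>First-order averaging suffices although the input has size \<omega>: along solutions,
  the derivative of the subtracted term contains exactly \<omega> u times the controlled fields,
  which cancels the forcing. For i \<ge> 1 the acceleration part of F i i is minus the covariant
  derivative of Z i = lam i \<alpha>(\<psi> - \<eta>) Y i along itself with \<eta> frozen; the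
  product rule splits it into half a symmetric product and the \<alpha>\<alpha>' term.

  The obstacle is that the fields are locally Lipschitz only on a closed set. Near the averaged
  trajectories they are replaced by bounded Lipschitz fields on the ambient space, which gives
  global solutions and uniform constants. The new fields are known to be tangent to the set only
  where they agree with the old ones. So closeness to the averaged trajectory is proved first and
  invariance afterwards: a point near that trajectory has its nearest points of the set inside the
  region of agreement.

  The stability notions speak of maximal solutions on open intervals, hence every solution is also
  continued a little before its initial time.\<close>

section \<open>Ordinary differential equations\<close>

text \<open>Distances and norms along solutions need not be differentiable, so only forward
  difference quotients are bounded, up to an error \<open>e\<close> that absorbs the o(s) terms. If
  the bound with \<open>c + e\<close> failed somewhere, it would still hold at the infimum of the
  failing times, and one application of \<open>step\<close> would carry it past that infimum. Then
  \<open>e\<close> tends to 0.\<close>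

lemma Dini_Gronwall:
  fixes g :: "real \<Rightarrow> real"
  assumes cont: "continuous_on {a..b} g" and L: "L \<ge> 0" and c: "c \<ge> 0"
    and nonneg: "\<And>t. t \<in> {a..b} \<Longrightarrow> g t \<ge> 0"
    and step: "\<And>t e. a \<le> t \<Longrightarrow> t < b \<Longrightarrow> e > 0 \<Longrightarrow>
      \<exists>d>0. \<forall>s. 0 < s \<and> s < d \<and> t + s \<le> b \<longrightarrow> g (t + s) \<le> g t + s * (L * g t + c + e)"
    and t: "t \<in> {a..b}"
  shows "g t \<le> (g a + c * (t - a)) * exp (L * (t - a))"
proof -
  have "g t \<le> (g a + (c + e) * (t - a)) * exp (L * (t - a))" if "e > 0" for e
  proof (rule ccontr)
    define G where "G t = (g a + (c + e) * (t - a)) * exp (L * (t - a))" for t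
    define B where "B = {r \<in> {a..b}. g r > G r}"
    define s where "s = Inf B"
    assume "\<not> ?thesis"
    then have tB: "t \<in> B" using t by (auto simp: B_def G_def)
    have bdd: "bdd_below B" by (auto simp: B_def bdd_below_def)
    have s1: "a \<le> s" unfolding s_def using tB by (intro cInf_greatest) (auto simp: B_def)
    have s2: "s \<le> t" unfolding s_def using tB bdd by (intro cInf_lower)
    have below: "g r \<le> G r" if "a \<le> r" "r < s" for r
    proof (rule ccontr)
      assume "\<not> ?thesis"
      then have "r \<in> B" using that s2 t by (auto simp: B_def)
      then have "s \<le> r" unfolding s_def using bdd by (intro cInf_lower)
      then show False using that by simp
    qed
    have contG: "continuous_on X G" for X
      unfolding G_def by (intro continuous_intros)
    have gs: "g s \<le> G s"
    proof (cases "s = a")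
      case True
      then show ?thesis by (simp add: G_def)
    next
      case False
      then have "a < s" using s1 by simp
      have "closed {r \<in> {a..b}. g r \<le> G r}"
        by (intro continuous_on_closed_Collect_le cont contG) simp_all
      moreover have "s \<in> closure {a<..<s}" using \<open>a < s\<close> by simp
      moreover have "{a<..<s} \<subseteq> {r \<in> {a..b}. g r \<le> G r}"
        using below s2 t by auto
      ultimately show ?thesis using closure_minimal by blast
    qed
    then have "s \<noteq> t" using tB by (auto simp: B_def)
    then have "s < b" using s2 t by auto
    from step[OF s1 this \<open>e > 0\<close>] obtain d where "d > 0"
      and d: "\<And>h. 0 < h \<Longrightarrow> h < d \<Longrightarrow> s + h \<le> b \<Longrightarrow> g (s + h) \<le> g s + h * (L * g s + c + e)" by blast
    have "r \<notin> B" if "r < s + d" for r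
    proof
      assume rB: "r \<in> B"
      then have "r \<ge> s" unfolding s_def using bdd by (intro cInf_lower)
      moreover have "r \<noteq> s" using rB gs by (auto simp: B_def)
      ultimately have "r > s" by simp
      define h where "h = r - s"
      have h: "0 < h" "h < d" "s + h \<le> b" using \<open>r > s\<close> that rB by (auto simp: h_def B_def)
      define A where "A = g a + (c + e) * (s - a)"
      define E where "E = exp (L * (s - a))"
      have A: "A \<ge> 0" unfolding A_def using nonneg[of a] t c \<open>e > 0\<close> s1 by auto
      have E: "E \<ge> 1" unfolding E_def using L s1 by simp
      have GA: "G s = A * E" by (simp add: G_def A_def E_def)
      have "G r = (A + (c + e) * h) * (E * exp (L * h))"
        by (simp add: G_def A_def E_def h_def algebra_simps flip: exp_add)
      also have "\<dots> \<ge> (A + (c + e) * h) * (E * (1 + L * h))"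
        using A c \<open>e > 0\<close> h E by (intro mult_left_mono) auto
      also have "(A + (c + e) * h) * (E * (1 + L * h)) \<ge> (A * E) * (1 + L * h) + (c + e) * h"
      proof -
        have "(c + e) * h * 1 \<le> (c + e) * h * (E * (1 + L * h))"
          using c \<open>e > 0\<close> h E L
          by (intro mult_left_mono) (auto intro!: mult_ge1_I)
        then show ?thesis by (simp add: algebra_simps)
      qed
      finally have "G r \<ge> G s * (1 + L * h) + (c + e) * h" by (simp add: GA)
      moreover have "g r \<le> g s * (1 + L * h) + (c + e) * h"
        using d[OF h] by (simp add: h_def algebra_simps)
      moreover have "g s * (1 + L * h) \<le> G s * (1 + L * h)"
        using gs L h by (intro mult_right_mono) auto
      ultimately show False using rB by (auto simp: B_def)
    qed
    then have "\<forall>r\<in>B. s + d \<le> r" by force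
    then have "s + d \<le> s" unfolding s_def using tB by (intro cInf_greatest) auto
    then show False using \<open>d > 0\<close> by simp
  qed note * = this
  have lim: "((\<lambda>e. (g a + (c + e) * (t - a)) * exp (L * (t - a))) \<longlongrightarrow>
     (g a + (c + 0) * (t - a)) * exp (L * (t - a))) (at_right 0)"
    by (intro tendsto_intros)
  have "eventually (\<lambda>e::real. e > 0) (at_right 0)"
    by (simp add: eventually_at_right_less)
  then have "eventually (\<lambda>e. g t \<le> (g a + (c + e) * (t - a)) * exp (L * (t - a))) (at_right 0)"
    by eventually_elim (rule *)
  then show ?thesis
    using tendsto_lowerbound[OF lim] by simp
qed

section \<open>Derivatives in increment form; reversal and shift of time\<close>

lemma has_vector_derivative_alt:
  "(f has_vector_derivative D) (at t) \<longleftrightarrow>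
    (\<forall>e>0. \<exists>d>0. \<forall>s. \<bar>s\<bar> < d \<longrightarrow> norm (f (t + s) - f t - s *\<^sub>R D) \<le> e * \<bar>s\<bar>)" (is "_ = ?R")
proof -
  have "(\<forall>y. norm(y - t) < d \<longrightarrow> norm (f y - f t - (y - t) *\<^sub>R D) \<le> e * norm (y - t)) \<longleftrightarrow>
        (\<forall>s. \<bar>s\<bar> < d \<longrightarrow> norm (f (t + s) - f t - s *\<^sub>R D) \<le> e * \<bar>s\<bar>)" for d e
  proof safe
    fix s assume *: "\<forall>y. norm (y - t) < d \<longrightarrow> norm (f y - f t - (y - t) *\<^sub>R D) \<le> e * norm (y - t)" "\<bar>s\<bar> < d"
    show "norm (f (t + s) - f t - s *\<^sub>R D) \<le> e * \<bar>s\<bar>"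
      using *(1)[rule_format, of "t + s"] *(2) by simp
  next
    fix y assume *: "\<forall>s. \<bar>s\<bar> < d \<longrightarrow> norm (f (t + s) - f t - s *\<^sub>R D) \<le> e * \<bar>s\<bar>" "norm (y - t) < d"
    show "norm (f y - f t - (y - t) *\<^sub>R D) \<le> e * norm (y - t)"
      using *(1)[rule_format, of "y - t"] *(2) by simp
  qed
  then show ?thesis
    unfolding has_vector_derivative_def has_derivative_at_alt
    by (simp add: bounded_linear_scaleR_left)
qed

lemma has_vector_derivative_reflect:
  assumes "(f has_vector_derivative D) (at (c - t))"
  shows "((\<lambda>s. f (c - s)) has_vector_derivative - D) (at t)"
proof -
  have "((\<lambda>s. c - s) has_vector_derivative -1) (at t)"
    by (auto intro!: derivative_eq_intros)
  from vector_diff_chain_at[OF this assms] show ?thesis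
    by (simp add: o_def)
qed

lemma has_vector_derivative_shift:
  assumes "(f has_vector_derivative D) (at (t + c))"
  shows "((\<lambda>s. f (s + c)) has_vector_derivative D) (at t)"
proof -
  have "((\<lambda>s. s + c) has_vector_derivative 1) (at t)"
    by (auto intro!: derivative_eq_intros)
  from vector_diff_chain_at[OF this assms] show ?thesis
    by (simp add: o_def)
qed

section \<open>Global solutions for bounded Lipschitz right-hand sides\<close>

lemma continuous_has_antiderivative:
  fixes g :: "real \<Rightarrow> 'b::banach"
  assumes g: "continuous_on UNIV g"
  shows "\<exists>G. G 0 = 0 \<and> (\<forall>t. (G has_vector_derivative g t) (at t))"
proof -
  \<comment> \<open>One of the two intervals is empty or a point, so this is the oriented integral
    from 0 to \<open>t\<close>.\<close>
  define G where "G t = integral {0..t} g - integral {t..0} g" for t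
  have int: "g integrable_on {a..b}" for a b
    using g by (intro integrable_continuous_real) (rule continuous_on_subset, auto)
  \<comment> \<open>Moving the base point to \<open>-N\<close> expresses \<open>G\<close> on both
    sides of 0 by a single indefinite integral, up to a constant.\<close>
  have G: "G t = integral {-N..t} g - integral {-N..0} g" if "t \<in> {-N<..<N}" for t N
  proof (cases "t \<ge> 0")
    case True
    then show ?thesis using that Henstock_Kurzweil_Integration.integral_combine[of "-N" 0 t g] int[of "-N" t]
      by (cases "t = 0") (auto simp: G_def algebra_simps)
  next
    case False
    then show ?thesis using that Henstock_Kurzweil_Integration.integral_combine[of "-N" t 0 g] int[of "-N" 0]
      by (auto simp: G_def algebra_simps)
  qed
  have "(G has_vector_derivative g t) (at t)" for t
  proof -
    define N where "N = \<bar>t\<bar> + 1"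
    have tN: "t \<in> {-N<..<N}" by (auto simp: N_def)
    have "((\<lambda>u. integral {-N..u} g) has_vector_derivative g t) (at t within {-N..N})"
      using tN by (intro integral_has_vector_derivative continuous_on_subset[OF g]) auto
    then have "((\<lambda>u. integral {-N..u} g) has_vector_derivative g t) (at t)"
      using tN at_within_interior[of t "{-N..N}"] by (simp add: interior_atLeastAtMost_real)
    then have "((\<lambda>u. integral {-N..u} g - integral {-N..0} g) has_vector_derivative g t) (at t)"
      by (auto intro!: derivative_eq_intros)
    then show ?thesis
      by (rule has_vector_derivative_transform_within_open[where S="{-N<..<N}"]) (use tN G in auto)
  qed
  then show ?thesis by (intro exI[of _ G]) (auto simp: G_def)
qed

lemma antiderivative_exp_bound_nonneg:
  fixes G :: "real \<Rightarrow> 'b::real_normed_vector"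
  assumes G: "\<And>t. (G has_vector_derivative g t) (at t)" and "G 0 = 0" and c: "c > 0"
    and bd: "\<And>t. norm (g t) \<le> M * exp (c * \<bar>t\<bar>)" and t: "t \<ge> 0"
  shows "norm (G t) \<le> M / c * exp (c * \<bar>t\<bar>)"
proof (cases "t = 0")
  case True
  have "M \<ge> 0" using order_trans[OF norm_ge_zero bd[of 0]] by simp
  then show ?thesis using True \<open>G 0 = 0\<close> c by auto
next
  case False
  have M: "M \<ge> 0" using order_trans[OF norm_ge_zero bd[of 0]] by simp
  have "norm (G t - G 0) \<le> M / c * exp (c * t) - M / c * exp (c * 0)"
  proof (rule differentiable_bound_general)
    show "0 < t" using t False by simp
    show "continuous_on {0..t} G"
      using G by (meson continuous_at_imp_continuous_on has_vector_derivative_continuous)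
    show "continuous_on {0..t} (\<lambda>s. M / c * exp (c * s))" by (intro continuous_intros)
    show "(G has_vector_derivative g x) (at x)" for x by (rule G)
    show "((\<lambda>s. M / c * exp (c * s)) has_vector_derivative M * exp (c * x)) (at x)" for x
      using c by (auto intro!: derivative_eq_intros simp flip: has_real_derivative_iff_has_vector_derivative)
    show "norm (g x) \<le> M * exp (c * x)" if "0 < x" for x using bd[of x] that by simp
  qed
  moreover have "0 \<le> M / c" using M c by simp
  ultimately show ?thesis using t \<open>G 0 = 0\<close> by simp
qed

lemma antiderivative_exp_bound:
  fixes G :: "real \<Rightarrow> 'b::real_normed_vector"
  assumes G: "\<And>t. (G has_vector_derivative g t) (at t)" and "G 0 = 0" and c: "c > 0"
    and bd: "\<And>t. norm (g t) \<le> M * exp (c * \<bar>t\<bar>)"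
  shows "norm (G t) \<le> M / c * exp (c * \<bar>t\<bar>)"
proof (cases "t \<ge> 0")
  case True
  then show ?thesis using antiderivative_exp_bound_nonneg[OF assms] by simp
next
  case False
  have "norm (- g (0 - t)) \<le> M * exp (c * \<bar>t\<bar>)" for t using bd[of "-t"] by simp
  from antiderivative_exp_bound_nonneg[OF has_vector_derivative_reflect[OF G] _ c this, of "-t"]
  show ?thesis using False \<open>G 0 = 0\<close> by simp
qed

text \<open>The unknown is the bounded function exp(-c|s|) (y(s + t0) - x0). In this weighted sup
  norm the Picard operator contracts by L / c, which is at most 1/2 for c = 2 (L + 1), so the
  solution on the whole line comes from one fixed point instead of gluing local ones. The bound
  \<open>B\<close> keeps the operator inside the bounded functions.\<close>

theorem Picard_global:
  fixes f :: "real \<Rightarrow> 'b::euclidean_space \<Rightarrow> 'b"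
  assumes cont: "continuous_on UNIV (\<lambda>(t, x). f t x)"
    and lip: "\<And>t. L-lipschitz_on UNIV (f t)"
    and bd: "\<And>t x. norm (f t x) \<le> B"
  shows "\<exists>y. y t0 = x0 \<and> (\<forall>t. (y has_vector_derivative f t (y t)) (at t))"
proof -
  define c where "c = 2 * (L + 1)"
  have L: "L \<ge> 0" using lip[of 0] by (rule lipschitz_on_nonneg)
  have c: "c > 0" using L by (simp add: c_def)
  have B: "B \<ge> 0" using order_trans[OF norm_ge_zero bd[of 0 0]] .
  define X where "X z s = x0 + exp (c * \<bar>s\<bar>) *\<^sub>R apply_bcontfun z s" for z :: "real \<Rightarrow>\<^sub>C 'b" and s
  have Xcont: "continuous_on UNIV (X z)" for z
    unfolding X_def by (intro continuous_intros continuous_on_apply_bcontfun)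
  have gcont: "continuous_on UNIV (\<lambda>s. f (s + t0) (X z s))" for z
  proof -
    have "continuous_on UNIV ((\<lambda>(t, x). f t x) \<circ> (\<lambda>s. (s + t0, X z s)))"
      by (intro continuous_on_compose continuous_intros Xcont continuous_on_subset[OF cont]) auto
    then show ?thesis by (simp add: o_def)
  qed
  \<comment> \<open>The Picard integral along the curve \<open>X z\<close>, with the initial time
    moved to 0, where the weight is centred.\<close>
  define P where "P z = (SOME G. G 0 = 0 \<and> (\<forall>t. (G has_vector_derivative f (t + t0) (X z t)) (at t)))" for z
  have P: "P z 0 = 0" "(P z has_vector_derivative f (t + t0) (X z t)) (at t)" for z t
    using someI_ex[OF continuous_has_antiderivative[OF gcont]] unfolding P_def by blast+
  have Pbd: "norm (P z t) \<le> B / c * exp (c * \<bar>t\<bar>)" for z t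
  proof (rule antiderivative_exp_bound[OF P(2) P(1) c])
    show "norm (f (t + t0) (X z t)) \<le> B * exp (c * \<bar>t\<bar>)" for t
    proof -
      have "B * 1 \<le> B * exp (c * \<bar>t\<bar>)" using B c by (intro mult_left_mono) auto
      then show ?thesis using bd[of "t + t0" "X z t"] by simp
    qed
  qed
  have expc: "exp (- (c * \<bar>t\<bar>)) * (K * exp (c * \<bar>t\<bar>)) = K" for t K
    by (simp add: exp_minus field_simps)
  define W where "W z t = exp (- (c * \<bar>t\<bar>)) *\<^sub>R P z t" for z t
  have "W z \<in> bcontfun" for z
  proof -
    have "continuous_on UNIV (P z)"
      using P(2) by (meson continuous_at_imp_continuous_on has_vector_derivative_continuous)
    then have "continuous_on UNIV (W z)"
      unfolding W_def by (intro continuous_intros)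
    moreover have "norm (W z t) \<le> B / c" for t
    proof -
      have "norm (W z t) \<le> exp (- (c * \<bar>t\<bar>)) * (B / c * exp (c * \<bar>t\<bar>))"
        unfolding W_def norm_scaleR abs_exp_cancel by (rule mult_left_mono[OF Pbd]) simp
      then show ?thesis unfolding expc .
    qed
    ultimately show ?thesis unfolding bcontfun_def bounded_iff by auto
  qed
  then have W: "apply_bcontfun (Bcontfun (W z)) = W z" for z
    by (simp add: Bcontfun_inverse)
  have "\<exists>!z. Bcontfun (W z) = z"
  proof (rule banach_fix_type[where c="1/2"]; (intro allI)?)
    fix z w :: "real \<Rightarrow>\<^sub>C 'b"
    have "norm (P z t - P w t) \<le> (L * dist z w) / c * exp (c * \<bar>t\<bar>)" for t
    proof (rule antiderivative_exp_bound[OF _ _ c])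
      show "((\<lambda>t. P z t - P w t) has_vector_derivative
         f (t + t0) (X z t) - f (t + t0) (X w t)) (at t)" for t
        by (intro derivative_intros P)
      show "norm (f (t + t0) (X z t) - f (t + t0) (X w t)) \<le> (L * dist z w) * exp (c * \<bar>t\<bar>)" for t
      proof -
        have "norm (f (t + t0) (X z t) - f (t + t0) (X w t)) \<le> L * dist (X z t) (X w t)"
          using lipschitz_onD[OF lip[of "t + t0"], of "X z t" "X w t"] by (simp add: dist_norm)
        also have "dist (X z t) (X w t) = exp (c * \<bar>t\<bar>) * dist (z t) (w t)"
          by (simp add: X_def dist_norm flip: scaleR_diff_right)
        also have "L * \<dots> \<le> L * (exp (c * \<bar>t\<bar>) * dist z w)"
          using L by (intro mult_left_mono dist_bounded) auto
        finally show ?thesis by (simp add: mult_ac)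
      qed
    qed (simp add: P)
    moreover have "L * dist z w / c \<le> 1/2 * dist z w"
    proof -
      have "L / c \<le> 1 / 2" using L by (simp add: c_def field_simps)
      from mult_right_mono[OF this zero_le_dist[of z w]] show ?thesis by simp
    qed
    ultimately have *: "norm (P z t - P w t) \<le> 1/2 * dist z w * exp (c * \<bar>t\<bar>)" for t
      by (meson exp_ge_zero mult_right_mono order_trans)
    show "dist (Bcontfun (W z)) (Bcontfun (W w)) \<le> 1/2 * dist z w"
    proof (rule dist_bound)
      fix t
      have "dist (W z t) (W w t) = exp (- (c * \<bar>t\<bar>)) * norm (P z t - P w t)"
        by (simp add: W_def dist_norm flip: scaleR_diff_right)
      also have "\<dots> \<le> exp (- (c * \<bar>t\<bar>)) * (1/2 * dist z w * exp (c * \<bar>t\<bar>))"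
        using * by (intro mult_left_mono) auto
      finally show "dist (apply_bcontfun (Bcontfun (W z)) t) (apply_bcontfun (Bcontfun (W w)) t) \<le> 1/2 * dist z w"
        unfolding expc W .
    qed
  qed auto
  then obtain z where z: "Bcontfun (W z) = z" by blast
  then have zW: "apply_bcontfun z = W z" using W by metis
  have XP: "X z t = x0 + P z t" for t
    unfolding X_def zW by (simp add: W_def flip: exp_add)
  have d: "(X z has_vector_derivative f (t + t0) (X z t)) (at t)" for t
    using P(2)[of z t] unfolding XP[abs_def] by (auto intro!: derivative_eq_intros)
  define y where "y t = X z (t + (- t0))" for t
  have "(y has_vector_derivative f t (y t)) (at t)" for t
    using has_vector_derivative_shift[of "X z" _ t "-t0"] d[of "t + (-t0)"] unfolding y_def
    by simp
  moreover have "y t0 = x0" by (simp add: y_def XP P)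
  ultimately show ?thesis by blast
qed

section \<open>Lipschitz maps on compact sets and their extensions\<close>

definition locally_lipschitz_on :: "'a::metric_space set \<Rightarrow> ('a \<Rightarrow> 'b::metric_space) \<Rightarrow> bool" where
  "locally_lipschitz_on A f \<longleftrightarrow> (\<forall>x\<in>A. \<exists>e>0. \<exists>L. L-lipschitz_on (cball x e \<inter> A) f)"

lemma locally_lipschitz_on_compact:
  assumes f: "locally_lipschitz_on A f" and C: "compact C" "C \<subseteq> A"
  obtains L where "L-lipschitz_on C f"
proof -
  \<comment> \<open>A time set with a single point turns \<open>f\<close> into a family, to which
    the compactness theorem for \<open>local_lipschitz\<close> applies.\<close>
  have "local_lipschitz {0::real} A (\<lambda>_. f)"
  proof (rule local_lipschitzI)
    fix t x assume "x \<in> A"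
    then obtain e L where e: "e > 0" "L-lipschitz_on (cball x e \<inter> A) f"
      using f unfolding locally_lipschitz_on_def by blast
    then show "\<exists>u>0. \<exists>L. \<forall>t\<in>cball t u \<inter> {0::real}. L-lipschitz_on (cball x u \<inter> A) f" by blast
  qed
  then have "local_lipschitz {0::real} C (\<lambda>_. f)"
    by (rule local_lipschitz_subset) (use C in auto)
  then obtain L where "\<And>t. t \<in> {0::real} \<Longrightarrow> L-lipschitz_on C f"
    by (rule local_lipschitz_compact_implies_lipschitz) (use C in auto)
  then show ?thesis using that by blast
qed

text \<open>McShane's extension: the infimum of the cones of slope \<open>L\<close> with vertices on
  the graph of \<open>f\<close>. An infimum of \<open>L\<close>-Lipschitz functions is
  \<open>L\<close>-Lipschitz, and over a point of \<open>C\<close> no cone lies below the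
  graph.\<close>

lemma lipschitz_extension_real:
  fixes f :: "'a::metric_space \<Rightarrow> real"
  assumes "L-lipschitz_on C f"
  shows "\<exists>g. L-lipschitz_on UNIV g \<and> (\<forall>x\<in>C. g x = f x)"
proof (cases "C = {}")
  case True
  then show ?thesis using lipschitz_on_nonneg[OF assms]
    by (intro exI[of _ "\<lambda>_. 0"]) (auto simp: lipschitz_on_def)
next
  case False
  then obtain c0 where c0: "c0 \<in> C" by blast
  have L: "L \<ge> 0" by (rule lipschitz_on_nonneg[OF assms])
  have lip: "f c \<le> f d + L * dist c d" if "c \<in> C" "d \<in> C" for c d
    using lipschitz_onD[OF assms that] by (simp add: dist_real_def abs_le_iff)
  define g where "g x = (INF c\<in>C. f c + L * dist x c)" for x
  have bdd: "bdd_below ((\<lambda>c. f c + L * dist x c) ` C)" for x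
  proof (rule bdd_belowI2)
    fix c assume "c \<in> C"
    have "L * dist c0 c \<le> L * (dist x c0 + dist x c)"
      using L by (intro mult_left_mono dist_triangle3) auto
    then show "f c0 - L * dist x c0 \<le> f c + L * dist x c"
      using lip[OF c0 \<open>c \<in> C\<close>] by (simp add: algebra_simps)
  qed
  have "g x \<le> g y + L * dist x y" for x y
  proof -
    have "g x - L * dist x y \<le> g y"
      unfolding g_def[of y]
    proof (rule cINF_greatest[OF False])
      fix c assume "c \<in> C"
      then have "g x \<le> f c + L * dist x c"
        unfolding g_def by (intro cINF_lower bdd)
      moreover have "L * dist x c \<le> L * (dist x y + dist y c)"
        using L by (intro mult_left_mono dist_triangle) auto
      ultimately show "g x - L * dist x y \<le> f c + L * dist y c"
        by (simp add: algebra_simps)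
    qed
    then show ?thesis by simp
  qed
  then have "L-lipschitz_on UNIV g"
    using L by (intro lipschitz_onI) (auto simp: dist_real_def abs_le_iff diff_le_eq add.commute, metis dist_commute)
  moreover have "g x = f x" if "x \<in> C" for x
  proof (rule antisym)
    show "g x \<le> f x" unfolding g_def using cINF_lower[OF bdd that, of x] by simp
    show "f x \<le> g x" unfolding g_def using lip[OF that] by (intro cINF_greatest False) auto
  qed
  ultimately show ?thesis by blast
qed

text \<open>McShane's extension of each coordinate, then truncation to a fixed interval. Truncation
  is 1-Lipschitz and leaves the values on \<open>C\<close> alone, and it makes the extension
  bounded, as \<open>Picard_global\<close> requires.\<close>

lemma lipschitz_extension:
  fixes f :: "'a::metric_space \<Rightarrow> 'b::euclidean_space"
  assumes f: "L-lipschitz_on C f" and bd: "\<And>x. x \<in> C \<Longrightarrow> norm (f x) \<le> B"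
  shows "\<exists>g L' B'. L'-lipschitz_on UNIV g \<and> (\<forall>x. norm (g x) \<le> B') \<and> (\<forall>x\<in>C. g x = f x)"
proof -
  have L: "L \<ge> 0" by (rule lipschitz_on_nonneg[OF f])
  have "\<exists>h. L-lipschitz_on UNIV h \<and> (\<forall>x\<in>C. h x = f x \<bullet> b)" if b: "b \<in> Basis" for b
  proof (rule lipschitz_extension_real)
    show "L-lipschitz_on C (\<lambda>x. f x \<bullet> b)"
    proof (rule lipschitz_onI[OF _ L])
      fix x y assume xy: "x \<in> C" "y \<in> C"
      have "dist (f x \<bullet> b) (f y \<bullet> b) \<le> dist (f x) (f y)"
        using b by (metis Basis_le_norm dist_norm inner_diff_left real_norm_def)
      also have "\<dots> \<le> L * dist x y" by (rule lipschitz_onD[OF f xy])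
      finally show "dist (f x \<bullet> b) (f y \<bullet> b) \<le> L * dist x y" .
    qed
  qed
  then obtain h where h: "\<And>b. b \<in> Basis \<Longrightarrow> L-lipschitz_on UNIV (h b)"
    "\<And>b x. b \<in> Basis \<Longrightarrow> x \<in> C \<Longrightarrow> h b x = f x \<bullet> b" by metis
  \<comment> \<open>For empty \<open>C\<close> the bound \<open>B\<close> may be negative; the
    truncation interval must not be empty.\<close>
  define B' where "B' = max B 0"
  define g where "g x = (\<Sum>b\<in>Basis. max (-B') (min B' (h b x)) *\<^sub>R b)" for x
  have clip: "\<bar>max (-B') (min B' s) - max (-B') (min B' t)\<bar> \<le> \<bar>s - t\<bar>" for s t :: real
    by (auto simp: max_def min_def)
  have "(\<Sum>b\<in>(Basis::'b set). L)-lipschitz_on UNIV g"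
  proof (rule lipschitz_onI)
    fix x y
    have "dist (g x) (g y) = norm (\<Sum>b\<in>Basis. (max (-B') (min B' (h b x)) - max (-B') (min B' (h b y))) *\<^sub>R b)"
      by (simp add: g_def dist_norm scaleR_diff_left sum_subtractf)
    also have "\<dots> \<le> (\<Sum>b\<in>(Basis::'b set). L * dist x y)"
    proof (rule sum_norm_le)
      fix b :: 'b assume b: "b \<in> Basis"
      show "norm ((max (-B') (min B' (h b x)) - max (-B') (min B' (h b y))) *\<^sub>R b) \<le> L * dist x y"
        using b clip[of "h b x" "h b y"] lipschitz_onD[OF h(1)[OF b], of x y]
        by (simp add: dist_real_def)
    qed
    finally show "dist (g x) (g y) \<le> (\<Sum>b\<in>(Basis::'b set). L) * dist x y" by (simp add: sum_distrib_right)
  qed (use L in \<open>auto intro: sum_nonneg\<close>)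
  moreover have "norm (g x) \<le> (\<Sum>b\<in>(Basis::'b set). B')" for x
    unfolding g_def by (rule sum_norm_le) (auto simp: B'_def)
  moreover have "g x = f x" if x: "x \<in> C" for x
  proof -
    have "max (-B') (min B' (h b x)) = f x \<bullet> b" if b: "b \<in> Basis" for b
    proof -
      have "\<bar>f x \<bullet> b\<bar> \<le> B'" using Basis_le_norm[OF b, of "f x"] bd[OF x] by (auto simp: B'_def)
      then show ?thesis using h(2)[OF b x] by (auto simp: max_def min_def)
    qed
    then show ?thesis by (simp add: g_def euclidean_representation)
  qed
  ultimately show ?thesis by blast
qed

section \<open>Uniqueness, invariance and averaging\<close>

lemma norm_triangle4:
  fixes x :: "'a::real_normed_vector"
  assumes "x = a + b + c - d"
  shows "norm x \<le> norm a + norm b + norm c + norm d"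
  unfolding assms
  by (intro order_trans[OF norm_triangle_ineq4] add_mono order_refl order_trans[OF norm_triangle_ineq])

lemma ODE_unique_forward:
  fixes y z :: "real \<Rightarrow> 'b::real_normed_vector"
  assumes y: "\<And>t. t \<in> {a..b} \<Longrightarrow> y t \<in> C \<and> (y has_vector_derivative g t (y t)) (at t)"
    and z: "\<And>t. t \<in> {a..b} \<Longrightarrow> z t \<in> C \<and> (z has_vector_derivative g t (z t)) (at t)"
    and g: "\<And>t. L-lipschitz_on C (g t)" and "y a = z a" and "a \<le> b"
  shows "y b = z b"
proof -
  have L: "L \<ge> 0" using g lipschitz_on_nonneg by blast
  have "norm (y b - z b) \<le> (norm (y a - z a) + 0 * (b - a)) * exp (L * (b - a))"
  proof (rule Dini_Gronwall[where g="\<lambda>t. norm (y t - z t)"])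
    show "continuous_on {a..b} (\<lambda>t. norm (y t - z t))"
      using y z by (intro continuous_intros continuous_at_imp_continuous_on)
        (blast intro: has_vector_derivative_continuous)+
    fix t e :: real assume t: "a \<le> t" "t < b" and "e > 0"
    then have ty: "t \<in> {a..b}" by auto
    have "((\<lambda>t. y t - z t) has_vector_derivative g t (y t) - g t (z t)) (at t)"
      using y[OF ty] z[OF ty] by (intro derivative_intros) auto
    then obtain d where "d > 0" and d: "\<And>s. \<bar>s\<bar> < d \<Longrightarrow>
        norm (y (t + s) - z (t + s) - (y t - z t) - s *\<^sub>R (g t (y t) - g t (z t))) \<le> e * \<bar>s\<bar>"
      using \<open>e > 0\<close> unfolding has_vector_derivative_alt by blast
    have "norm (y (t + s) - z (t + s)) \<le> norm (y t - z t) + s * (L * norm (y t - z t) + 0 + e)"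
      if "0 < s" "s < d" for s
    proof -
      have "norm (y (t + s) - z (t + s)) \<le> norm (y t - z t) + norm (s *\<^sub>R (g t (y t) - g t (z t))) +
         norm (y (t + s) - z (t + s) - (y t - z t) - s *\<^sub>R (g t (y t) - g t (z t)))"
        using norm_triangle4[of "y (t + s) - z (t + s)" "y t - z t" "s *\<^sub>R (g t (y t) - g t (z t))"
          "y (t + s) - z (t + s) - (y t - z t) - s *\<^sub>R (g t (y t) - g t (z t))" 0]
        by simp
      also have "\<dots> \<le> norm (y t - z t) + s * (L * norm (y t - z t)) + e * s"
        using lipschitz_onD[OF g, of "y t" "z t" t] y[OF ty] z[OF ty] that d[of s]
        by (intro add_mono) (auto simp: dist_norm)
      finally show ?thesis by (simp add: algebra_simps)
    qed
    then show "\<exists>d>0. \<forall>s. 0 < s \<and> s < d \<and> t + s \<le> b \<longrightarrow>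
      norm (y (t + s) - z (t + s)) \<le> norm (y t - z t) + s * (L * norm (y t - z t) + 0 + e)"
      using \<open>d > 0\<close> by blast
  qed (use L \<open>a \<le> b\<close> in auto)
  then show ?thesis using \<open>y a = z a\<close> by simp
qed

text \<open>On the segment between the two times both curves stay in one compact set, on which a
  Lipschitz constant uniform in time is available. Times before \<open>t0\<close> are reached by
  reversing time.\<close>

lemma ODE_unique:
  fixes y z :: "real \<Rightarrow> 'b::real_normed_vector"
  assumes y: "\<And>t. t \<in> J \<Longrightarrow> y t \<in> M \<and> (y has_vector_derivative g t (y t)) (at t)"
    and z: "\<And>t. t \<in> J \<Longrightarrow> z t \<in> M \<and> (z has_vector_derivative g t (z t)) (at t)"
    and g: "\<And>C. compact C \<Longrightarrow> C \<subseteq> M \<Longrightarrow> \<exists>L. \<forall>t. L-lipschitz_on C (g t)"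
    and J: "is_interval J" "t0 \<in> J" "t \<in> J" and eq: "y t0 = z t0"
  shows "y t = z t"
proof -
  define a where "a = min t0 t"
  define b where "b = max t0 t"
  have ab: "{a..b} \<subseteq> J"
    using J mem_is_interval_1_I[of J a b] by (auto simp: a_def b_def min_def max_def split: if_splits)
  define C where "C = y ` {a..b} \<union> z ` {a..b}"
  have cont: "continuous_on {a..b} y" "continuous_on {a..b} z"
    using y z ab by (meson continuous_at_imp_continuous_on has_vector_derivative_continuous subsetD)+
  have "compact C" unfolding C_def by (intro compact_Un compact_continuous_image cont) auto
  moreover have "C \<subseteq> M" using y z ab by (auto simp: C_def)
  ultimately obtain L where L: "\<And>t. L-lipschitz_on C (g t)" using g by blast
  have inC: "y s \<in> C" "z s \<in> C" if "s \<in> {a..b}" for s using that by (auto simp: C_def)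
  show ?thesis
  proof (cases "t0 \<le> t")
    case True
    then have "a = t0" "b = t" by (auto simp: a_def b_def)
    then show ?thesis
      using ODE_unique_forward[of a b y C g z L] inC y z ab L eq True by blast
  next
    case False
    then have "a = t" "b = t0" by (auto simp: a_def b_def)
    define y' where "y' s = y (0 - s)" for s
    define z' where "z' s = z (0 - s)" for s
    have "y' (-a) = z' (-a)"
    proof (rule ODE_unique_forward[where a="-b" and C=C and L=L and g="\<lambda>t x. - g (-t) x"])
      show "y' t \<in> C \<and> (y' has_vector_derivative - g (- t) (y' t)) (at t)" if "t \<in> {-b..-a}" for t
      proof -
        have *: "0 - t \<in> {a..b}" using that by auto
        then show ?thesis
          using y[of "0 - t"] ab inC[OF *] has_vector_derivative_reflect[of y "g (-t) (y (-t))" 0 t]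
          unfolding y'_def by auto
      qed
      show "z' t \<in> C \<and> (z' has_vector_derivative - g (- t) (z' t)) (at t)" if "t \<in> {-b..-a}" for t
      proof -
        have *: "0 - t \<in> {a..b}" using that by auto
        then show ?thesis
          using z[of "0 - t"] ab inC[OF *] has_vector_derivative_reflect[of z "g (-t) (z (-t))" 0 t]
          unfolding z'_def by auto
      qed
      show "L-lipschitz_on C (\<lambda>x. - g (- t) x)" for t using L[of "-t"] by (simp add: lipschitz_on_minus)
      show "y' (- b) = z' (- b)" using eq \<open>b = t0\<close> by (simp add: y'_def z'_def)
      show "- b \<le> - a" using False \<open>a = t\<close> \<open>b = t0\<close> by simp
    qed
    then show ?thesis using \<open>a = t\<close> by (simp add: y'_def z'_def)
  qed
qed

text \<open>Nagumo's invariance theorem: compare \<open>y\<close> with the curves in \<open>M\<close> issued from the points of \<open>M\<close>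
  nearest to \<open>y\<close>.\<close>

lemma invariant_forward:
  fixes y :: "real \<Rightarrow> 'b::euclidean_space"
  assumes M: "closed M" and y: "\<And>t. t \<in> {a..b} \<Longrightarrow> (y has_vector_derivative f t (y t)) (at t)"
    and f: "\<And>t. L-lipschitz_on UNIV (f t)" and "y a \<in> M"
    and tangent: "\<And>t p. t \<in> {a..b} \<Longrightarrow> p \<in> M \<Longrightarrow> dist (y t) p = infdist (y t) M \<Longrightarrow>
      \<exists>c. c 0 = p \<and> (\<forall>\<^sub>F s in nhds 0. c s \<in> M) \<and> (c has_vector_derivative f t p) (at 0)"
    and t: "t \<in> {a..b}"
  shows "y t \<in> M"
proof -
  have L: "L \<ge> 0" using f lipschitz_on_nonneg by blast
  have ne: "M \<noteq> {}" using \<open>y a \<in> M\<close> by auto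
  have "infdist (y t) M \<le> (infdist (y a) M + 0 * (t - a)) * exp (L * (t - a))"
  proof (rule Dini_Gronwall[where g="\<lambda>t. infdist (y t) M" and b=b])
    show "continuous_on {a..b} (\<lambda>t. infdist (y t) M)"
      using y by (intro continuous_intros continuous_at_imp_continuous_on)
        (blast intro: has_vector_derivative_continuous)
    fix t e :: real assume t: "a \<le> t" "t < b" and "e > 0"
    then have ty: "t \<in> {a..b}" by auto
    obtain p where p: "p \<in> M" "infdist (y t) M = dist (y t) p"
      using infdist_attains_inf[OF M ne] by blast
    obtain c where c: "c 0 = p" "\<forall>\<^sub>F s in nhds 0. c s \<in> M" "(c has_vector_derivative f t p) (at 0)"
      using tangent[OF ty p(1) p(2)[symmetric]] by blast
    have "e / 2 > 0" using \<open>e > 0\<close> by simp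
    then obtain d1 where "d1 > 0" and d1: "\<And>s. \<bar>s\<bar> < d1 \<Longrightarrow>
        norm (y (t + s) - y t - s *\<^sub>R f t (y t)) \<le> e / 2 * \<bar>s\<bar>"
      using y[OF ty] unfolding has_vector_derivative_alt by blast
    obtain d2 where "d2 > 0" and d2: "\<And>s. \<bar>s\<bar> < d2 \<Longrightarrow>
        norm (c (0 + s) - c 0 - s *\<^sub>R f t p) \<le> e / 2 * \<bar>s\<bar>"
      using c(3) \<open>e / 2 > 0\<close> unfolding has_vector_derivative_alt by blast
    obtain d3 where "d3 > 0" and d3: "\<And>s. \<bar>s\<bar> < d3 \<Longrightarrow> c s \<in> M"
      using c(2) unfolding eventually_nhds_metric dist_real_def by auto
    have "infdist (y (t + s)) M \<le> infdist (y t) M + s * (L * infdist (y t) M + 0 + e)"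
      if "0 < s" "s < min d1 (min d2 d3)" for s
    proof -
      have "infdist (y (t + s)) M \<le> dist (y (t + s)) (c s)"
        using d3 that by (intro infdist_le) auto
      \<comment> \<open>The velocities of \<open>y\<close> and \<open>c\<close> differ by at most
        \<open>L\<close> times the distance of \<open>y t\<close> to \<open>M\<close>, so that
        distance grows at most exponentially, starting from 0.\<close>
      also have "y (t + s) - c s = (y t - p) + s *\<^sub>R (f t (y t) - f t p)
        + (y (t + s) - y t - s *\<^sub>R f t (y t)) - (c s - p - s *\<^sub>R f t p)"
        by (simp add: algebra_simps)
      then have "dist (y (t + s)) (c s) \<le> norm (y t - p) + norm (s *\<^sub>R (f t (y t) - f t p)) +
         norm (y (t + s) - y t - s *\<^sub>R f t (y t)) + norm (c s - p - s *\<^sub>R f t p)"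
        unfolding dist_norm by (rule norm_triangle4)
      also have "\<dots> \<le> norm (y t - p) + s * (L * dist (y t) p) + e / 2 * s + e / 2 * s"
        using lipschitz_onD[OF f, of "y t" p t] d1[of s] d2[of s] that c(1)
        by (intro add_mono) (auto simp: dist_norm)
      finally show ?thesis using p(2) by (simp add: algebra_simps dist_norm)
    qed
    then show "\<exists>d>0. \<forall>s. 0 < s \<and> s < d \<and> t + s \<le> b \<longrightarrow>
      infdist (y (t + s)) M \<le> infdist (y t) M + s * (L * infdist (y t) M + 0 + e)"
      using \<open>d1 > 0\<close> \<open>d2 > 0\<close> \<open>d3 > 0\<close> by (intro exI[of _ "min d1 (min d2 d3)"]) auto
  qed (use L t in \<open>auto simp: infdist_nonneg\<close>)
  also have "\<dots> = 0" using \<open>y a \<in> M\<close> by simp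
  finally show ?thesis
    using infdist_nonneg[of "y t" M] in_closed_iff_infdist_zero[OF M ne] by force
qed

text \<open>The average of the oscillating part is removed by the near-identity change of variables
  \<open>w = y - 1/\<omega> \<Sum> A i (\<omega> t) F i y\<close>; only difference quotients of \<open>F i\<close> along \<open>y\<close> enter, so Lipschitz
  continuity suffices.\<close>

lemma averaging_estimate:
  fixes F :: "'i \<Rightarrow> 'b::real_normed_vector \<Rightarrow> 'b" and L B P a :: real
  assumes I: "finite I" and om: "om > 0"
    and lip: "\<And>i. i \<in> I \<Longrightarrow> L-lipschitz_on UNIV (F i)"
    and bd: "\<And>i x. i \<in> I \<Longrightarrow> norm (F i x) \<le> B"
    and P: "\<And>i t. i \<in> I \<Longrightarrow> \<bar>p i t\<bar> \<le> P" and m: "\<And>i. i \<in> I \<Longrightarrow> \<bar>m i\<bar> \<le> P"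
    and A: "\<And>i t. i \<in> I \<Longrightarrow> \<bar>A i t\<bar> \<le> a"
      "\<And>i t. i \<in> I \<Longrightarrow> (A i has_real_derivative p i t - m i) (at t)"
    and nonneg: "L \<ge> 0" "B \<ge> 0" "P \<ge> 0" "a \<ge> 0"
    and y: "\<And>t. t \<in> {t1..t2} \<Longrightarrow> (y has_vector_derivative (\<Sum>i\<in>I. p i (om * t) *\<^sub>R F i (y t))) (at t)"
    and z: "\<And>t. t \<in> {t1..t2} \<Longrightarrow> (z has_vector_derivative (\<Sum>i\<in>I. m i *\<^sub>R F i (z t))) (at t)"
    and eq: "y t1 = z t1" and t: "t \<in> {t1..t2}"
  shows "norm (y t - z t) \<le> 1 / om * (card I * (a * B) + (card I * (a * B) +
      (card I * (P * L) * (card I * (a * B)) + card I * (a * (L * (card I * (P * B))))) * (t2 - t1))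
      * exp (card I * (P * L) * (t2 - t1)))"
proof -
  define N where "N = real (card I)"
  define k where "k = N * (a * B)"
  define LL where "LL = N * (P * L)"
  define BB where "BB = N * (P * B)"
  have N: "N \<ge> 0" by (simp add: N_def)
  have pos: "k \<ge> 0" "LL \<ge> 0" "BB \<ge> 0" using N nonneg by (auto simp: k_def LL_def BB_def)
  define fav where "fav x = (\<Sum>i\<in>I. m i *\<^sub>R F i x)" for x
  \<comment> \<open>The first-order corrector: its time derivative at a fixed point is the
    oscillating part of the right-hand side, and it has size 1 / om because the primitives
    \<open>A i\<close> are bounded.\<close>
  define v where "v t x = (1 / om) *\<^sub>R (\<Sum>i\<in>I. A i (om * t) *\<^sub>R F i x)" for t x
  have sumN: "(\<Sum>i\<in>I. c) = N * c" for c :: real by (simp add: N_def)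
  have vbd: "norm (v t x) \<le> k / om" for t x
  proof -
    have "norm (\<Sum>i\<in>I. A i (om * t) *\<^sub>R F i x) \<le> (\<Sum>i\<in>I. a * B)"
      using A(1) bd nonneg by (intro sum_norm_le) (auto intro!: mult_mono)
    then show ?thesis unfolding v_def sumN using om by (simp add: k_def divide_right_mono)
  qed
  have favL: "norm (fav x - fav y) \<le> LL * norm (x - y)" for x y
  proof -
    have "norm (fav x - fav y) = norm (\<Sum>i\<in>I. m i *\<^sub>R (F i x - F i y))"
      by (simp add: fav_def sum_subtractf scaleR_diff_right)
    also have "\<dots> \<le> (\<Sum>i\<in>I. P * (L * norm (x - y)))"
    proof (rule sum_norm_le)
      fix i assume i: "i \<in> I"
      show "norm (m i *\<^sub>R (F i x - F i y)) \<le> P * (L * norm (x - y))"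
        using m[OF i] lipschitz_onD[OF lip[OF i], of x y] nonneg
        by (auto simp: dist_norm intro!: mult_mono)
    qed
    finally show ?thesis by (simp add: N_def LL_def mult.assoc)
  qed
  have fbd: "norm (\<Sum>i\<in>I. p i t *\<^sub>R F i x) \<le> BB" for t x
  proof -
    have "norm (\<Sum>i\<in>I. p i t *\<^sub>R F i x) \<le> (\<Sum>i\<in>I. P * B)"
      using P bd nonneg by (intro sum_norm_le) (auto intro!: mult_mono)
    then show ?thesis by (simp add: N_def BB_def)
  qed
  have vL: "norm (v t x - v t x') \<le> N * (a * L) / om * norm (x - x')" for t x x'
  proof -
    have "norm (\<Sum>i\<in>I. A i (om * t) *\<^sub>R (F i x - F i x')) \<le> (\<Sum>i\<in>I. a * (L * norm (x - x')))"
    proof (rule sum_norm_le)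
      fix i assume i: "i \<in> I"
      show "norm (A i (om * t) *\<^sub>R (F i x - F i x')) \<le> a * (L * norm (x - x'))"
        using A(1)[OF i] lipschitz_onD[OF lip[OF i], of x x'] nonneg
        by (auto simp: dist_norm intro!: mult_mono)
    qed
    moreover have "v t x - v t x' = (1 / om) *\<^sub>R (\<Sum>i\<in>I. A i (om * t) *\<^sub>R (F i x - F i x'))"
      by (simp add: v_def sum_subtractf scaleR_diff_right)
    ultimately show ?thesis using om by (simp add: N_def divide_right_mono mult_ac)
  qed
  \<comment> \<open>The two errors of order 1 / om: evaluating the averaged field at
    \<open>y\<close> instead of the corrected point, and the motion of \<open>y\<close> inside the
    corrector.\<close>
  define c where "c = LL * (k / om) + N * (a * L) / om * BB"
  have c: "c \<ge> 0" unfolding c_def using pos N nonneg om by auto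
  define g where "g t = norm (y t - v t (y t) - z t)" for t
  have ycont: "continuous_on {t1..t2} y" and zcont: "continuous_on {t1..t2} z"
    using y z by (meson continuous_at_imp_continuous_on has_vector_derivative_continuous)+
  have Fcont: "continuous_on {t1..t2} (\<lambda>t. F i (y t))" if "i \<in> I" for i
    using continuous_on_compose[OF ycont, of "F i"] lipschitz_on_continuous_on[OF lip[OF that]]
    by (auto simp: o_def intro: continuous_on_subset)
  have Acont: "continuous_on UNIV (A i)" if "i \<in> I" for i
    using A(2)[OF that] by (meson DERIV_continuous continuous_at_imp_continuous_on)
  have Acont': "continuous_on X (\<lambda>t. A i (om * t))" if "i \<in> I" for i X
    by (intro continuous_on_compose2[OF Acont[OF that]] continuous_intros) auto
  have vcont: "continuous_on {t1..t2} (\<lambda>t. v t (y t))"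
    unfolding v_def by (intro continuous_intros Fcont Acont') auto
  have gt1: "g t1 \<le> k / om"
    using vbd[of t1 "y t1"] eq by (simp add: g_def norm_minus_commute)
  have "g t \<le> (g t1 + c * (t - t1)) * exp (LL * (t - t1))"
  proof (rule Dini_Gronwall[where b=t2])
    show "continuous_on {t1..t2} g" unfolding g_def by (intro continuous_intros ycont zcont vcont)
    fix t e :: real assume t: "t1 \<le> t" "t < t2" and "e > 0"
    then have ty: "t \<in> {t1..t2}" by auto
    \<comment> \<open>Freezing the space argument of the corrector at \<open>y t\<close> makes this
      differentiable at \<open>t\<close>. The remaining variation of the corrector is only bounded,
      through its Lipschitz constant.\<close>
    define \<zeta> where "\<zeta> s = y s - z s - v s (y t)" for s
    have "(\<zeta> has_vector_derivative (fav (y t) - fav (z t))) (at t)"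
    proof -
      have "((\<lambda>s. v s (y t)) has_vector_derivative
         (1 / om) *\<^sub>R (\<Sum>i\<in>I. (om * (p i (om * t) - m i)) *\<^sub>R F i (y t))) (at t)"
        unfolding v_def
      proof (intro bounded_linear.has_vector_derivative[OF bounded_linear_scaleR_right]
          has_vector_derivative_sum)
        fix i assume i: "i \<in> I"
        have "((\<lambda>s. A i (om * s)) has_real_derivative om * (p i (om * t) - m i)) (at t)"
        proof -
          have "((\<lambda>s. om * s) has_real_derivative om) (at t)"
            by (auto intro!: derivative_eq_intros)
          from DERIV_chain'[OF this A(2)[OF i]] show ?thesis by (simp add: mult.commute)
        qed
        then show "((\<lambda>s. A i (om * s) *\<^sub>R F i (y t)) has_vector_derivative
            (om * (p i (om * t) - m i)) *\<^sub>R F i (y t)) (at t)"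
          unfolding has_real_derivative_iff_has_vector_derivative
          by (rule bounded_linear.has_vector_derivative[OF bounded_linear_scaleR_left])
      qed
      moreover have "(1 / om) *\<^sub>R (\<Sum>i\<in>I. (om * (p i (om * t) - m i)) *\<^sub>R F i (y t))
          = (\<Sum>i\<in>I. p i (om * t) *\<^sub>R F i (y t)) - fav (y t)"
        using om by (simp add: scaleR_sum_right fav_def sum_subtractf scaleR_diff_left)
      ultimately have v': "((\<lambda>s. v s (y t)) has_vector_derivative (\<Sum>i\<in>I. p i (om * t) *\<^sub>R F i (y t)) - fav (y t)) (at t)"
        by simp
      show ?thesis unfolding \<zeta>_def
        using has_vector_derivative_diff[OF has_vector_derivative_diff[OF y[OF ty] z[OF ty]] v']
        by (simp add: fav_def)
    qed
    moreover have "e / 2 > 0" using \<open>e > 0\<close> by simp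
    ultimately obtain d1 where "d1 > 0" and d1: "\<And>s. \<bar>s\<bar> < d1 \<Longrightarrow>
        norm (\<zeta> (t + s) - \<zeta> t - s *\<^sub>R (fav (y t) - fav (z t))) \<le> e / 2 * \<bar>s\<bar>"
      unfolding has_vector_derivative_alt by blast
    define V where "V = N * (a * L) / om"
    have V: "V \<ge> 0" unfolding V_def using N nonneg om by auto
    \<comment> \<open>Multiplied by the Lipschitz constant \<open>V\<close> of the corrector, this
      tolerance stays below e / 2, also when \<open>V\<close> is 0.\<close>
    have "e / (2 * (V + 1)) > 0" using \<open>e > 0\<close> V by simp
    then obtain d2 where "d2 > 0" and d2: "\<And>s. \<bar>s\<bar> < d2 \<Longrightarrow>
        norm (y (t + s) - y t - s *\<^sub>R (\<Sum>i\<in>I. p i (om * t) *\<^sub>R F i (y t))) \<le> e / (2 * (V + 1)) * \<bar>s\<bar>"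
      using y[OF ty] unfolding has_vector_derivative_alt by blast
    have "g (t + s) \<le> g t + s * (LL * g t + c + e)"
      if s: "0 < s" "s < min d1 d2" for s
    proof -
      define E where "E = (\<Sum>i\<in>I. p i (om * t) *\<^sub>R F i (y t))"
      have dy: "norm (y (t + s) - y t) \<le> s * BB + e / (2 * (V + 1)) * s"
      proof -
        have "norm (y (t + s) - y t) \<le> norm (s *\<^sub>R E) + norm (y (t + s) - y t - s *\<^sub>R E)"
          by (rule order_trans[OF _ norm_triangle_ineq]) simp
        also have "\<dots> \<le> s * BB + e / (2 * (V + 1)) * s"
          using fbd[of "om * t" "y t"] d2[of s] s
          by (intro add_mono) (auto simp: E_def)
        finally show ?thesis .
      qed
      have "y (t + s) - v (t + s) (y (t + s)) - z (t + s)
        = (y t - v t (y t) - z t) + s *\<^sub>R (fav (y t) - fav (z t))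
          + (\<zeta> (t + s) - \<zeta> t - s *\<^sub>R (fav (y t) - fav (z t)))
          - (v (t + s) (y (t + s)) - v (t + s) (y t))"
        by (simp add: \<zeta>_def algebra_simps)
      then have "g (t + s) \<le> g t + norm (s *\<^sub>R (fav (y t) - fav (z t)))
          + norm (\<zeta> (t + s) - \<zeta> t - s *\<^sub>R (fav (y t) - fav (z t)))
          + norm (v (t + s) (y (t + s)) - v (t + s) (y t))"
        unfolding g_def by (rule norm_triangle4)
      also have "\<dots> \<le> g t + s * (LL * (g t + k / om)) + e / 2 * s + V * (s * BB + e / (2 * (V + 1)) * s)"
      proof (intro add_mono order_refl)
        have "norm (y t - z t) \<le> g t + k / om"
          using vbd[of t "y t"] norm_triangle_ineq[of "y t - v t (y t) - z t" "v t (y t)"]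
          by (simp add: g_def)
        then have "LL * norm (y t - z t) \<le> LL * (g t + k / om)" using pos by (intro mult_left_mono)
        then have "norm (fav (y t) - fav (z t)) \<le> LL * (g t + k / om)"
          using favL[of "y t" "z t"] by linarith
        then show "norm (s *\<^sub>R (fav (y t) - fav (z t))) \<le> s * (LL * (g t + k / om))"
          using s by (simp add: mult_left_mono)
        show "norm (\<zeta> (t + s) - \<zeta> t - s *\<^sub>R (fav (y t) - fav (z t))) \<le> e / 2 * s"
          using d1[of s] s by simp
        have "norm (v (t + s) (y (t + s)) - v (t + s) (y t)) \<le> V * norm (y (t + s) - y t)"
          using vL unfolding V_def .
        also have "\<dots> \<le> V * (s * BB + e / (2 * (V + 1)) * s)" by (rule mult_left_mono[OF dy V])
        finally show "norm (v (t + s) (y (t + s)) - v (t + s) (y t)) \<le> \<dots>" .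
      qed
      also have "\<dots> \<le> g t + s * (LL * g t + c + e)"
      proof -
        have "V * (e / (2 * (V + 1)) * s) = V / (V + 1) * (e / 2 * s)"
          using V by (simp add: field_simps)
        also have "\<dots> \<le> 1 * (e / 2 * s)"
          using V \<open>e > 0\<close> s by (intro mult_right_mono) auto
        finally have "V * (e / (2 * (V + 1)) * s) \<le> e / 2 * s" by simp
        define q where "q = V * (s * BB + e / (2 * (V + 1)) * s)"
        have "q \<le> V * (s * BB) + e / 2 * s"
          unfolding q_def distrib_left[of V] using \<open>V * (e / (2 * (V + 1)) * s) \<le> e / 2 * s\<close> by linarith
        moreover have "c = LL * (k / om) + V * BB" by (simp add: c_def V_def)
        ultimately show ?thesis unfolding q_def[symmetric] by (simp add: algebra_simps)
      qed
      finally show ?thesis .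
    qed
    then show "\<exists>d>0. \<forall>s. 0 < s \<and> s < d \<and> t + s \<le> t2 \<longrightarrow> g (t + s) \<le> g t + s * (LL * g t + c + e)"
      using \<open>d1 > 0\<close> \<open>d2 > 0\<close> by (intro exI[of _ "min d1 d2"]) auto
  qed (use pos c t in \<open>auto simp: g_def\<close>)
  also have "\<dots> \<le> (k / om + c * (t2 - t1)) * exp (LL * (t2 - t1))"
    using gt1 pos c t om
    by (intro mult_mono add_mono) (auto intro!: mult_left_mono add_nonneg_nonneg mult_nonneg_nonneg simp: g_def)
  finally have "g t \<le> \<dots>" .
  moreover have "norm (y t - z t) \<le> k / om + g t"
    using vbd[of t "y t"] norm_triangle_ineq[of "y t - v t (y t) - z t" "v t (y t)"]
    by (simp add: g_def)
  ultimately have "norm (y t - z t) \<le> k / om + (k / om + c * (t2 - t1)) * exp (LL * (t2 - t1))" by simp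
  also have "\<dots> = 1 / om * (k + (k + (LL * k + N * (a * (L * BB))) * (t2 - t1)) * exp (LL * (t2 - t1)))"
    using om by (simp add: c_def field_simps)
  finally show ?thesis by (simp add: k_def LL_def BB_def N_def)
qed

section \<open>Solutions on intervals, gluing and maximal solutions\<close>

definition solution_on ::
  "'b::real_normed_vector set \<Rightarrow> (real \<Rightarrow> 'b \<Rightarrow> 'b) \<Rightarrow> real set \<Rightarrow> (real \<Rightarrow> 'b) \<Rightarrow> bool" where
  "solution_on M g J y \<longleftrightarrow> (\<forall>t\<in>J. y t \<in> M \<and> (y has_vector_derivative g t (y t)) (at t))"

definition lipschitz_on_compacts ::
  "'b::metric_space set \<Rightarrow> (real \<Rightarrow> 'b \<Rightarrow> 'c::metric_space) \<Rightarrow> bool" where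
  "lipschitz_on_compacts M g \<longleftrightarrow> (\<forall>C\<subseteq>M. compact C \<longrightarrow> (\<exists>L. \<forall>t. L-lipschitz_on C (g t)))"

lemma solution_on_subset: "solution_on M g J y \<Longrightarrow> I \<subseteq> J \<Longrightarrow> solution_on M g I y"
  unfolding solution_on_def by blast

lemma solution_on_cong:
  assumes "open J" "\<And>t. t \<in> J \<Longrightarrow> y t = z t" "solution_on M g J y"
  shows "solution_on M g J z"
  unfolding solution_on_def
proof
  fix t assume t: "t \<in> J"
  have "(y has_vector_derivative g t (y t)) (at t)" "y t \<in> M"
    using assms(3) t unfolding solution_on_def by auto
  then show "z t \<in> M \<and> (z has_vector_derivative g t (z t)) (at t)"
    using has_vector_derivative_transform_within_open[of y _ t J z] assms(1,2) t by auto
qed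

lemma solution_on_unique:
  assumes g: "lipschitz_on_compacts M g"
    and "solution_on M g J y" "solution_on M g J z" "is_interval J" "t0 \<in> J" "t \<in> J" "y t0 = z t0"
  shows "y t = z t"
  using ODE_unique[of J y M g z t0 t] assms unfolding solution_on_def lipschitz_on_compacts_def by blast

lemma solution_on_glue:
  assumes g: "lipschitz_on_compacts M g"
    and J: "open J1" "open J2" "is_interval J1" "is_interval J2"
    and y: "solution_on M g J1 y1" "solution_on M g J2 y2"
    and t: "t \<in> J1" "t \<in> J2" "y1 t = y2 t"
  obtains y where "solution_on M g (J1 \<union> J2) y" "\<And>t. t \<in> J1 \<Longrightarrow> y t = y1 t" "\<And>t. t \<in> J2 \<Longrightarrow> y t = y2 t"
proof -
  define y where "y s = (if s \<in> J1 then y1 s else y2 s)" for s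
  have "y1 s = y2 s" if s: "s \<in> J1 \<inter> J2" for s
  proof (rule solution_on_unique[OF g])
    show "solution_on M g (J1 \<inter> J2) y1" "solution_on M g (J1 \<inter> J2) y2"
      using y by (auto intro: solution_on_subset)
    show "is_interval (J1 \<inter> J2)" using J by (intro is_interval_Int)
    show "t \<in> J1 \<inter> J2" using t by blast
  qed (use s t in auto)

  have eq1: "y s = y1 s" if "s \<in> J1" for s using that by (auto simp: y_def)
  have eq2: "y s = y2 s" if "s \<in> J2" for s
    using that \<open>\<And>s. s \<in> J1 \<inter> J2 \<Longrightarrow> y1 s = y2 s\<close> by (auto simp: y_def)
  have "solution_on M g J1 y" "solution_on M g J2 y"
    using solution_on_cong[OF J(1) _ y(1), of y] solution_on_cong[OF J(2) _ y(2), of y] eq1 eq2 by auto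
  then have "solution_on M g (J1 \<union> J2) y" unfolding solution_on_def by auto
  then show ?thesis using that eq1 eq2 by blast
qed

text \<open>Everything rests on uniqueness in the new variables. The solutions through the initial
  value agree on overlaps, so their union is a maximal solution; and any maximal solution can be
  glued to \<open>y\<close>, so by maximality its interval already contains the half-line of
  \<open>y\<close>. The margin \<open>e\<close> makes that half-line open at \<open>t0\<close>, and
  \<open>\<xi>\<close> carries the glued curve back to the original variables.\<close>

lemma max_solution_satisfies_via:
  assumes g: "lipschitz_on_compacts M g"
    and sol: "\<And>J x. open J \<Longrightarrow> is_interval J \<Longrightarrow>
       sol J x \<longleftrightarrow> (\<forall>t\<in>J. x t \<in> M) \<and> solution_on M g J (\<lambda>t. \<phi> t (x t))"
    and \<xi>: "\<And>t x. x \<in> M \<Longrightarrow> \<xi> t x \<in> M" "\<And>t x. x \<in> M \<Longrightarrow> \<phi> t (\<xi> t x) = x"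
      "\<And>t x. x \<in> M \<Longrightarrow> \<xi> t (\<phi> t x) = x"
    and y: "e > 0" "solution_on M g {t0 - e<..} y" "y t0 = \<phi> t0 x0" "x0 \<in> M"
    and P: "\<And>t. t \<ge> t0 \<Longrightarrow> P t (y t)"
  shows "max_solution_satisfies sol t0 x0 (\<lambda>x. \<forall>t\<ge>t0. P t (\<phi> t (x t)))"
proof -
  define JJ where "JJ = {t0 - e<..}"
  have JJ: "open JJ" "is_interval JJ" "t0 \<in> JJ" "{t0..} \<subseteq> JJ"
    using \<open>e > 0\<close> by (auto simp: JJ_def is_interval_1)
  have sy: "solution_on M g JJ y" using y by (simp add: JJ_def)
  have trans: "sol J (\<lambda>t. \<xi> t (z t)) \<and> (\<forall>t\<in>J. \<phi> t (\<xi> t (z t)) = z t)"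
    if "open J" "is_interval J" "solution_on M g J z" for J z
  proof -
    have z: "z t \<in> M" if "t \<in> J" for t using that \<open>solution_on M g J z\<close> by (simp add: solution_on_def)
    then show ?thesis
      using sol[OF that(1,2), of "\<lambda>t. \<xi> t (z t)"] \<xi>
        solution_on_cong[OF that(1) _ that(3), of "\<lambda>t. \<phi> t (\<xi> t (z t))"] by auto
  qed
  define F where "F = {(J, z). open J \<and> is_interval J \<and> t0 \<in> J \<and> z t0 = y t0 \<and> solution_on M g J z}"
  have FJJ: "(JJ, y) \<in> F" using JJ sy by (auto simp: F_def)
  define Jm where "Jm = \<Union> (fst ` F)"
  \<comment> \<open>Which of the solutions defined at \<open>t\<close> is chosen does not matter:
    they agree there by uniqueness.\<close>
  define zm where "zm t = snd (SOME p. p \<in> F \<and> t \<in> fst p) t" for t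
  have zm: "zm t = z t" if "(J, z) \<in> F" "t \<in> J" for J z t
  proof -
    define p where "p = (SOME p. p \<in> F \<and> t \<in> fst p)"
    have "p \<in> F \<and> t \<in> fst p" unfolding p_def by (rule someI[of _ "(J, z)"]) (use that in auto)
    then obtain J' z' where p': "p = (J', z')" "(J', z') \<in> F" "t \<in> J'" by (cases p) auto
    have "z' t = z t"
    proof (rule solution_on_unique[OF g])
      show "solution_on M g (J' \<inter> J) z'" "solution_on M g (J' \<inter> J) z"
        using p'(2) that by (auto simp: F_def intro: solution_on_subset)
      show "is_interval (J' \<inter> J)" using p'(2) that by (intro is_interval_Int) (auto simp: F_def)
      show "t0 \<in> J' \<inter> J" "t \<in> J' \<inter> J" "z' t0 = z t0" using p' that by (auto simp: F_def)
    qed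
    then show ?thesis unfolding zm_def p_def[symmetric] p'(1) by simp
  qed
  have Jm: "open Jm" "t0 \<in> Jm" using FJJ JJ by (force simp: Jm_def F_def)+
  have "connected Jm" unfolding Jm_def
    by (rule connected_Union) (auto simp: F_def is_interval_connected)
  then have Jmi: "is_interval Jm" by (simp add: is_interval_connected_1)
  have szm: "solution_on M g Jm zm"
    unfolding solution_on_def
  proof
    fix t assume "t \<in> Jm"
    then obtain J z where Jz: "(J, z) \<in> F" "t \<in> J" by (auto simp: Jm_def)
    then have "solution_on M g J zm"
      using solution_on_cong[of J z zm] zm[OF Jz(1)] by (auto simp: F_def)
    then show "zm t \<in> M \<and> (zm has_vector_derivative g t (zm t)) (at t)"
      using Jz by (auto simp: solution_on_def)
  qed
  have zm0: "zm t0 = y t0" using zm[OF FJJ] JJ by auto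
  have "maximal_solution sol t0 x0 Jm (\<lambda>t. \<xi> t (zm t))"
    unfolding maximal_solution_def
  proof (intro conjI allI impI)
    show "open Jm" "is_interval Jm" "t0 \<in> Jm" by fact+
    show "\<xi> t0 (zm t0) = x0" using zm0 y \<xi> by simp
    show "sol Jm (\<lambda>t. \<xi> t (zm t))" using trans[OF Jm(1) Jmi szm] by simp
    fix J' x assume *: "open J' \<and> is_interval J' \<and> Jm \<subseteq> J' \<and> sol J' x \<and> (\<forall>t\<in>Jm. x t = \<xi> t (zm t))"
    then have "solution_on M g J' (\<lambda>t. \<phi> t (x t))" using sol by blast
    moreover have "x t0 = x0" using * zm0 y \<xi> Jm by simp
    ultimately have "(J', \<lambda>t. \<phi> t (x t)) \<in> F" using * y Jm by (auto simp: F_def)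
    then have "J' \<subseteq> Jm" by (force simp: Jm_def)
    then show "J' = Jm" using * by auto
  qed
  moreover have "{t0..} \<subseteq> J \<and> (\<forall>t\<ge>t0. P t (\<phi> t (x t)))" if x: "maximal_solution sol t0 x0 J x" for J x
  proof -
    have J: "open J" "is_interval J" "t0 \<in> J" "x t0 = x0" "sol J x"
      using x by (auto simp: maximal_solution_def)
    then have xM: "\<And>t. t \<in> J \<Longrightarrow> x t \<in> M" and sx: "solution_on M g J (\<lambda>t. \<phi> t (x t))"
      using sol by blast+
    obtain z where z: "solution_on M g (J \<union> JJ) z" "\<And>t. t \<in> J \<Longrightarrow> z t = \<phi> t (x t)" "\<And>t. t \<in> JJ \<Longrightarrow> z t = y t"
    proof (rule solution_on_glue[OF g J(1) JJ(1) J(2) JJ(2) sx sy J(3) JJ(3)])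
      show "\<phi> t0 (x t0) = y t0" using J(4) y(3) by simp
    qed (rule that)
    have "open (J \<union> JJ)" using J JJ by auto
    moreover have "is_interval (J \<union> JJ)"
      using J JJ by (auto simp: is_interval_connected_1 intro!: connected_Un)
    moreover have "\<forall>t\<in>J. \<xi> t (z t) = x t" using z(2) \<xi> xM by simp
    moreover have "sol (J \<union> JJ) (\<lambda>t. \<xi> t (z t))"
      using trans[OF calculation(1,2) z(1)] by simp
    \<comment> \<open>The glued curve extends \<open>x\<close>, so maximality of \<open>x\<close>
      forbids a larger interval.\<close>
    ultimately have "J \<union> JJ = J"
      using x unfolding maximal_solution_def by (metis Un_upper1)
    then have sub: "JJ \<subseteq> J" by blast
    then have "P t (\<phi> t (x t))" if "t \<ge> t0" for t
      using P[OF that] z(2)[of t] z(3)[of t] that JJ(4) by force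
    then show ?thesis using sub JJ by blast
  qed
  ultimately show ?thesis unfolding max_solution_satisfies_def by blast
qed

text \<open>What averaging needs, free of geometry: periodicity and means enter only through bounded
  primitives \<open>A i\<close> of \<open>p i - m i\<close>, and the manifold only as a closed set
  to which the right-hand side is tangent at each frozen phase \<open>\<tau>\<close>.\<close>

locale oscillating_system =
  fixes M :: "'b::euclidean_space set" and I :: "'i set"
    and p A :: "'i \<Rightarrow> real \<Rightarrow> real" and m :: "'i \<Rightarrow> real" and F :: "'i \<Rightarrow> 'b \<Rightarrow> 'b"
  assumes M: "closed M" and I: "finite I"
    and F: "\<And>i. i \<in> I \<Longrightarrow> locally_lipschitz_on M (F i)"
    and p_cont: "\<And>i. i \<in> I \<Longrightarrow> continuous_on UNIV (p i)"
    and p_bounded: "\<And>i. i \<in> I \<Longrightarrow> bounded (range (p i))"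
    and A_deriv: "\<And>i t. i \<in> I \<Longrightarrow> (A i has_real_derivative p i t - m i) (at t)"
    and A_bounded: "\<And>i. i \<in> I \<Longrightarrow> bounded (range (A i))"
    and tangent: "\<And>\<tau> x. x \<in> M \<Longrightarrow> \<exists>c. c 0 = x \<and> (\<forall>\<^sub>F s in nhds 0. c s \<in> M) \<and>
        (c has_vector_derivative (\<Sum>i\<in>I. p i \<tau> *\<^sub>R F i x)) (at 0)"
begin

definition rhs :: "real \<Rightarrow> 'b \<Rightarrow> 'b" where "rhs \<tau> x = (\<Sum>i\<in>I. p i \<tau> *\<^sub>R F i x)"

definition avg :: "'b \<Rightarrow> 'b" where "avg x = (\<Sum>i\<in>I. m i *\<^sub>R F i x)"

lemma uniform_bounds:
  obtains P a where "P \<ge> 0" "a \<ge> 0" "\<And>i t. i \<in> I \<Longrightarrow> \<bar>p i t\<bar> \<le> P" "\<And>i t. i \<in> I \<Longrightarrow> \<bar>A i t\<bar> \<le> a"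
    "\<And>i. i \<in> I \<Longrightarrow> \<bar>m i\<bar> \<le> P"
proof -
  have *: "\<exists>b\<ge>0. \<forall>i\<in>I. \<forall>t. \<bar>q i t\<bar> \<le> b" if "\<And>i. i \<in> I \<Longrightarrow> bounded (range (q i))" for q :: "'i \<Rightarrow> real \<Rightarrow> real"
  proof -
    have "bounded (\<Union>i\<in>I. range (q i))" using I that by (intro bounded_UN) auto
    then obtain b where "b > 0" "\<forall>x\<in>(\<Union>i\<in>I. range (q i)). norm x \<le> b" unfolding bounded_pos by blast
    then show ?thesis by (intro exI[of _ b]) auto
  qed
  obtain P a where P: "P \<ge> 0" "\<forall>i\<in>I. \<forall>t. \<bar>p i t\<bar> \<le> P" and a: "a \<ge> 0" "\<forall>i\<in>I. \<forall>t. \<bar>A i t\<bar> \<le> a"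
    using *[of p] *[of A] p_bounded A_bounded by blast
  define P' where "P' = P + (\<Sum>i\<in>I. \<bar>m i\<bar>)"
  have "0 \<le> (\<Sum>i\<in>I. \<bar>m i\<bar>)" by (simp add: sum_nonneg)
  moreover have "\<bar>m i\<bar> \<le> (\<Sum>i\<in>I. \<bar>m i\<bar>)" if "i \<in> I" for i using I that member_le_sum[of i I "\<lambda>i. \<bar>m i\<bar>"] by auto
  ultimately have "P' \<ge> 0" "\<And>i t. i \<in> I \<Longrightarrow> \<bar>p i t\<bar> \<le> P'" "\<And>i. i \<in> I \<Longrightarrow> \<bar>m i\<bar> \<le> P'"
    using P by (auto simp: P'_def intro: add_increasing add_increasing2)
  then show ?thesis using a by (intro that[of P' a]) auto
qed

text \<open>Stated for arbitrary \<open>G\<close>, as it serves both the fields \<open>F\<close> on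
  compact subsets of \<open>M\<close> and their extensions to the whole space. Boundedness of
  \<open>p\<close> makes the constant independent of the phase.\<close>

lemma rhs_lipschitz:
  fixes G :: "'i \<Rightarrow> 'b \<Rightarrow> 'b"
  assumes "\<And>i. i \<in> I \<Longrightarrow> L-lipschitz_on C (G i)" "L \<ge> 0"
  shows "\<exists>L'. \<forall>\<tau>. L'-lipschitz_on C (\<lambda>x. \<Sum>i\<in>I. p i \<tau> *\<^sub>R G i x)"
proof -
  obtain P a where P: "P \<ge> 0" "\<And>i t. i \<in> I \<Longrightarrow> \<bar>p i t\<bar> \<le> P" using uniform_bounds by metis
  have "(card I * (P * L))-lipschitz_on C (\<lambda>x. \<Sum>i\<in>I. p i \<tau> *\<^sub>R G i x)" for \<tau>
  proof (rule lipschitz_onI)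
    fix x y assume xy: "x \<in> C" "y \<in> C"
    have "dist (\<Sum>i\<in>I. p i \<tau> *\<^sub>R G i x) (\<Sum>i\<in>I. p i \<tau> *\<^sub>R G i y) = norm (\<Sum>i\<in>I. p i \<tau> *\<^sub>R (G i x - G i y))"
      by (simp add: dist_norm sum_subtractf scaleR_diff_right)
    also have "\<dots> \<le> (\<Sum>i\<in>I. P * (L * dist x y))"
    proof (rule sum_norm_le)
      fix i assume i: "i \<in> I"
      show "norm (p i \<tau> *\<^sub>R (G i x - G i y)) \<le> P * (L * dist x y)"
        using P(2)[OF i] lipschitz_onD[OF assms(1)[OF i] xy] P(1)
        by (auto simp: dist_norm intro!: mult_mono)
    qed
    finally show "dist (\<Sum>i\<in>I. p i \<tau> *\<^sub>R G i x) (\<Sum>i\<in>I. p i \<tau> *\<^sub>R G i y) \<le> card I * (P * L) * dist x y"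
      by (simp add: mult.assoc)
  qed (use P assms in auto)
  then show ?thesis by blast
qed

lemma rhs_lipschitz_compact: "lipschitz_on_compacts M (\<lambda>t. rhs (om * t))"
  unfolding lipschitz_on_compacts_def
proof (intro allI impI)
  fix C assume assms: "C \<subseteq> M" "compact C"
  have "\<exists>L. L-lipschitz_on C (F i)" if "i \<in> I" for i
    using locally_lipschitz_on_compact[OF F[OF that] assms(2,1)] by blast
  then obtain L where L: "\<And>i. i \<in> I \<Longrightarrow> (L i)-lipschitz_on C (F i)" by metis
  define L' where "L' = (\<Sum>i\<in>I. L i)"
  have L0: "0 \<le> L i" if "i \<in> I" for i using lipschitz_on_nonneg[OF L[OF that]] .
  have "L'-lipschitz_on C (F i)" if "i \<in> I" for i
    using L[OF that] by (rule lipschitz_on_mono) (use I that L0 in \<open>auto simp: L'_def intro: member_le_sum\<close>)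
  moreover have "L' \<ge> 0" unfolding L'_def using L0 by (intro sum_nonneg) auto
  ultimately obtain LL where "\<forall>\<tau>. LL-lipschitz_on C (\<lambda>x. \<Sum>i\<in>I. p i \<tau> *\<^sub>R F i x)"
    using rhs_lipschitz[of L' C F] by blast
  then show "\<exists>L. \<forall>t. L-lipschitz_on C (rhs (om * t))" unfolding rhs_def by blast
qed

text \<open>Packs all that is used later about the extended fields \<open>G\<close>: agreement with
  \<open>F\<close> near \<open>C\<close>, global solvability, two-sided short-time invariance of
  \<open>M\<close>, and closeness to averaged trajectories. Each \<open>G i\<close> extends
  \<open>F i\<close> from a large ball in \<open>M\<close>. The threshold \<open>om0\<close> serves
  all initial times because \<open>p\<close> and \<open>A\<close> are bounded on the whole
  line.\<close>

lemma finite_time_approximation: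
  assumes C: "bounded C"
  obtains G where
    "\<forall>i\<in>I. \<forall>x\<in>M. \<forall>c\<in>C. dist x c \<le> 1 \<longrightarrow> G i x = F i x"
    "\<forall>om t0 x0. \<exists>y. y t0 = x0 \<and> (\<forall>t. (y has_vector_derivative (\<Sum>i\<in>I. p i (om * t) *\<^sub>R G i (y t))) (at t))"
    "\<forall>om y t0. (\<forall>t. (y has_vector_derivative (\<Sum>i\<in>I. p i (om * t) *\<^sub>R G i (y t))) (at t)) \<longrightarrow> y t0 \<in> M \<inter> C \<longrightarrow>
       (\<exists>e>0. \<forall>t. \<bar>t - t0\<bar> \<le> e \<longrightarrow> y t \<in> M)"
    "\<forall>D \<eta>. D > 0 \<longrightarrow> \<eta> > 0 \<longrightarrow> \<eta> \<le> 1 \<longrightarrow> (\<exists>om0>0. \<forall>om\<ge>om0. \<forall>t1 y z.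
       (\<forall>t. (y has_vector_derivative (\<Sum>i\<in>I. p i (om * t) *\<^sub>R G i (y t))) (at t)) \<longrightarrow> y t1 \<in> M \<longrightarrow> z t1 = y t1 \<longrightarrow>
       (\<forall>t\<ge>t1. z t \<in> M \<inter> C \<and> (z has_vector_derivative avg (z t)) (at t)) \<longrightarrow>
       (\<forall>t\<in>{t1..t1 + D}. y t \<in> M \<and> dist (y t) (z t) \<le> \<eta>))"
proof -
  obtain r where r: "r > 0" "\<And>c. c \<in> C \<Longrightarrow> norm c \<le> r" using C unfolding bounded_pos by blast
  \<comment> \<open>If \<open>x\<close> and some \<open>k\<close> in \<open>M\<close> have norm at
    most r + 1, then a point of \<open>M\<close> nearest to \<open>x\<close> has norm at most |x| +
    |x - k|, hence at most 3 (r + 1). So tangency of \<open>G\<close> holds at all nearest points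
    that occur below.\<close>
  define R where "R = 3 * (r + 1)"
  define MR where "MR = M \<inter> cball 0 R"
  have MR: "compact MR" "MR \<subseteq> M" using M by (auto simp: MR_def compact_Int_closed closed_Int_compact)
  have "\<exists>G L B. L-lipschitz_on UNIV G \<and> (\<forall>x. norm (G x) \<le> B) \<and> (\<forall>x\<in>MR. G x = F i x)" if i: "i \<in> I" for i
  proof -
    obtain L where L: "L-lipschitz_on MR (F i)"
      using locally_lipschitz_on_compact[OF F[OF i] MR] by blast
    have "bounded (F i ` MR)"
      by (intro compact_imp_bounded compact_continuous_image MR lipschitz_on_continuous_on[OF L])
    then obtain B where "\<And>x. x \<in> MR \<Longrightarrow> norm (F i x) \<le> B" unfolding bounded_iff by blast
    from lipschitz_extension[OF L this] show ?thesis by blast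
  qed
  then obtain G L B where G: "\<And>i. i \<in> I \<Longrightarrow> (L i)-lipschitz_on UNIV (G i)"
    "\<And>i x. i \<in> I \<Longrightarrow> norm (G i x) \<le> B i" "\<And>i x. i \<in> I \<Longrightarrow> x \<in> MR \<Longrightarrow> G i x = F i x" by metis
  define L' where "L' = (\<Sum>i\<in>I. L i)"
  define B' where "B' = (\<Sum>i\<in>I. B i)"
  have L0: "0 \<le> L i" if "i \<in> I" for i using lipschitz_on_nonneg[OF G(1)[OF that]] .
  have B0: "0 \<le> B i" if "i \<in> I" for i using order_trans[OF norm_ge_zero G(2)[OF that]] .
  have L': "L' \<ge> 0" and B': "B' \<ge> 0" unfolding L'_def B'_def using L0 B0 by (auto intro: sum_nonneg)
  have GL: "L'-lipschitz_on UNIV (G i)" if "i \<in> I" for i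
    using G(1)[OF that] by (rule lipschitz_on_mono) (use I that L0 in \<open>auto simp: L'_def intro: member_le_sum\<close>)
  have GB: "norm (G i x) \<le> B'" if i: "i \<in> I" for i x
  proof -
    have "B i \<le> B'" unfolding B'_def by (rule member_le_sum) (use I i B0 in auto)
    then show ?thesis using G(2)[OF i, of x] by linarith
  qed
  obtain P a where Pa: "P \<ge> 0" "a \<ge> 0" "\<And>i t. i \<in> I \<Longrightarrow> \<bar>p i t\<bar> \<le> P" "\<And>i t. i \<in> I \<Longrightarrow> \<bar>A i t\<bar> \<le> a"
    "\<And>i. i \<in> I \<Longrightarrow> \<bar>m i\<bar> \<le> P" using uniform_bounds by metis
  obtain LL where LL: "\<And>\<tau>. LL-lipschitz_on UNIV (\<lambda>x. \<Sum>i\<in>I. p i \<tau> *\<^sub>R G i x)"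
    using rhs_lipschitz[of L' UNIV G] GL L' by blast
  have Gcont: "continuous_on UNIV (G i)" if "i \<in> I" for i
    using lipschitz_on_continuous_on[OF GL[OF that]] .
  have fbd: "norm (\<Sum>i\<in>I. p i \<tau> *\<^sub>R G i x) \<le> card I * (P * B')" for \<tau> x
  proof -
    have "norm (\<Sum>i\<in>I. p i \<tau> *\<^sub>R G i x) \<le> (\<Sum>i\<in>I. P * B')"
      using Pa GB by (intro sum_norm_le) (auto intro!: mult_mono)
    then show ?thesis by simp
  qed
  have inMR: "x \<in> MR" if "x \<in> M" "c \<in> C" "dist x c \<le> 1" for x c
  proof -
    have "norm x \<le> norm c + dist x c" using norm_triangle_sub[of x c] by (simp add: dist_norm)
    then show ?thesis using that r by (force simp: MR_def R_def)
  qed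
  have tangentG: "\<exists>c. c 0 = q \<and> (\<forall>\<^sub>F s in nhds 0. c s \<in> M) \<and> (c has_vector_derivative (\<Sum>i\<in>I. p i \<tau> *\<^sub>R G i q)) (at 0)"
    if "norm x \<le> r + 1" "k \<in> M" "norm k \<le> r + 1" "q \<in> M" "dist x q = infdist x M" for x q k \<tau>
  proof -
    have "norm q \<le> norm x + dist x q" by (metis dist_norm dist_commute norm_triangle_sub)
    also have "dist x q \<le> dist x k" using that infdist_le by metis
    also have "dist x k \<le> norm x + norm k" by (simp add: dist_norm norm_triangle_ineq4)
    finally have "q \<in> MR" using that by (auto simp: MR_def R_def)
    then have "(\<Sum>i\<in>I. p i \<tau> *\<^sub>R G i q) = (\<Sum>i\<in>I. p i \<tau> *\<^sub>R F i q)" using G by (intro sum.cong) auto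
    then show ?thesis using tangent[OF \<open>q \<in> M\<close>] by metis
  qed
  show ?thesis
  proof (rule that; (intro allI impI ballI)?)
    show "G i x = F i x" if "i \<in> I" "x \<in> M" "c \<in> C" "dist x c \<le> 1" for i x c
      using G(3) inMR that by blast
    show "\<exists>y. y t0 = x0 \<and> (\<forall>t. (y has_vector_derivative (\<Sum>i\<in>I. p i (om * t) *\<^sub>R G i (y t))) (at t))" for om t0 x0
    proof (rule Picard_global[where f="\<lambda>t x. \<Sum>i\<in>I. p i (om * t) *\<^sub>R G i x", OF _ LL fbd])
      have "continuous_on UNIV (\<lambda>z. \<Sum>i\<in>I. p i (om * fst z) *\<^sub>R G i (snd z))"
      proof (intro continuous_intros)
        fix i assume i: "i \<in> I"
        show "continuous_on UNIV (\<lambda>z::real \<times> 'b. p i (om * fst z))"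
          by (rule continuous_on_compose2[OF p_cont[OF i]]) (auto intro!: continuous_intros)
        show "continuous_on UNIV (\<lambda>z::real \<times> 'b. G i (snd z))"
          by (rule continuous_on_compose2[OF Gcont[OF i]]) (auto intro!: continuous_intros)
      qed
      then show "continuous_on UNIV (\<lambda>(t, x). \<Sum>i\<in>I. p i (om * t) *\<^sub>R G i x)" by (simp add: case_prod_unfold)
    qed
    show "\<exists>e>0. \<forall>t. \<bar>t - t0\<bar> \<le> e \<longrightarrow> y t \<in> M"
      if "\<forall>t. (y has_vector_derivative (\<Sum>i\<in>I. p i (om * t) *\<^sub>R G i (y t))) (at t)" and t0: "y t0 \<in> M \<inter> C" for om y t0
    proof -
      note y = that(1)[rule_format]
      have "continuous (at t0) y" using y has_vector_derivative_continuous by blast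
      then obtain d where d: "d > 0" "\<And>t. \<bar>t - t0\<bar> < d \<Longrightarrow> dist (y t) (y t0) < 1"
        unfolding continuous_at_eps_delta by (metis dist_real_def zero_less_one)
      define e where "e = d / 2"
      have e: "e > 0" "\<And>t. \<bar>t - t0\<bar> \<le> e \<Longrightarrow> norm (y t) \<le> r + 1"
      proof -
        show "e > 0" using d by (simp add: e_def)
        fix t assume "\<bar>t - t0\<bar> \<le> e"
        then have "dist (y t) (y t0) < 1" using d by (intro d) (auto simp: e_def)
        then show "norm (y t) \<le> r + 1"
          using norm_triangle_sub[of "y t" "y t0"] r(2)[of "y t0"] t0 by (auto simp: dist_norm)
      qed
      have k: "y t0 \<in> M" "norm (y t0) \<le> r + 1" using t0 r(2)[of "y t0"] by auto
      have fwd: "y t \<in> M" if "t0 \<le> t" "t \<le> t0 + e" for t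
      proof (rule invariant_forward[where a=t0 and b="t0 + e" and y=y and f="\<lambda>t x. \<Sum>i\<in>I. p i (om * t) *\<^sub>R G i x" and L=LL])
        fix t q assume "t \<in> {t0..t0 + e}" "q \<in> M" "dist (y t) q = infdist (y t) M"
        then show "\<exists>c. c 0 = q \<and> (\<forall>\<^sub>F s in nhds 0. c s \<in> M) \<and>
            (c has_vector_derivative (\<Sum>i\<in>I. p i (om * t) *\<^sub>R G i q)) (at 0)"
          by (intro tangentG[OF _ k]) (auto intro!: e)
      qed (use M y LL k that in auto)
      \<comment> \<open>The same argument backward in time: reversing a curve in \<open>M\<close>
        reverses its velocity, so the reversed field is tangent as well.\<close>
      define w where "w s = y (t0 - s)" for s
      have bwd: "w t \<in> M" if "0 \<le> t" "t \<le> e" for t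
      proof (rule invariant_forward[where a=0 and b="e" and y=w and f="\<lambda>t x. - (\<Sum>i\<in>I. p i (om * (t0 - t)) *\<^sub>R G i x)" and L=LL])
        fix t q assume *: "t \<in> {0..e}" "q \<in> M" "dist (w t) q = infdist (w t) M"
        have "norm (y (t0 - t)) \<le> r + 1" using * by (intro e) auto
        then obtain c where c: "c 0 = q" "\<forall>\<^sub>F s in nhds 0. c s \<in> M"
            "(c has_vector_derivative (\<Sum>i\<in>I. p i (om * (t0 - t)) *\<^sub>R G i q)) (at 0)"
          using tangentG[OF _ k *(2), of "w t" "om * (t0 - t)"] * unfolding w_def by blast
        have "\<forall>\<^sub>F s in nhds 0. c (0 - s) \<in> M"
          using c(2) unfolding eventually_nhds_metric by (auto simp: dist_real_def)
        moreover have "((\<lambda>s. c (0 - s)) has_vector_derivative - (\<Sum>i\<in>I. p i (om * (t0 - t)) *\<^sub>R G i q)) (at 0)"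
          using c(3) by (intro has_vector_derivative_reflect) simp
        ultimately show "\<exists>c. c 0 = q \<and> (\<forall>\<^sub>F s in nhds 0. c s \<in> M) \<and>
            (c has_vector_derivative - (\<Sum>i\<in>I. p i (om * (t0 - t)) *\<^sub>R G i q)) (at 0)"
          using c(1) by (intro exI[of _ "\<lambda>s. c (0 - s)"]) auto
      next
        show "(w has_vector_derivative - (\<Sum>i\<in>I. p i (om * (t0 - t)) *\<^sub>R G i (w t))) (at t)" for t
          unfolding w_def by (intro has_vector_derivative_reflect y)
        show "LL-lipschitz_on UNIV (\<lambda>x. - (\<Sum>i\<in>I. p i (om * (t0 - t)) *\<^sub>R G i x))" for t
          using LL by (simp add: lipschitz_on_minus)
      qed (use M k that in \<open>auto simp: w_def\<close>)
      have "y t \<in> M" if "\<bar>t - t0\<bar> \<le> e" for t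
        using fwd[of t] bwd[of "t0 - t"] that by (cases "t0 \<le> t") (auto simp: w_def)
      then show ?thesis using e(1) by blast
    qed
    show "\<exists>om0>0. \<forall>om\<ge>om0. \<forall>t1 y z.
       (\<forall>t. (y has_vector_derivative (\<Sum>i\<in>I. p i (om * t) *\<^sub>R G i (y t))) (at t)) \<longrightarrow> y t1 \<in> M \<longrightarrow> z t1 = y t1 \<longrightarrow>
       (\<forall>t\<ge>t1. z t \<in> M \<inter> C \<and> (z has_vector_derivative avg (z t)) (at t)) \<longrightarrow>
       (\<forall>t\<in>{t1..t1 + D}. y t \<in> M \<and> dist (y t) (z t) \<le> \<eta>)" if D: "D > 0" and \<eta>: "\<eta> > 0" "\<eta> \<le> 1" for D \<eta>
    proof -
      define N where "N = card I"
      \<comment> \<open>The factor of 1 / om in \<open>averaging_estimate\<close> for a time span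
        \<open>D\<close>; the initial time does not enter.\<close>
      define \<kappa> where "\<kappa> = N * (a * B') + (N * (a * B') +
        (N * (P * L') * (N * (a * B')) + N * (a * (L' * (N * (P * B'))))) * D) * exp (N * (P * L') * D)"
      have \<kappa>: "\<kappa> \<ge> 0" unfolding \<kappa>_def using Pa L' B' D by auto
      \<comment> \<open>The distance is at most \<kappa> / om, hence at most \<eta> from here on;
        the summand 1 keeps \<open>om0\<close> positive.\<close>
      define om0 where "om0 = (\<kappa> + 1) / \<eta>"
      have om0: "om0 > 0" using \<kappa> \<eta> by (simp add: om0_def)
      have "y t \<in> M \<and> dist (y t) (z t) \<le> \<eta>"
        if om: "om \<ge> om0" and y: "\<And>t. (y has_vector_derivative (\<Sum>i\<in>I. p i (om * t) *\<^sub>R G i (y t))) (at t)"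
          and y1: "y t1 \<in> M" "z t1 = y t1" and z: "\<And>t. t \<ge> t1 \<Longrightarrow> z t \<in> M \<inter> C \<and> (z has_vector_derivative avg (z t)) (at t)"
          and t: "t \<in> {t1..t1 + D}" for om t1 y z t
      proof -
        have om_pos: "om > 0" using om om0 by simp
        \<comment> \<open>This makes no use of invariance for \<open>y\<close>: only
          \<open>z\<close> has to stay in M \<inter> C, where \<open>avg\<close> is also the average
          of the extended fields. The closeness then confines \<open>y\<close> to a ball in which
          nearest points are under control.\<close>
        have close: "dist (y t) (z t) \<le> \<eta>" if t: "t \<in> {t1..t1 + D}" for t
        proof -
          have "norm (y t - z t) \<le> 1 / om * \<kappa>"
            unfolding \<kappa>_def N_def
          proof (rule order_trans[OF averaging_estimate[where F=G and p=p and m=m and A=A and a=a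
                  and P=P and L=L' and B=B' and ?t1.0=t1 and ?t2.0="t1 + D", OF I om_pos GL GB]])
            fix s assume s: "s \<in> {t1..t1 + D}"
            have "avg (z s) = (\<Sum>i\<in>I. m i *\<^sub>R G i (z s))"
              unfolding avg_def using z[of s] s inMR[of "z s" "z s"] G(3)
              by (intro sum.cong) auto
            then show "(z has_vector_derivative (\<Sum>i\<in>I. m i *\<^sub>R G i (z s))) (at s)"
              using z[of s] s by auto
          qed (use Pa L' B' y y1 t A_deriv in auto)
          also have "\<dots> \<le> 1 / om0 * \<kappa>"
            using om om0 \<kappa> by (intro mult_right_mono) (auto simp: frac_le)
          also have "\<dots> \<le> \<eta>" using \<kappa> \<eta> by (simp add: om0_def field_simps)
          finally show ?thesis by (simp add: dist_norm)
        qed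
        have nb: "norm (y t) \<le> r + 1" if t: "t \<in> {t1..t1 + D}" for t
          using close[OF t] norm_triangle_sub[of "y t" "z t"] z[of t] t r(2)[of "z t"] \<eta>
          by (auto simp: dist_norm)
        have k: "y t1 \<in> M" "norm (y t1) \<le> r + 1" using y1 nb[of t1] D by auto
        have "y t \<in> M"
        proof (rule invariant_forward[where a=t1 and b="t1 + D" and y=y and f="\<lambda>t x. \<Sum>i\<in>I. p i (om * t) *\<^sub>R G i x" and L=LL])
          fix t q assume "t \<in> {t1..t1 + D}" "q \<in> M" "dist (y t) q = infdist (y t) M"
          then show "\<exists>c. c 0 = q \<and> (\<forall>\<^sub>F s in nhds 0. c s \<in> M) \<and>
              (c has_vector_derivative (\<Sum>i\<in>I. p i (om * t) *\<^sub>R G i q)) (at 0)"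
            by (intro tangentG[OF _ k]) (auto intro!: nb)
        qed (use M y LL k t in auto)
        then show ?thesis using close t by blast
      qed
      then show ?thesis using om0 by blast
    qed
  qed
qed

end

section \<open>Practical stability and attractivity\<close>

lemma bounded_infdist_le:
  fixes K :: "'b::heine_borel set"
  assumes "compact K" "K \<noteq> {}"
  shows "bounded {x. infdist x K \<le> r}"
proof -
  obtain a b where ab: "\<And>x. x \<in> K \<Longrightarrow> dist a x \<le> b"
    using compact_imp_bounded[OF assms(1)] unfolding bounded_def by blast
  have "dist a x \<le> b + r" if x: "infdist x K \<le> r" for x
  proof -
    obtain k where "k \<in> K" "infdist x K = dist x k"
      using infdist_attains_inf[OF compact_imp_closed[OF assms(1)] assms(2)] by blast
    then show ?thesis using ab[of k] x dist_triangle[of a x k] by (simp add: dist_commute)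
  qed
  then show ?thesis unfolding bounded_def by blast
qed

context oscillating_system
begin

text \<open>Time is cut into segments of length \<open>D\<close>. On each, \<open>y\<close> is
  compared with two averaged trajectories issued from \<open>y t1\<close>: the one given by
  stability keeps \<open>y\<close> within \<epsilon> during the whole segment, the one given by
  attractivity brings it back within \<delta> at the end. Errors do not accumulate, because every
  segment starts afresh from the \<delta>-neighbourhood.\<close>

lemma practical_stability:
  assumes K: "compact K" "K \<noteq> {}"
    and r0: "r0 > 0" "\<forall>x\<in>M. infdist x K \<le> r0 \<longrightarrow> x \<in> S"
    and H1: "\<forall>\<epsilon>>0. \<exists>\<delta>>0. \<forall>t0. \<forall>x0\<in>M. infdist x0 K \<le> \<delta> \<longrightarrow>
      (\<exists>z. z t0 = x0 \<and> solution_on M (\<lambda>_. avg) {t0..} z \<and> (\<forall>t\<ge>t0. infdist (z t) K \<le> \<epsilon>))"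
    and H2: "\<forall>r>0. \<forall>\<epsilon>>0. \<exists>\<Delta>>0. \<exists>\<rho>>0. \<forall>t0. \<forall>x0\<in>S. infdist x0 K \<le> r \<longrightarrow>
      (\<exists>z. z t0 = x0 \<and> solution_on M (\<lambda>_. avg) {t0..} z \<and> (\<forall>t\<ge>t0. infdist (z t) K \<le> \<rho>) \<and>
        (\<forall>t\<ge>t0 + \<Delta>. infdist (z t) K \<le> \<epsilon>))"
    and "\<epsilon> > 0"
  shows "\<exists>om0>0. \<exists>\<delta>>0. \<forall>om\<ge>om0. \<forall>t0. \<forall>x0\<in>M. infdist x0 K \<le> \<delta> \<longrightarrow>
    (\<exists>e>0. \<exists>y. y t0 = x0 \<and> solution_on M (\<lambda>t. rhs (om * t)) {t0 - e<..} y \<and> (\<forall>t\<ge>t0. infdist (y t) K \<le> \<epsilon>))"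
proof -
  obtain \<delta>1 where \<delta>1: "\<delta>1 > 0" "\<And>t0 x0. x0 \<in> M \<Longrightarrow> infdist x0 K \<le> \<delta>1 \<Longrightarrow>
      \<exists>z. z t0 = x0 \<and> solution_on M (\<lambda>_. avg) {t0..} z \<and> (\<forall>t\<ge>t0. infdist (z t) K \<le> \<epsilon> / 2)"
    using H1[rule_format, of "\<epsilon> / 2"] \<open>\<epsilon> > 0\<close> by auto
  \<comment> \<open>Staying below \<open>r0\<close> puts the starting point of every segment into
    \<open>S\<close>, so that attractivity applies there.\<close>
  define \<delta> where "\<delta> = min \<delta>1 r0"
  have \<delta>: "\<delta> > 0" "\<delta> \<le> \<delta>1" "\<delta> \<le> r0" using \<delta>1 r0 by (auto simp: \<delta>_def)
  have "\<delta> / 2 > 0" using \<delta> by simp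
  from H2[rule_format, OF \<delta>(1) this] obtain D \<rho> where D: "D > 0" "\<rho> > 0" "\<And>t0 x0. x0 \<in> S \<Longrightarrow> infdist x0 K \<le> \<delta> \<Longrightarrow>
      \<exists>z. z t0 = x0 \<and> solution_on M (\<lambda>_. avg) {t0..} z \<and> (\<forall>t\<ge>t0. infdist (z t) K \<le> \<rho>) \<and>
        (\<forall>t\<ge>t0 + D. infdist (z t) K \<le> \<delta> / 2)" by blast
  define C where "C = {x. infdist x K \<le> max (\<epsilon> / 2) \<rho>}"
  have "bounded C" unfolding C_def using bounded_infdist_le[OF K] .
  then obtain G where
    "\<forall>i\<in>I. \<forall>x\<in>M. \<forall>c\<in>C. dist x c \<le> 1 \<longrightarrow> G i x = F i x"
    "\<forall>om t0 x0. \<exists>y. y t0 = x0 \<and> (\<forall>t. (y has_vector_derivative (\<Sum>i\<in>I. p i (om * t) *\<^sub>R G i (y t))) (at t))"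
    "\<forall>om y t0. (\<forall>t. (y has_vector_derivative (\<Sum>i\<in>I. p i (om * t) *\<^sub>R G i (y t))) (at t)) \<longrightarrow> y t0 \<in> M \<inter> C \<longrightarrow>
       (\<exists>e>0. \<forall>t. \<bar>t - t0\<bar> \<le> e \<longrightarrow> y t \<in> M)"
    "\<forall>D \<eta>. D > 0 \<longrightarrow> \<eta> > 0 \<longrightarrow> \<eta> \<le> 1 \<longrightarrow> (\<exists>om0>0. \<forall>om\<ge>om0. \<forall>t1 y z.
       (\<forall>t. (y has_vector_derivative (\<Sum>i\<in>I. p i (om * t) *\<^sub>R G i (y t))) (at t)) \<longrightarrow> y t1 \<in> M \<longrightarrow> z t1 = y t1 \<longrightarrow>
       (\<forall>t\<ge>t1. z t \<in> M \<inter> C \<and> (z has_vector_derivative avg (z t)) (at t)) \<longrightarrow>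
       (\<forall>t\<in>{t1..t1 + D}. y t \<in> M \<and> dist (y t) (z t) \<le> \<eta>))"
    by (rule finite_time_approximation)
  note G = this(1)[rule_format] and ex = this(2)[rule_format] and loc = this(3)[rule_format]
    and apx = this(4)[rule_format]
  \<comment> \<open>The averaged trajectories reach only \<epsilon> / 2 and \<delta> / 2, so half of
    each is left for the averaging error. The bound 1 keeps \<open>y\<close> where the extended
    fields agree with the original ones.\<close>
  define \<eta> where "\<eta> = min 1 (min (\<epsilon> / 2) (\<delta> / 2))"
  have \<eta>: "\<eta> > 0" "\<eta> \<le> 1" "\<eta> \<le> \<epsilon> / 2" "\<eta> \<le> \<delta> / 2" using \<open>\<epsilon> > 0\<close> \<delta> by (auto simp: \<eta>_def)
  from apx[OF D(1) \<eta>(1,2)] obtain om0 where om0: "om0 > 0" "\<forall>om\<ge>om0. \<forall>t1 y z.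
       (\<forall>t. (y has_vector_derivative (\<Sum>i\<in>I. p i (om * t) *\<^sub>R G i (y t))) (at t)) \<longrightarrow> y t1 \<in> M \<longrightarrow> z t1 = y t1 \<longrightarrow>
       (\<forall>t\<ge>t1. z t \<in> M \<inter> C \<and> (z has_vector_derivative avg (z t)) (at t)) \<longrightarrow>
       (\<forall>t\<in>{t1..t1 + D}. y t \<in> M \<and> dist (y t) (z t) \<le> \<eta>)" by (elim exE conjE)
  note om0 = om0(1) om0(2)[rule_format]
  have "\<exists>e>0. \<exists>y. y t0 = x0 \<and> solution_on M (\<lambda>t. rhs (om * t)) {t0 - e<..} y \<and> (\<forall>t\<ge>t0. infdist (y t) K \<le> \<epsilon>)"
    if om: "om \<ge> om0" and x0: "x0 \<in> M" "infdist x0 K \<le> \<delta>" for om t0 x0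
  proof -
    obtain y where y: "y t0 = x0" "\<And>t. (y has_vector_derivative (\<Sum>i\<in>I. p i (om * t) *\<^sub>R G i (y t))) (at t)"
      using ex by blast
    have yrhs: "(y has_vector_derivative rhs (om * t) (y t)) (at t)"
      if "y t \<in> M" "c \<in> C" "dist (y t) c \<le> 1" for t c
    proof -
      have "rhs (om * t) (y t) = (\<Sum>i\<in>I. p i (om * t) *\<^sub>R G i (y t))"
        unfolding rhs_def using G that by (intro sum.cong) auto
      then show ?thesis using y(2) by simp
    qed
    have seg: "(\<forall>t\<in>{t1..t1 + D}. y t \<in> M \<and> (\<exists>c\<in>C. dist (y t) c \<le> 1) \<and> infdist (y t) K \<le> \<epsilon>) \<and> infdist (y (t1 + D)) K \<le> \<delta>"
      if t1: "y t1 \<in> M" "infdist (y t1) K \<le> \<delta>" for t1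
    proof -
      obtain z where z: "z t1 = y t1" "solution_on M (\<lambda>_. avg) {t1..} z" "\<And>t. t \<ge> t1 \<Longrightarrow> infdist (z t) K \<le> \<epsilon> / 2"
        using \<delta>1(2)[of "y t1" t1] t1 \<delta> by auto
      have zz: "z t \<in> M \<inter> C \<and> (z has_vector_derivative avg (z t)) (at t)" if "t \<ge> t1" for t
        using z(2) z(3)[OF that] that by (auto simp: solution_on_def C_def)
      have a1: "y t \<in> M \<and> dist (y t) (z t) \<le> \<eta>" if t: "t \<in> {t1..t1 + D}" for t
        using om0(2)[OF om y(2) t1(1) z(1) zz t] by auto
      have zC: "z t \<in> C" if "t \<ge> t1" for t using z(3)[OF that] by (auto simp: C_def)
      have "y t1 \<in> S" using r0 t1 \<delta> by auto
      then obtain w where w: "w t1 = y t1" "solution_on M (\<lambda>_. avg) {t1..} w" "\<And>t. t \<ge> t1 \<Longrightarrow> infdist (w t) K \<le> \<rho>"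
         "\<And>t. t \<ge> t1 + D \<Longrightarrow> infdist (w t) K \<le> \<delta> / 2"
        using D(3)[of "y t1" t1] t1 by auto
      have ww: "w t \<in> M \<inter> C \<and> (w has_vector_derivative avg (w t)) (at t)" if "t \<ge> t1" for t
        using w(2) w(3)[OF that] that by (auto simp: solution_on_def C_def)
      have a2: "y t \<in> M \<and> dist (y t) (w t) \<le> \<eta>" if t: "t \<in> {t1..t1 + D}" for t
        using om0(2)[OF om y(2) t1(1) w(1) ww t] by auto
      have "y t \<in> M \<and> (\<exists>c\<in>C. dist (y t) c \<le> 1) \<and> infdist (y t) K \<le> \<epsilon>" if t: "t \<in> {t1..t1 + D}" for t
        using a1[OF t] zC[of t] z(3)[of t] t \<eta> infdist_triangle[of "y t" K "z t"] by force
      moreover have "infdist (y (t1 + D)) K \<le> \<delta>"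
        using a2[of "t1 + D"] w(4)[of "t1 + D"] D(1) \<eta> infdist_triangle[of "y (t1 + D)" K "w (t1 + D)"] by force
      ultimately show ?thesis by blast
    qed
    have it: "y (t0 + real k * D) \<in> M \<and> infdist (y (t0 + real k * D)) K \<le> \<delta>" for k :: nat
    proof (induction k)
      case 0
      then show ?case using y x0 by simp
    next
      case (Suc k)
      have eq: "t0 + real (Suc k) * D = (t0 + real k * D) + D" by (simp add: algebra_simps)
      show ?case unfolding eq using seg[of "t0 + real k * D"] Suc D(1) by auto
    qed
    have all: "y t \<in> M \<and> (\<exists>c\<in>C. dist (y t) c \<le> 1) \<and> infdist (y t) K \<le> \<epsilon>" if t: "t \<ge> t0" for t
    proof -
      define k where "k = nat \<lfloor>(t - t0) / D\<rfloor>"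
      have "real k \<le> (t - t0) / D" "(t - t0) / D < real k + 1"
        unfolding k_def using t D(1) by (auto intro: divide_nonneg_pos)
      then have "t \<in> {t0 + real k * D..(t0 + real k * D) + D}"
        using D(1) by (auto simp: field_simps)
      then show ?thesis using seg[of "t0 + real k * D"] it[of k] by blast
    qed
    have sub: "solution_on M (\<lambda>t. rhs (om * t)) {t0..} y"
      unfolding solution_on_def using all yrhs by auto
    have "y t0 \<in> M \<inter> C"
      using x0 y(1) \<delta>1(2)[of x0 t0] \<delta> by (auto simp: C_def)
    from loc[OF y(2) this] obtain e1 where e1: "e1 > 0" "\<And>t. \<bar>t - t0\<bar> \<le> e1 \<Longrightarrow> y t \<in> M" by blast
    have "continuous (at t0) y" using y has_vector_derivative_continuous by blast
    then obtain e2 where e2: "e2 > 0" "\<And>t. \<bar>t - t0\<bar> < e2 \<Longrightarrow> dist (y t) (y t0) < 1"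
      unfolding continuous_at_eps_delta by (metis dist_real_def zero_less_one)
    \<comment> \<open>Before \<open>t0\<close>, the bound \<open>e1\<close> keeps \<open>y\<close>
      in \<open>M\<close>, and \<open>e2\<close> keeps it within distance 1 of the point
      \<open>y t0\<close> of \<open>C\<close>, where \<open>G\<close> agrees with
      \<open>F\<close>.\<close>
    have "solution_on M (\<lambda>t. rhs (om * t)) {t0 - min e1 e2<..} y"
      unfolding solution_on_def
    proof
      fix t assume t: "t \<in> {t0 - min e1 e2<..}"
      show "y t \<in> M \<and> (y has_vector_derivative rhs (om * t) (y t)) (at t)"
      proof (cases "t \<ge> t0")
        case True
        then show ?thesis using sub by (auto simp: solution_on_def)
      next
        case False
        then have "\<bar>t - t0\<bar> \<le> e1" "\<bar>t - t0\<bar> < e2" using t by auto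
        then have "y t \<in> M" "dist (y t) (y t0) \<le> 1" using e1(2) e2(2)[of t] by auto
        then show ?thesis using \<open>y t0 \<in> M \<inter> C\<close> yrhs[of t "y t0"] by auto
      qed
    qed
    then show ?thesis using y(1) all e1(1) e2(1) by (intro exI[of _ "min e1 e2"] conjI exI[of _ y]) auto
  qed
  then show ?thesis using om0(1) \<delta>(1) by blast
qed

text \<open>A single finite-time comparison up to time \<open>D\<close> carries \<open>y\<close>
  into the \<delta>-neighbourhood provided by \<open>practical_stability\<close>, which is then
  started at \<open>t0 + D\<close>; the two solutions are glued. This explains max (\<rho> + 1)
  \<epsilon>: the first bound holds before \<open>t0 + D\<close>, the second one after.\<close>

lemma practical_attractivity:
  assumes K: "compact K" "K \<noteq> {}"
    and r0: "r0 > 0" "\<forall>x\<in>M. infdist x K \<le> r0 \<longrightarrow> x \<in> S" and S: "S \<subseteq> M"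
    and H1: "\<forall>\<epsilon>>0. \<exists>\<delta>>0. \<forall>t0. \<forall>x0\<in>M. infdist x0 K \<le> \<delta> \<longrightarrow>
      (\<exists>z. z t0 = x0 \<and> solution_on M (\<lambda>_. avg) {t0..} z \<and> (\<forall>t\<ge>t0. infdist (z t) K \<le> \<epsilon>))"
    and H2: "\<forall>r>0. \<forall>\<epsilon>>0. \<exists>\<Delta>>0. \<exists>\<rho>>0. \<forall>t0. \<forall>x0\<in>S. infdist x0 K \<le> r \<longrightarrow>
      (\<exists>z. z t0 = x0 \<and> solution_on M (\<lambda>_. avg) {t0..} z \<and> (\<forall>t\<ge>t0. infdist (z t) K \<le> \<rho>) \<and>
        (\<forall>t\<ge>t0 + \<Delta>. infdist (z t) K \<le> \<epsilon>))"
    and "r > 0" "\<epsilon> > 0"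
  shows "\<exists>om0>0. \<exists>\<Delta>>0. \<exists>\<rho>>0. \<forall>om\<ge>om0. \<forall>t0. \<forall>x0\<in>S. infdist x0 K \<le> r \<longrightarrow>
    (\<exists>e>0. \<exists>y. y t0 = x0 \<and> solution_on M (\<lambda>t. rhs (om * t)) {t0 - e<..} y \<and>
      (\<forall>t\<ge>t0. infdist (y t) K \<le> \<rho>) \<and> (\<forall>t\<ge>t0 + \<Delta>. infdist (y t) K \<le> \<epsilon>))"
proof -
  from practical_stability[OF K r0 H1 H2 \<open>\<epsilon> > 0\<close>]
  obtain om1 \<delta> where \<delta>: "om1 > 0" "\<delta> > 0" "\<forall>om\<ge>om1. \<forall>t0. \<forall>x0\<in>M. infdist x0 K \<le> \<delta> \<longrightarrow>
    (\<exists>e>0. \<exists>y. y t0 = x0 \<and> solution_on M (\<lambda>t. rhs (om * t)) {t0 - e<..} y \<and> (\<forall>t\<ge>t0. infdist (y t) K \<le> \<epsilon>))"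
    by (elim exE conjE)
  note \<delta> = \<delta>(1,2) \<delta>(3)[rule_format]
  have "\<delta> / 2 > 0" using \<delta> by simp
  from H2[rule_format, OF \<open>r > 0\<close> this] obtain D \<rho> where D: "D > 0" "\<rho> > 0" "\<And>t0 x0. x0 \<in> S \<Longrightarrow> infdist x0 K \<le> r \<Longrightarrow>
      \<exists>z. z t0 = x0 \<and> solution_on M (\<lambda>_. avg) {t0..} z \<and> (\<forall>t\<ge>t0. infdist (z t) K \<le> \<rho>) \<and>
        (\<forall>t\<ge>t0 + D. infdist (z t) K \<le> \<delta> / 2)" by blast
  define C where "C = {x. infdist x K \<le> \<rho>}"
  have "bounded C" unfolding C_def using bounded_infdist_le[OF K] .
  then obtain G where
    "\<forall>i\<in>I. \<forall>x\<in>M. \<forall>c\<in>C. dist x c \<le> 1 \<longrightarrow> G i x = F i x"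
    "\<forall>om t0 x0. \<exists>y. y t0 = x0 \<and> (\<forall>t. (y has_vector_derivative (\<Sum>i\<in>I. p i (om * t) *\<^sub>R G i (y t))) (at t))"
    "\<forall>om y t0. (\<forall>t. (y has_vector_derivative (\<Sum>i\<in>I. p i (om * t) *\<^sub>R G i (y t))) (at t)) \<longrightarrow> y t0 \<in> M \<inter> C \<longrightarrow>
       (\<exists>e>0. \<forall>t. \<bar>t - t0\<bar> \<le> e \<longrightarrow> y t \<in> M)"
    "\<forall>D \<eta>. D > 0 \<longrightarrow> \<eta> > 0 \<longrightarrow> \<eta> \<le> 1 \<longrightarrow> (\<exists>om0>0. \<forall>om\<ge>om0. \<forall>t1 y z.
       (\<forall>t. (y has_vector_derivative (\<Sum>i\<in>I. p i (om * t) *\<^sub>R G i (y t))) (at t)) \<longrightarrow> y t1 \<in> M \<longrightarrow> z t1 = y t1 \<longrightarrow>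
       (\<forall>t\<ge>t1. z t \<in> M \<inter> C \<and> (z has_vector_derivative avg (z t)) (at t)) \<longrightarrow>
       (\<forall>t\<in>{t1..t1 + D}. y t \<in> M \<and> dist (y t) (z t) \<le> \<eta>))"
    by (rule finite_time_approximation)
  note G = this(1)[rule_format] and ex = this(2)[rule_format] and loc = this(3)[rule_format]
    and apx = this(4)[rule_format]
  define \<eta> where "\<eta> = min 1 (\<delta> / 2)"
  have \<eta>: "\<eta> > 0" "\<eta> \<le> 1" "\<eta> \<le> \<delta> / 2" using \<delta> by (auto simp: \<eta>_def)
  \<comment> \<open>The additional unit of time makes \<open>t0 + D\<close> an interior point, so
    that the two solutions overlap on an open interval.\<close>
  have "D + 1 > 0" using D by simp
  from apx[OF this \<eta>(1,2)] obtain om2 where om2: "om2 > 0" "\<forall>om\<ge>om2. \<forall>t1 y z.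
       (\<forall>t. (y has_vector_derivative (\<Sum>i\<in>I. p i (om * t) *\<^sub>R G i (y t))) (at t)) \<longrightarrow> y t1 \<in> M \<longrightarrow> z t1 = y t1 \<longrightarrow>
       (\<forall>t\<ge>t1. z t \<in> M \<inter> C \<and> (z has_vector_derivative avg (z t)) (at t)) \<longrightarrow>
       (\<forall>t\<in>{t1..t1 + (D + 1)}. y t \<in> M \<and> dist (y t) (z t) \<le> \<eta>)" by (elim exE conjE)
  note om2 = om2(1) om2(2)[rule_format]
  have "\<exists>e>0. \<exists>y. y t0 = x0 \<and> solution_on M (\<lambda>t. rhs (om * t)) {t0 - e<..} y \<and>
      (\<forall>t\<ge>t0. infdist (y t) K \<le> max (\<rho> + 1) \<epsilon>) \<and> (\<forall>t\<ge>t0 + D. infdist (y t) K \<le> \<epsilon>)"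
    if om: "om \<ge> max om1 om2" and x0: "x0 \<in> S" "infdist x0 K \<le> r" for om t0 x0
  proof -
    obtain y where y: "y t0 = x0" "\<And>t. (y has_vector_derivative (\<Sum>i\<in>I. p i (om * t) *\<^sub>R G i (y t))) (at t)"
      using ex by blast
    have yrhs: "(y has_vector_derivative rhs (om * t) (y t)) (at t)"
      if "y t \<in> M" "c \<in> C" "dist (y t) c \<le> 1" for t c
    proof -
      have "rhs (om * t) (y t) = (\<Sum>i\<in>I. p i (om * t) *\<^sub>R G i (y t))"
        unfolding rhs_def using G that by (intro sum.cong) auto
      then show ?thesis using y(2) by simp
    qed
    obtain z where z: "z t0 = x0" "solution_on M (\<lambda>_. avg) {t0..} z" "\<And>t. t \<ge> t0 \<Longrightarrow> infdist (z t) K \<le> \<rho>"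
         "\<And>t. t \<ge> t0 + D \<Longrightarrow> infdist (z t) K \<le> \<delta> / 2"
      using D(3)[OF x0] by blast
    have zC: "z t \<in> C" if "t \<ge> t0" for t using z(3)[OF that] by (auto simp: C_def)
    have zz: "z t \<in> M \<inter> C \<and> (z has_vector_derivative avg (z t)) (at t)" if "t \<ge> t0" for t
      using z(2) zC[OF that] that by (auto simp: solution_on_def)
    have y0: "y t0 \<in> M" "z t0 = y t0" using y(1) z(1) x0 S by auto
    have a: "y t \<in> M \<and> dist (y t) (z t) \<le> \<eta>" if "t \<in> {t0..t0 + (D + 1)}" for t
      using om2(2)[of om y t0 z t, OF _ y(2) y0 zz that] om by auto
    have "y t0 \<in> M \<inter> C" using y0 zC[of t0] by auto
    from loc[OF y(2) this] obtain e1 where e1: "e1 > 0" "\<And>t. \<bar>t - t0\<bar> \<le> e1 \<Longrightarrow> y t \<in> M" by blast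
    have "continuous (at t0) y" using y has_vector_derivative_continuous by blast
    then obtain e2 where e2: "e2 > 0" "\<And>t. \<bar>t - t0\<bar> < e2 \<Longrightarrow> dist (y t) (y t0) < 1"
      unfolding continuous_at_eps_delta by (metis dist_real_def zero_less_one)
    define e where "e = min e1 e2"
    have e: "e > 0" using e1 e2 by (simp add: e_def)
    define J1 where "J1 = {t0 - e<..<t0 + D + 1}"
    have sy: "solution_on M (\<lambda>t. rhs (om * t)) J1 y"
      unfolding solution_on_def
    proof
      fix t assume t: "t \<in> J1"
      show "y t \<in> M \<and> (y has_vector_derivative rhs (om * t) (y t)) (at t)"
      proof (cases "t \<ge> t0")
        case True
        then show ?thesis using a[of t] t \<eta> yrhs[of t "z t"] zC[of t] by (auto simp: J1_def)
      next
        case False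
        then have "\<bar>t - t0\<bar> \<le> e1" "\<bar>t - t0\<bar> < e2" using t by (auto simp: e_def J1_def)
        then have "y t \<in> M" "dist (y t) (y t0) \<le> 1" using e1(2) e2(2)[of t] by auto
        then show ?thesis using \<open>y t0 \<in> M \<inter> C\<close> yrhs[of t "y t0"] by auto
      qed
    qed
    have yD: "y (t0 + D) \<in> M" "infdist (y (t0 + D)) K \<le> \<delta>"
      using a[of "t0 + D"] z(4)[of "t0 + D"] D(1) \<eta> infdist_triangle[of "y (t0 + D)" K "z (t0 + D)"] by force+
    obtain f w where fw: "f > 0" "w (t0 + D) = y (t0 + D)"
      "solution_on M (\<lambda>t. rhs (om * t)) {t0 + D - f<..} w" "\<And>t. t \<ge> t0 + D \<Longrightarrow> infdist (w t) K \<le> \<epsilon>"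
      using \<delta>(3)[OF _ yD, of om "t0 + D"] om by auto
    define J2 where "J2 = {t0 + D - f<..}"
    have J: "open J1" "open J2" "is_interval J1" "is_interval J2" "t0 + D \<in> J1" "t0 + D \<in> J2"
      using e fw D by (auto simp: J1_def J2_def is_interval_1)
    have sw: "solution_on M (\<lambda>t. rhs (om * t)) J2 w" using fw(3) by (simp add: J2_def)
    obtain x where x: "solution_on M (\<lambda>t. rhs (om * t)) (J1 \<union> J2) x"
      "\<And>t. t \<in> J1 \<Longrightarrow> x t = y t" "\<And>t. t \<in> J2 \<Longrightarrow> x t = w t"
      using solution_on_glue[OF rhs_lipschitz_compact J(1-4) sy sw J(5,6) fw(2)[symmetric]] by blast
    have xs: "solution_on M (\<lambda>t. rhs (om * t)) {t0 - e<..} x"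
      by (rule solution_on_subset[OF x(1)]) (use fw in \<open>auto simp: J1_def J2_def\<close>)
    have x2: "infdist (x t) K \<le> \<epsilon>" if "t \<ge> t0 + D" for t
      using x(3)[of t] fw(4)[OF that] that fw(1) by (auto simp: J2_def)
    have x1: "infdist (x t) K \<le> \<rho> + 1" if t: "t \<ge> t0" "t < t0 + D" for t
    proof -
      have "infdist (y t) K \<le> infdist (z t) K + dist (y t) (z t)" by (rule infdist_triangle)
      also have "\<dots> \<le> \<rho> + 1" using z(3)[of t] a[of t] \<eta> t by (intro add_mono) auto
      finally show ?thesis using x(2)[of t] t e by (auto simp: J1_def)
    qed
    have "x t0 = x0" using x(2)[of t0] y(1) e D by (auto simp: J1_def)
    moreover have "infdist (x t) K \<le> max (\<rho> + 1) \<epsilon>" if "t \<ge> t0" for t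
      using x1[OF that] x2[of t] by (cases "t < t0 + D") auto
    ultimately show ?thesis using xs x2 e by blast
  qed
  then show ?thesis
    using \<delta>(1) D(1) \<open>\<epsilon> > 0\<close>
    by (intro exI[of _ "max om1 om2"] exI[of _ D] exI[of _ "max (\<rho> + 1) \<epsilon>"] conjI) auto
qed

end

section \<open>Smooth maps\<close>

lemma frechet_derivative_cong:
  assumes "open S" "x \<in> S" "\<And>y. y \<in> S \<Longrightarrow> f y = g y" "f differentiable (at x)"
  shows "g differentiable (at x)" "frechet_derivative g (at x) = frechet_derivative f (at x)"
proof -
  have "(f has_derivative frechet_derivative f (at x)) (at x)"
    using assms(4) frechet_derivative_works by blast
  then have *: "(g has_derivative frechet_derivative f (at x)) (at x)"
    by (rule has_derivative_transform_within_open[OF _ assms(1,2)]) (use assms(3) in auto)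
  then show "g differentiable (at x)" unfolding differentiable_def by blast
  show "frechet_derivative g (at x) = frechet_derivative f (at x)"
    using frechet_derivative_at[OF *] by simp
qed

lemma C_diff_cong:
  assumes "open S" "\<And>x. x \<in> S \<Longrightarrow> f x = g x" "C_diff k S f"
  shows "C_diff k S g"
  using assms(2,3)
proof (induction k arbitrary: f g)
  case 0
  then show ?case by (auto cong: continuous_on_cong)
next
  case (Suc k)
  have "g differentiable (at x) \<and> frechet_derivative g (at x) = frechet_derivative f (at x)" if "x \<in> S" for x
    using frechet_derivative_cong[OF assms(1) that, of f g] Suc.prems that by auto
  then show ?case using Suc.IH[of "\<lambda>x. frechet_derivative f (at x) w" "\<lambda>x. frechet_derivative g (at x) w" for w]
      Suc.prems by auto
qed

lemma C_diff_subset: "C_diff k S f \<Longrightarrow> T \<subseteq> S \<Longrightarrow> C_diff k T f"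
  by (induction k arbitrary: f) (auto intro: continuous_on_subset)

lemma C_diff_imp_continuous: "C_diff k S f \<Longrightarrow> continuous_on S f"
  by (cases k) (auto intro!: continuous_at_imp_continuous_on differentiable_imp_continuous_within)

lemma C_diff_SucD: "C_diff (Suc k) S f \<Longrightarrow> C_diff k S f"
proof (induction k arbitrary: f)
  case 0
  then show ?case using C_diff_imp_continuous[of "Suc 0" S f] by simp
next
  case (Suc k)
  then show ?case by auto
qed

lemma C_diff_SucI:
  assumes "open S" "\<And>x. x \<in> S \<Longrightarrow> (f has_derivative f' x) (at x)" "\<And>w. C_diff k S (\<lambda>x. f' x w)"
  shows "C_diff (Suc k) S f"
proof -
  have *: "f differentiable (at x)" "frechet_derivative f (at x) = f' x" if "x \<in> S" for x
    using assms(2)[OF that] frechet_derivative_at[of f "f' x" x] by (auto simp: differentiable_def)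
  have "C_diff k S (\<lambda>x. frechet_derivative f (at x) w)" for w
    by (rule C_diff_cong[OF assms(1) _ assms(3)[of w]]) (simp add: *)
  then show ?thesis using * by simp
qed

lemma C_diff_SucE:
  assumes "C_diff (Suc k) S f"
  shows "\<And>x. x \<in> S \<Longrightarrow> (f has_derivative frechet_derivative f (at x)) (at x)"
    "\<And>w. C_diff k S (\<lambda>x. frechet_derivative f (at x) w)"
  using assms frechet_derivative_works by auto

lemma C_diff_const: "open S \<Longrightarrow> C_diff k S (\<lambda>x. c)"
proof (induction k arbitrary: c)
  case (Suc k)
  then show ?case by (intro C_diff_SucI[where f'="\<lambda>_ _. 0"]) auto
qed auto

lemma C_diff_bounded_linear: "open S \<Longrightarrow> bounded_linear f \<Longrightarrow> C_diff k S f"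
proof (cases k)
  case 0
  then show "bounded_linear f \<Longrightarrow> ?thesis" by (auto intro: linear_continuous_on)
next
  case (Suc k)
  then show "open S \<Longrightarrow> bounded_linear f \<Longrightarrow> ?thesis"
    unfolding Suc by (intro C_diff_SucI[where f'="\<lambda>_. f"] bounded_linear_imp_has_derivative C_diff_const)
qed

lemma C_diff_add: "open S \<Longrightarrow> C_diff k S f \<Longrightarrow> C_diff k S g \<Longrightarrow> C_diff k S (\<lambda>x. f x + g x)"
proof (induction k arbitrary: f g)
  case 0
  then show ?case by (auto intro: continuous_intros)
next
  case (Suc k)
  note f = C_diff_SucE[OF Suc.prems(2)] and g = C_diff_SucE[OF Suc.prems(3)]
  show ?case
    by (rule C_diff_SucI[OF Suc.prems(1), where f'="\<lambda>x w. frechet_derivative f (at x) w + frechet_derivative g (at x) w"])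
      (use f g Suc in \<open>auto intro!: has_derivative_add\<close>)
qed

text \<open>The product rule yields two terms of the same shape, each with one factor differentiated
  and the other merely lowered by one order, so the induction on the order closes.\<close>

lemma C_diff_bilinear:
  assumes "bounded_bilinear B" "open S"
  shows "C_diff k S f \<Longrightarrow> C_diff k S g \<Longrightarrow> C_diff k S (\<lambda>x. B (f x) (g x))"
proof (induction k arbitrary: f g)
  case 0
  then show ?case using bounded_bilinear.continuous_on[OF assms(1)] by auto
next
  case (Suc k)
  note f = C_diff_SucE[OF Suc.prems(1)] and g = C_diff_SucE[OF Suc.prems(2)]
  show ?case
  proof (rule C_diff_SucI[OF assms(2),
        where f'="\<lambda>x w. B (f x) (frechet_derivative g (at x) w) + B (frechet_derivative f (at x) w) (g x)"])
    show "((\<lambda>x. B (f x) (g x)) has_derivative (\<lambda>w. B (f x) (frechet_derivative g (at x) w) +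
        B (frechet_derivative f (at x) w) (g x))) (at x)" if "x \<in> S" for x
      using bounded_bilinear.FDERIV[OF assms(1) f(1)[OF that] g(1)[OF that]] .
    show "C_diff k S (\<lambda>x. B (f x) (frechet_derivative g (at x) w) + B (frechet_derivative f (at x) w) (g x))" for w
      by (rule C_diff_add[OF assms(2) Suc.IH[OF C_diff_SucD[OF Suc.prems(1)] g(2)]
            Suc.IH[OF f(2) C_diff_SucD[OF Suc.prems(2)]]])
  qed
qed

lemma C_diff_linear_compose:
  assumes "bounded_linear L" "open S" "C_diff k S f"
  shows "C_diff k S (\<lambda>x. L (f x))"
  using assms(3)
proof (induction k arbitrary: f)
  case 0
  then show ?case by (auto intro: bounded_linear.continuous_on[OF assms(1)])
next
  case (Suc k)
  note f = C_diff_SucE[OF Suc.prems(1)]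
  show ?case
    by (rule C_diff_SucI[OF assms(2), where f'="\<lambda>x w. L (frechet_derivative f (at x) w)"])
      (use f Suc.IH in \<open>auto intro: bounded_linear.has_derivative[OF assms(1)]\<close>)
qed

lemma C_diff_sum: "finite A \<Longrightarrow> open S \<Longrightarrow> (\<And>i. i \<in> A \<Longrightarrow> C_diff k S (f i)) \<Longrightarrow> C_diff k S (\<lambda>x. \<Sum>i\<in>A. f i x)"
proof (induction A rule: finite_induct)
  case empty
  then show ?case by (simp add: C_diff_const)
next
  case (insert a A)
  then show ?case using C_diff_add[of S k "f a" "\<lambda>x. \<Sum>i\<in>A. f i x"] by simp
qed

text \<open>The derivative of 1 / f is built from f' and 1 / f itself, the latter needed one order
  lower, which the induction hypothesis supplies.\<close>

lemma C_diff_inverse: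
  fixes f :: "'a::real_normed_vector \<Rightarrow> real"
  assumes "open S" "\<And>x. x \<in> S \<Longrightarrow> f x \<noteq> 0"
  shows "C_diff k S f \<Longrightarrow> C_diff k S (\<lambda>x. inverse (f x))"
proof (induction k)
  case 0
  then show ?case using assms by (auto intro!: continuous_intros)
next
  case (Suc k)
  note f = C_diff_SucE[OF Suc.prems(1)]
  have IH: "C_diff k S (\<lambda>x. inverse (f x))" using Suc C_diff_SucD by blast
  show ?case
  proof (rule C_diff_SucI[OF assms(1),
        where f'="\<lambda>x w. (-1) * ((inverse (f x) * inverse (f x)) * frechet_derivative f (at x) w)"])
    show "((\<lambda>x. inverse (f x)) has_derivative (\<lambda>w. (-1) * ((inverse (f x) * inverse (f x)) * frechet_derivative f (at x) w))) (at x)"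
      if "x \<in> S" for x
      using Deriv.has_derivative_inverse[OF assms(2)[OF that] f(1)[OF that]]
      by (simp add: mult_ac fun_eq_iff)
    show "C_diff k S (\<lambda>x. (-1) * ((inverse (f x) * inverse (f x)) * frechet_derivative f (at x) w))" for w
      by (intro C_diff_bilinear[OF bounded_bilinear_mult] C_diff_const IH f(2) assms)
  qed
qed

text \<open>Used to pull straight lines in a flattening chart back to smooth curves in the
  submanifold.\<close>

lemma C_diff_affine:
  fixes f :: "'a::real_normed_vector \<Rightarrow> 'b::real_normed_vector"
  assumes "open S" "open T" "\<And>s. s \<in> T \<Longrightarrow> a + s *\<^sub>R w \<in> S"
  shows "C_diff k S f \<Longrightarrow> C_diff k T (\<lambda>s. f (a + s *\<^sub>R w))"
proof (induction k arbitrary: f)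
  case 0
  then show ?case
    by (auto intro!: continuous_on_compose2[of S f T] continuous_intros assms)
next
  case (Suc k)
  note f = C_diff_SucE[OF Suc.prems(1)]
  show ?case
  proof (rule C_diff_SucI[OF assms(2), where f'="\<lambda>s r. r *\<^sub>R frechet_derivative f (at (a + s *\<^sub>R w)) w"])
    fix s assume s: "s \<in> T"
    have "((\<lambda>s. a + s *\<^sub>R w) has_derivative (\<lambda>r. r *\<^sub>R w)) (at s)"
      by (auto intro!: derivative_eq_intros)
    from has_derivative_compose[OF this f(1)[OF assms(3)[OF s]]]
    show "((\<lambda>s. f (a + s *\<^sub>R w)) has_derivative (\<lambda>r. r *\<^sub>R frechet_derivative f (at (a + s *\<^sub>R w)) w)) (at s)"
      using linear_scale[OF has_derivative_linear[OF f(1)[OF assms(3)[OF s]]]] by simp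
  next
    show "C_diff k T (\<lambda>s. r *\<^sub>R frechet_derivative f (at (a + s *\<^sub>R w)) w)" for r
      by (intro C_diff_linear_compose[OF bounded_linear_scaleR_right assms(2)] Suc.IH f(2))
  qed
qed

lemma smooth_on_openD: "smooth_on_open S f \<Longrightarrow> open S" "smooth_on_open S f \<Longrightarrow> C_diff k S f"
  by (auto simp: smooth_on_open_def)

lemma smooth_on_open_has_derivative:
  "smooth_on_open S f \<Longrightarrow> x \<in> S \<Longrightarrow> (f has_derivative frechet_derivative f (at x)) (at x)"
  using smooth_on_openD(2)[of S f "Suc 0"] C_diff_SucE by blast

lemma smooth_on_open_frechet: "smooth_on_open S f \<Longrightarrow> smooth_on_open S (\<lambda>x. frechet_derivative f (at x) w)"
  unfolding smooth_on_open_def using C_diff_SucE(2) by blast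

lemma smooth_on_open_subset: "smooth_on_open S f \<Longrightarrow> open T \<Longrightarrow> T \<subseteq> S \<Longrightarrow> smooth_on_open T f"
  unfolding smooth_on_open_def using C_diff_subset by blast

lemma smooth_on_open_imp_map_on: "smooth_on_open W f \<Longrightarrow> A \<subseteq> W \<Longrightarrow> smooth_map_on A f"
  unfolding smooth_map_on_def by blast

lemma smooth_map_on_cong: "(\<And>x. x \<in> A \<Longrightarrow> f x = g x) \<Longrightarrow> smooth_map_on A f \<Longrightarrow> smooth_map_on A g"
  unfolding smooth_map_on_def by (metis IntD1)

lemma smooth_map_on_locally:
  assumes "\<And>x. x \<in> A \<Longrightarrow> \<exists>W. open W \<and> x \<in> W \<and> smooth_map_on (A \<inter> W) f"
  shows "smooth_map_on A f"
  unfolding smooth_map_on_def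
proof
  fix x assume x: "x \<in> A"
  then obtain W where W: "open W" "x \<in> W" "smooth_map_on (A \<inter> W) f" using assms by blast
  then obtain V F where V: "x \<in> V" "smooth_on_open V F" "\<forall>y\<in>A \<inter> W \<inter> V. F y = f y"
    using x unfolding smooth_map_on_def by blast
  have "smooth_on_open (V \<inter> W) F"
    using V(2) W(1) smooth_on_openD(1)[OF V(2)] by (auto intro: smooth_on_open_subset)
  then show "\<exists>W F. x \<in> W \<and> smooth_on_open W F \<and> (\<forall>y\<in>A \<inter> W. F y = f y)"
    using V W by (intro exI[of _ "V \<inter> W"] exI[of _ F]) auto
qed

lemma smooth_map_on_const: "smooth_map_on A (\<lambda>x. c)"
  by (rule smooth_on_open_imp_map_on[of UNIV]) (auto simp: smooth_on_open_def C_diff_const)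

lemma smooth_map_on_combine:
  fixes A :: "'a::euclidean_space set"
  assumes f: "smooth_map_on A f" and g: "smooth_map_on A g"
    and B: "\<And>(S :: 'a set) F G. smooth_on_open S F \<Longrightarrow> smooth_on_open S G \<Longrightarrow> smooth_on_open S (\<lambda>x. B (F x) (G x))"
  shows "smooth_map_on A (\<lambda>x. B (f x) (g x))"
  unfolding smooth_map_on_def
proof
  fix x assume x: "x \<in> A"
  obtain W F where W: "x \<in> W" "smooth_on_open W F" "\<forall>y\<in>A \<inter> W. F y = f y"
    using f x unfolding smooth_map_on_def by blast
  obtain V G where V: "x \<in> V" "smooth_on_open V G" "\<forall>y\<in>A \<inter> V. G y = g y"
    using g x unfolding smooth_map_on_def by blast
  have o: "open (V \<inter> W)" using smooth_on_openD(1)[OF V(2)] smooth_on_openD(1)[OF W(2)] by auto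
  have "smooth_on_open (V \<inter> W) F" "smooth_on_open (V \<inter> W) G"
    using smooth_on_open_subset[OF V(2) o] smooth_on_open_subset[OF W(2) o] by auto
  from B[OF this] show "\<exists>W F. x \<in> W \<and> smooth_on_open W F \<and> (\<forall>y\<in>A \<inter> W. F y = B (f y) (g y))"
    using V W by (intro exI[of _ "V \<inter> W"] exI[of _ "\<lambda>x. B (F x) (G x)"]) auto
qed

lemma smooth_map_on_add: "smooth_map_on A f \<Longrightarrow> smooth_map_on A g \<Longrightarrow> smooth_map_on A (\<lambda>x. f x + g x)"
  by (rule smooth_map_on_combine) (auto simp: smooth_on_open_def C_diff_add)

lemma smooth_map_on_bilinear:
  "bounded_bilinear B \<Longrightarrow> smooth_map_on A f \<Longrightarrow> smooth_map_on A g \<Longrightarrow> smooth_map_on A (\<lambda>x. B (f x) (g x))"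
  by (rule smooth_map_on_combine) (auto simp: smooth_on_open_def C_diff_bilinear)

lemmas smooth_map_on_scaleR = smooth_map_on_bilinear[OF bounded_bilinear_scaleR]
lemmas smooth_map_on_inner = smooth_map_on_bilinear[OF bounded_bilinear_inner]

lemma smooth_map_on_sum:
  "finite I \<Longrightarrow> (\<And>i. i \<in> I \<Longrightarrow> smooth_map_on A (f i)) \<Longrightarrow> smooth_map_on A (\<lambda>x. \<Sum>i\<in>I. f i x)"
  by (induction I rule: finite_induct) (auto intro: smooth_map_on_const smooth_map_on_add)

text \<open>The mean value inequality is applied to the local extension \<open>F\<close> on a closed
  ball, which is convex, whereas \<open>A\<close> need not be.\<close>

lemma smooth_imp_locally_lipschitz:
  fixes f :: "'a::euclidean_space \<Rightarrow> 'b::euclidean_space"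
  assumes "smooth_map_on A f"
  shows "locally_lipschitz_on A f"
  unfolding locally_lipschitz_on_def
proof
  fix x assume "x \<in> A"
  then obtain W F where W: "x \<in> W" "smooth_on_open W F" "\<forall>y\<in>A \<inter> W. F y = f y"
    using assms unfolding smooth_map_on_def by blast
  then obtain e where e: "e > 0" "cball x e \<subseteq> W"
    using smooth_on_openD(1)[OF W(2)] open_contains_cball by blast
  \<comment> \<open>Smoothness is phrased through directional derivatives, so the operator norm is
    dominated by the sum over the basis directions, each of which is continuous.\<close>
  define h where "h y = (\<Sum>b\<in>Basis. norm (frechet_derivative F (at y) b))" for y
  have "continuous_on W (\<lambda>y. frechet_derivative F (at y) b)" for b
    using smooth_on_openD(2)[OF smooth_on_open_frechet[OF W(2)]] C_diff_imp_continuous by blast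
  then have "continuous_on (cball x e) h"
    unfolding h_def by (intro continuous_intros) (blast intro: continuous_on_subset[OF _ e(2)])
  then have "bounded (h ` cball x e)" by (intro compact_imp_bounded compact_continuous_image) auto
  then obtain B where "\<forall>z\<in>h ` cball x e. norm z \<le> B" unfolding bounded_iff by blast
  then have B: "h y \<le> B" if "y \<in> cball x e" for y using that by (auto dest!: bspec)
  have d: "(F has_derivative frechet_derivative F (at y)) (at y)" if "y \<in> cball x e" for y
    using smooth_on_open_has_derivative[OF W(2)] e that by auto
  have on: "onorm (frechet_derivative F (at y)) \<le> B" if y: "y \<in> cball x e" for y
  proof (rule onorm_le)
    fix w
    interpret bounded_linear "frechet_derivative F (at y)"
      using d[OF y] by (rule has_derivative_bounded_linear)
    have "frechet_derivative F (at y) w = (\<Sum>b\<in>Basis. (w \<bullet> b) *\<^sub>R frechet_derivative F (at y) b)"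
      by (subst euclidean_representation[of w, symmetric]) (simp add: sum scaleR)
    also have "norm \<dots> \<le> (\<Sum>b\<in>Basis. norm (frechet_derivative F (at y) b) * norm w)"
      by (rule sum_norm_le) (auto simp: mult.commute[of _ "norm w"] Basis_le_norm intro!: mult_right_mono)
    also have "\<dots> = h y * norm w" by (simp add: h_def sum_distrib_right)
    also have "\<dots> \<le> B * norm w" using B[OF y] by (intro mult_right_mono) auto
    finally show "norm (frechet_derivative F (at y) w) \<le> B * norm w" .
  qed
  have "B-lipschitz_on (cball x e \<inter> A) f"
  proof (rule lipschitz_onI)
    fix y z assume yz: "y \<in> cball x e \<inter> A" "z \<in> cball x e \<inter> A"
    have "norm (F y - F z) \<le> B * norm (y - z)"
      by (rule differentiable_bound[OF convex_cball[of x e]])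
        (use d on yz in \<open>auto intro: has_derivative_at_withinI\<close>)
    then show "dist (f y) (f z) \<le> B * dist y z" using W e yz by (auto simp: dist_norm subset_iff)
  next
    have "0 \<le> h x" unfolding h_def by (intro sum_nonneg) auto
    also have "h x \<le> B" using B[of x] e by simp
    finally show "0 \<le> B" .
  qed
  then show "\<exists>e>0. \<exists>L. L-lipschitz_on (cball x e \<inter> A) f" using e by blast
qed

section \<open>Local Lipschitz continuity\<close>

lemma locally_lipschitz_on_cong:
  "(\<And>x. x \<in> A \<Longrightarrow> f x = g x) \<Longrightarrow> locally_lipschitz_on A f \<Longrightarrow> locally_lipschitz_on A g"
  unfolding locally_lipschitz_on_def lipschitz_on_def by (metis IntD2)

lemma locally_lipschitz_on_locally:
  assumes "\<And>x. x \<in> A \<Longrightarrow> \<exists>W. open W \<and> x \<in> W \<and> locally_lipschitz_on (A \<inter> W) f"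
  shows "locally_lipschitz_on A f"
  unfolding locally_lipschitz_on_def
proof
  fix x assume x: "x \<in> A"
  then obtain W where W: "open W" "x \<in> W" "locally_lipschitz_on (A \<inter> W) f" using assms by blast
  then obtain e L where e: "e > 0" "L-lipschitz_on (cball x e \<inter> (A \<inter> W)) f"
    using x unfolding locally_lipschitz_on_def by blast
  obtain d where d: "d > 0" "cball x d \<subseteq> W" using W open_contains_cball by blast
  have "L-lipschitz_on (cball x (min d e) \<inter> A) f"
    using e(2) by (rule lipschitz_on_subset) (use d in \<open>auto simp: subset_iff\<close>)
  then show "\<exists>e>0. \<exists>L. L-lipschitz_on (cball x e \<inter> A) f" using d e by (intro exI[of _ "min d e"]) auto
qed

lemma locally_lipschitz_on_subset: "locally_lipschitz_on A f \<Longrightarrow> B \<subseteq> A \<Longrightarrow> locally_lipschitz_on B f"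
  unfolding locally_lipschitz_on_def by (meson Int_mono lipschitz_on_subset order_refl subsetD)

lemma locally_lipschitz_on_continuous: "locally_lipschitz_on A f \<Longrightarrow> continuous_on A f"
  unfolding continuous_on_eq_continuous_within
proof
  fix x assume "locally_lipschitz_on A f" "x \<in> A"
  then obtain e L where e: "e > 0" "L-lipschitz_on (cball x e \<inter> A) f"
    unfolding locally_lipschitz_on_def by blast
  have "continuous_on (cball x e \<inter> A) f" using e(2) by (rule lipschitz_on_continuous_on)
  then have "continuous (at x within (cball x e \<inter> A)) f"
    using \<open>x \<in> A\<close> e(1) by (auto simp: continuous_on_eq_continuous_within)
  then have "continuous (at x within (A \<inter> ball x e)) f"
    by (rule continuous_within_subset) (auto simp: subset_iff)
  then show "continuous (at x within A) f"
    using at_within_nhd[of x "ball x e" A "A \<inter> ball x e"] e(1) by (simp add: Int_Diff Int_assoc)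
qed

lemma locally_lipschitz_on_compose:
  assumes f: "locally_lipschitz_on A f" and g: "locally_lipschitz_on B g" and sub: "f ` A \<subseteq> B"
  shows "locally_lipschitz_on A (\<lambda>x. g (f x))"
  unfolding locally_lipschitz_on_def
proof
  fix x assume x: "x \<in> A"
  obtain e L where e: "e > 0" "L-lipschitz_on (cball x e \<inter> A) f"
    using f x unfolding locally_lipschitz_on_def by blast
  obtain d K where d: "d > 0" "K-lipschitz_on (cball (f x) d \<inter> B) g"
    using g x sub unfolding locally_lipschitz_on_def by blast
  have L: "L \<ge> 0" using e(2) lipschitz_on_nonneg by blast
  \<comment> \<open>Small enough for \<open>f\<close> to map the ball into the ball of radius
    \<open>d\<close> around \<open>f x\<close>; L + 1 avoids a division by zero.\<close>
  define r where "r = min e (d / (L + 1))"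
  have r: "r > 0" "r \<le> e" using e d L by (auto simp: r_def)
  have "f ` (cball x r \<inter> A) \<subseteq> cball (f x) d \<inter> B"
  proof safe
    fix y assume y: "y \<in> cball x r" "y \<in> A"
    have "dist (f x) (f y) \<le> L * dist x y"
      using lipschitz_onD[OF e(2), of x y] x y e r by auto
    also have "\<dots> \<le> (L + 1) * (d / (L + 1))" using y L d by (intro mult_mono) (auto simp: r_def)
    also have "\<dots> = d" using L by simp
    finally show "f y \<in> cball (f x) d" by simp
    show "f y \<in> B" using y sub by auto
  qed
  then have "K-lipschitz_on (f ` (cball x r \<inter> A)) g" using d(2) lipschitz_on_subset by blast
  moreover have "L-lipschitz_on (cball x r \<inter> A) f"
    using e(2) by (rule lipschitz_on_subset) (use r in \<open>auto simp: subset_iff\<close>)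
  ultimately have "(K * L)-lipschitz_on (cball x r \<inter> A) (\<lambda>x. g (f x))"
    using lipschitz_on_compose2[of L "cball x r \<inter> A" f K g] by blast
  then show "\<exists>e>0. \<exists>L. L-lipschitz_on (cball x e \<inter> A) (\<lambda>x. g (f x))" using r by blast
qed

lemma locally_lipschitz_on_Pair:
  assumes "locally_lipschitz_on A f" "locally_lipschitz_on A g"
  shows "locally_lipschitz_on A (\<lambda>x. (f x, g x))"
  unfolding locally_lipschitz_on_def
proof
  fix x assume x: "x \<in> A"
  obtain e L where e: "e > 0" "L-lipschitz_on (cball x e \<inter> A) f"
    using assms(1) x unfolding locally_lipschitz_on_def by blast
  obtain d K where d: "d > 0" "K-lipschitz_on (cball x d \<inter> A) g"
    using assms(2) x unfolding locally_lipschitz_on_def by blast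
  have "L-lipschitz_on (cball x (min d e) \<inter> A) f" "K-lipschitz_on (cball x (min d e) \<inter> A) g"
    by (rule lipschitz_on_subset[OF e(2)], force, rule lipschitz_on_subset[OF d(2)], force)
  from lipschitz_on_Pair[OF this] show "\<exists>e>0. \<exists>L. L-lipschitz_on (cball x e \<inter> A) (\<lambda>x. (f x, g x))"
    using e d by (intro exI[of _ "min d e"]) auto
qed

lemma bounded_linear_locally_lipschitz: "bounded_linear f \<Longrightarrow> locally_lipschitz_on A f"
  unfolding locally_lipschitz_on_def
  using bounded_linear.lipschitz_boundE[of f] zero_less_one by metis

text \<open>Viewed as a map on the product space, \<open>B\<close> is smooth. Sums and products of
  locally Lipschitz maps are then handled by pairing and composition.\<close>

lemma bounded_bilinear_locally_lipschitz:
  fixes B :: "'a::euclidean_space \<Rightarrow> 'b::euclidean_space \<Rightarrow> 'c::euclidean_space"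
  assumes "bounded_bilinear B"
  shows "locally_lipschitz_on A (\<lambda>z. B (fst z) (snd z))"
proof (rule smooth_imp_locally_lipschitz)
  have "C_diff k UNIV (\<lambda>z::'a \<times> 'b. B (fst z) (snd z))" for k
    by (intro C_diff_bilinear[OF assms] C_diff_bounded_linear bounded_linear_fst bounded_linear_snd open_UNIV)
  then show "smooth_map_on A (\<lambda>z. B (fst z) (snd z))"
    by (intro smooth_on_open_imp_map_on[of UNIV]) (auto simp: smooth_on_open_def)
qed

lemma locally_lipschitz_on_bilinear:
  fixes B :: "'a::euclidean_space \<Rightarrow> 'b::euclidean_space \<Rightarrow> 'c::euclidean_space"
  assumes "bounded_bilinear B" "locally_lipschitz_on A f" "locally_lipschitz_on A g"
  shows "locally_lipschitz_on A (\<lambda>x. B (f x) (g x))"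
  using locally_lipschitz_on_compose[OF locally_lipschitz_on_Pair[OF assms(2,3)]
      bounded_bilinear_locally_lipschitz[OF assms(1), of UNIV]] by simp

lemmas locally_lipschitz_on_scaleR = locally_lipschitz_on_bilinear[OF bounded_bilinear_scaleR]
lemmas locally_lipschitz_on_inner = locally_lipschitz_on_bilinear[OF bounded_bilinear_inner]
lemmas locally_lipschitz_on_mult = locally_lipschitz_on_bilinear[OF bounded_bilinear_mult]

lemma locally_lipschitz_on_linear:
  "bounded_linear h \<Longrightarrow> locally_lipschitz_on A f \<Longrightarrow> locally_lipschitz_on A (\<lambda>x. h (f x))"
  by (rule locally_lipschitz_on_compose[OF _ bounded_linear_locally_lipschitz[of h UNIV]]) auto

lemma locally_lipschitz_on_const: "locally_lipschitz_on A (\<lambda>x. c)"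
  unfolding locally_lipschitz_on_def using lipschitz_on_constant zero_less_one by blast

lemma locally_lipschitz_on_add:
  fixes f g :: "'a::metric_space \<Rightarrow> 'b::euclidean_space"
  assumes "locally_lipschitz_on A f" "locally_lipschitz_on A g"
  shows "locally_lipschitz_on A (\<lambda>x. f x + g x)"
  using locally_lipschitz_on_linear[OF bounded_linear_add[OF bounded_linear_fst bounded_linear_snd]
      locally_lipschitz_on_Pair[OF assms]] by simp

lemma locally_lipschitz_on_diff:
  fixes f g :: "'a::metric_space \<Rightarrow> 'b::euclidean_space"
  assumes "locally_lipschitz_on A f" "locally_lipschitz_on A g"
  shows "locally_lipschitz_on A (\<lambda>x. f x - g x)"
  using locally_lipschitz_on_linear[OF bounded_linear_sub[OF bounded_linear_fst bounded_linear_snd]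
      locally_lipschitz_on_Pair[OF assms]] by simp

lemma locally_lipschitz_on_sum:
  fixes f :: "'i \<Rightarrow> 'a::metric_space \<Rightarrow> 'b::euclidean_space"
  shows "finite I \<Longrightarrow> (\<And>i. i \<in> I \<Longrightarrow> locally_lipschitz_on A (f i)) \<Longrightarrow> locally_lipschitz_on A (\<lambda>x. \<Sum>i\<in>I. f i x)"
  by (induction I rule: finite_induct) (auto intro: locally_lipschitz_on_const locally_lipschitz_on_add)

section \<open>Tangent spaces and orthogonal projections\<close>

lemma has_vector_derivative_unique_eventually:
  assumes "(f has_vector_derivative a) (at t)" "(g has_vector_derivative b) (at t)"
    "\<forall>\<^sub>F s in nhds t. f s = g s"
  shows "a = b"
proof -
  from assms(3) obtain S where S: "open S" "t \<in> S" "\<And>s. s \<in> S \<Longrightarrow> f s = g s"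
    unfolding eventually_nhds by blast
  have "(g has_vector_derivative a) (at t)"
    by (rule has_vector_derivative_transform_within_open[OF assms(1) S])
  then show ?thesis using assms(2) vector_derivative_unique_at by blast
qed

lemma has_derivative_along_curve:
  assumes "(F has_derivative F') (at (c t))" "(c has_vector_derivative v) (at t)"
  shows "((\<lambda>s. F (c s)) has_vector_derivative F' v) (at t)"
proof -
  have "((\<lambda>s. F (c s)) has_derivative (\<lambda>r. F' (r *\<^sub>R v))) (at t)"
    using has_derivative_compose[of c "\<lambda>r. r *\<^sub>R v" t UNIV F F'] assms
    by (simp add: has_vector_derivative_def)
  then show ?thesis
    unfolding has_vector_derivative_def
    using linear_scale[OF has_derivative_linear[OF assms(1)]] by simp
qed

lemma linear_representation:
  assumes "linear f"
  shows "f v = (\<Sum>b\<in>Basis. (v \<bullet> b) *\<^sub>R f b)"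
proof -
  have "f v = f (\<Sum>b\<in>Basis. (v \<bullet> b) *\<^sub>R b)" by (simp only: euclidean_representation)
  also have "\<dots> = (\<Sum>b\<in>Basis. (v \<bullet> b) *\<^sub>R f b)"
    by (simp only: linear_sum[OF assms] linear_scale[OF assms])
  finally show ?thesis .
qed

lemma curve_eventually:
  fixes c :: "real \<Rightarrow> 'b::real_normed_vector"
  assumes "(c has_vector_derivative v) (at t)" "open W" "c t \<in> W"
  shows "\<forall>\<^sub>F s in nhds t. c s \<in> W"
proof -
  have "continuous (at t) c" using assms(1) by (rule has_vector_derivative_continuous)
  then have "(c \<longlongrightarrow> c t) (nhds t)"
    by (simp add: continuous_at tendsto_at_iff_tendsto_nhds)
  then show ?thesis using assms(2,3) topological_tendstoD by blast
qed

lemma smooth_curve_throughD: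
  assumes "smooth_curve_through Q q v c"
  shows "c 0 = q" "\<forall>\<^sub>F s in nhds 0. c s \<in> Q" "(c has_vector_derivative v) (at 0)"
proof -
  obtain e where e: "e > 0" "c ` {-e<..<e} \<subseteq> Q"
    and c: "c 0 = q" "(c has_vector_derivative v) (at 0)"
    using assms unfolding smooth_curve_through_def by blast
  show "c 0 = q" "(c has_vector_derivative v) (at 0)" by fact+
  have "open {-e<..<e}" "0 \<in> {-e<..<e}" using e by auto
  then show "\<forall>\<^sub>F s in nhds 0. c s \<in> Q"
    unfolding eventually_nhds using e(2) by (intro exI[of _ "{-e<..<e}"]) auto
qed

text \<open>Gram-Schmidt: projecting off one more covector \<open>N l\<close> only needs a division by the
  positive smooth function \<open>w \<bullet> w\<close>.\<close>

lemma smooth_kernel_projection: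
  fixes N :: "'i \<Rightarrow> 'a::euclidean_space \<Rightarrow> 'a"
  assumes U: "open U" and B: "finite B" "\<And>l. l \<in> B \<Longrightarrow> smooth_on_open U (N l)"
    and indep: "\<And>B' l q. B' \<subseteq> B \<Longrightarrow> l \<in> B - B' \<Longrightarrow> q \<in> U \<Longrightarrow> \<exists>v. (\<forall>l'\<in>B'. N l' q \<bullet> v = 0) \<and> N l q \<bullet> v \<noteq> 0"
  shows "\<exists>Pr. (\<forall>x. smooth_on_open U (\<lambda>q. Pr q x)) \<and> (\<forall>q\<in>U. linear (Pr q) \<and>
      (\<forall>x. (\<forall>l\<in>B. N l q \<bullet> Pr q x = 0) \<and> (\<forall>v. (\<forall>l\<in>B. N l q \<bullet> v = 0) \<longrightarrow> (x - Pr q x) \<bullet> v = 0)))"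
  using B indep
proof (induction B rule: finite_induct)
  case empty
  have "\<forall>x. smooth_on_open U (\<lambda>q. x)" using U by (simp add: smooth_on_open_def C_diff_const)
  then show ?case by (intro exI[of _ "\<lambda>q x. x"]) (auto simp: linear_iff)
next
  case (insert l B)
  have sub: "\<And>l'. l' \<in> B \<Longrightarrow> smooth_on_open U (N l')" using insert.prems by blast
  have "\<exists>Pr. (\<forall>x. smooth_on_open U (\<lambda>q. Pr q x)) \<and> (\<forall>q\<in>U. linear (Pr q) \<and>
      (\<forall>x. (\<forall>l\<in>B. N l q \<bullet> Pr q x = 0) \<and> (\<forall>v. (\<forall>l\<in>B. N l q \<bullet> v = 0) \<longrightarrow> (x - Pr q x) \<bullet> v = 0)))"
  proof (rule insert.IH)
    fix B' l' q assume "B' \<subseteq> B" "l' \<in> B - B'" "q \<in> U"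
    then show "\<exists>v. (\<forall>l'\<in>B'. N l' q \<bullet> v = 0) \<and> N l' q \<bullet> v \<noteq> 0" by (intro insert.prems) auto
  qed (rule sub)
  then obtain Pr where Pr: "\<And>x. smooth_on_open U (\<lambda>q. Pr q x)" "\<And>q. q \<in> U \<Longrightarrow> linear (Pr q)"
    "\<And>q x l'. q \<in> U \<Longrightarrow> l' \<in> B \<Longrightarrow> N l' q \<bullet> Pr q x = 0"
    "\<And>q x v. q \<in> U \<Longrightarrow> (\<forall>l'\<in>B. N l' q \<bullet> v = 0) \<Longrightarrow> (x - Pr q x) \<bullet> v = 0" by blast
  \<comment> \<open>The part of \<open>N l q\<close> inside the kernel of the earlier covectors. On
    that kernel it represents the same functional as \<open>N l q\<close>, and \<open>indep\<close>
    keeps it away from 0.\<close>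
  define w where "w q = Pr q (N l q)" for q
  have wB: "N l' q \<bullet> w q = 0" if "q \<in> U" "l' \<in> B" for l' q using Pr(3) that by (simp add: w_def)
  have Nw: "N l q \<bullet> v = w q \<bullet> v" if "q \<in> U" "\<forall>l'\<in>B. N l' q \<bullet> v = 0" for q v
    using Pr(4)[OF that, of "N l q"] by (simp add: w_def inner_diff_left)
  have w0: "w q \<bullet> w q \<noteq> 0" if "q \<in> U" for q
  proof -
    have "\<exists>v. (\<forall>l'\<in>B. N l' q \<bullet> v = 0) \<and> N l q \<bullet> v \<noteq> 0"
      by (rule insert.prems(2)) (use insert.hyps that in auto)
    then obtain v where "\<forall>l'\<in>B. N l' q \<bullet> v = 0" "N l q \<bullet> v \<noteq> 0" by blast
    then have "w q \<bullet> v \<noteq> 0" using Nw that by simp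
    then show ?thesis by auto
  qed
  define Pr' where "Pr' q x = Pr q x - (inverse (w q \<bullet> w q) * (x \<bullet> w q)) *\<^sub>R w q" for q x
  \<comment> \<open>In \<open>w\<close> the argument of \<open>Pr q\<close> moves with
    \<open>q\<close>, too. Expansion in the basis reduces this to smoothness of
    \<open>Pr q b\<close> for fixed \<open>b\<close>.\<close>
  have wsm: "C_diff k U w" for k
  proof (rule C_diff_cong[OF U])
    show "(\<Sum>b\<in>Basis. (N l q \<bullet> b) *\<^sub>R Pr q b) = w q" if "q \<in> U" for q
    proof -
      have "w q = Pr q (\<Sum>b\<in>Basis. (N l q \<bullet> b) *\<^sub>R b)" by (simp add: w_def euclidean_representation)
      also have "\<dots> = (\<Sum>b\<in>Basis. (N l q \<bullet> b) *\<^sub>R Pr q b)"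
        using Pr(2)[OF that] by (simp add: linear_sum linear_scale)
      finally show ?thesis by simp
    qed
    have "C_diff k U (N l)" "C_diff k U (\<lambda>q. Pr q b)" for b
      using insert.prems(1)[of l] Pr(1) by (auto simp: smooth_on_open_def)
    then show "C_diff k U (\<lambda>q. \<Sum>b\<in>Basis. (N l q \<bullet> b) *\<^sub>R Pr q b)"
      by (intro C_diff_sum U C_diff_bilinear[OF bounded_bilinear_scaleR]
        C_diff_bilinear[OF bounded_bilinear_inner] C_diff_const) auto
  qed
  have "smooth_on_open U (\<lambda>q. Pr' q x)" for x
  proof -
    have "C_diff k U (\<lambda>q. Pr q x + (- 1) *\<^sub>R ((inverse (w q \<bullet> w q) * (x \<bullet> w q)) *\<^sub>R w q))" for k
      using smooth_on_openD(2)[OF Pr(1)]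
      by (intro C_diff_add U C_diff_bilinear[OF bounded_bilinear_scaleR] C_diff_inverse w0 C_diff_const
        C_diff_bilinear[OF bounded_bilinear_mult] C_diff_bilinear[OF bounded_bilinear_inner] wsm)
    then show ?thesis using U by (simp add: smooth_on_open_def Pr'_def)
  qed
  moreover have "linear (Pr' q)" if "q \<in> U" for q
    using linear_add[OF Pr(2)[OF that]] linear_scale[OF Pr(2)[OF that]]
    by (intro linearI) (simp_all add: Pr'_def algebra_simps inner_add_left)
  moreover have "N l' q \<bullet> Pr' q x = 0" if q: "q \<in> U" and l': "l' \<in> insert l B" for q x l'
  proof (cases "l' = l")
    case False
    then show ?thesis using q l' Pr(3)[OF q] wB[OF q] by (simp add: Pr'_def inner_diff_right)
  next
    case True
    have 1: "N l q \<bullet> Pr q x = w q \<bullet> Pr q x" using Nw[OF q] Pr(3)[OF q] by blast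
    have 2: "N l q \<bullet> w q = w q \<bullet> w q" using Nw[OF q] wB[OF q] by blast
    have 3: "x \<bullet> w q = w q \<bullet> Pr q x"
      using Pr(4)[OF q, of "w q" x] wB[OF q] by (simp add: inner_diff_left inner_commute[of "w q"])
    show ?thesis unfolding True Pr'_def
      using w0[OF q] by (simp add: inner_diff_right 1 2 3)
  qed
  moreover have "(x - Pr' q x) \<bullet> v = 0" if q: "q \<in> U" and v: "\<forall>l'\<in>insert l B. N l' q \<bullet> v = 0" for q x v
  proof -
    have "w q \<bullet> v = 0" using Nw[OF q, of v] v by simp
    moreover have "(x - Pr q x) \<bullet> v = 0" using Pr(4)[OF q] v by simp
    ultimately show ?thesis by (simp add: Pr'_def inner_diff_left)
  qed
  ultimately show ?case by (intro exI[of _ Pr']) blast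
qed

section \<open>Tangent spaces of a closed embedded submanifold\<close>

definition tangent_proj :: "'a::euclidean_space set \<Rightarrow> 'a \<Rightarrow> 'a \<Rightarrow> 'a" where
  "tangent_proj Q q x = (THE y. y \<in> tangent_space Q q \<and> (\<forall>z\<in>tangent_space Q q. (x - y) \<bullet> z = 0))"

locale submanifold =
  fixes Q :: "'a::euclidean_space set" and k :: nat
  assumes emb: "embedded_submanifold k Q" and closed_Q: "closed Q"
begin

abbreviation "TS \<equiv> tangent_space Q"
abbreviation "P \<equiv> tangent_proj Q"

text \<open>A flattening diffeomorphism \<Phi> maps \<open>Q\<close> into the subspace
  \<open>L\<close>, so the tangent space at \<open>q\<close> is the preimage of \<open>L\<close>
  under the derivative of \<Phi>. It is cut out by the pulled-back covectors of a basis of the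
  orthogonal complement of \<open>L\<close>. The last property concerns curves that are
  differentiable at one time only, while tangent vectors are defined through smooth curves.\<close>

lemma tangent_space_kernel:
  assumes q0: "q0 \<in> Q"
  obtains U B N where "open U" "q0 \<in> U" "finite (B :: 'a set)" "\<And>l. l \<in> B \<Longrightarrow> smooth_on_open U (N l)"
    "\<And>B' l q. B' \<subseteq> B \<Longrightarrow> l \<in> B - B' \<Longrightarrow> q \<in> U \<Longrightarrow> \<exists>v. (\<forall>l'\<in>B'. N l' q \<bullet> v = 0) \<and> N l q \<bullet> (v :: 'a) \<noteq> 0"
    "\<And>q v. q \<in> Q \<inter> U \<Longrightarrow> v \<in> TS q \<longleftrightarrow> (\<forall>l\<in>B. N l q \<bullet> v = 0)"
    "\<And>c t v l. l \<in> B \<Longrightarrow> c t \<in> Q \<inter> U \<Longrightarrow> (\<forall>\<^sub>F s in nhds t. c s \<in> Q) \<Longrightarrow> (c has_vector_derivative v) (at t) \<Longrightarrow>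
       N l (c t) \<bullet> v = 0"
proof -
  from bspec[OF emb[unfolded embedded_submanifold_def] q0]
  obtain U V :: "'a set" and \<Phi> \<Psi> :: "'a \<Rightarrow> 'a" and L :: "'a set" where
    ch: "q0 \<in> U" "smooth_on_open U \<Phi>" "smooth_on_open V \<Psi>" "homeomorphism U V \<Phi> \<Psi>"
      "subspace L" "\<Phi> ` (Q \<inter> U) = V \<inter> L"
    by (elim exE conjE)
  have oU: "open U" and oV: "open V" using ch smooth_on_openD(1) by blast+
  have inv: "\<And>x. x \<in> U \<Longrightarrow> \<Phi> x \<in> V \<and> \<Psi> (\<Phi> x) = x" "\<And>y. y \<in> V \<Longrightarrow> \<Psi> y \<in> U \<and> \<Phi> (\<Psi> y) = y"
    using ch(4) unfolding homeomorphism_def by auto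
  define DF where "DF q = frechet_derivative \<Phi> (at q)" for q
  define DP where "DP q = frechet_derivative \<Psi> (at (\<Phi> q))" for q
  have DF: "(\<Phi> has_derivative DF q) (at q)" if "q \<in> U" for q
    unfolding DF_def using smooth_on_open_has_derivative[OF ch(2) that] .
  have DP: "(\<Psi> has_derivative DP q) (at (\<Phi> q))" if "q \<in> U" for q
    unfolding DP_def using smooth_on_open_has_derivative[OF ch(3)] inv(1)[OF that] by blast
  have DPDF: "DP q (DF q v) = v" if q: "q \<in> U" for q v
  proof -
    have "((\<lambda>x. \<Psi> (\<Phi> x)) has_derivative (\<lambda>v. DP q (DF q v))) (at q)"
      using has_derivative_compose[OF DF[OF q] DP[OF q]] .
    moreover have "((\<lambda>x. \<Psi> (\<Phi> x)) has_derivative (\<lambda>v. v)) (at q)"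
      by (rule has_derivative_transform_within_open[OF has_derivative_ident oU q]) (use inv in auto)
    ultimately show ?thesis using has_derivative_unique by metis
  qed
  have DFDP: "DF q (DP q v) = v" if q: "q \<in> U" for q v
  proof -
    have "(\<Phi> has_derivative DF q) (at (\<Psi> (\<Phi> q)))" using DF[OF q] inv(1)[OF q] by simp
    from has_derivative_compose[OF DP[OF q] this]
    have "((\<lambda>x. \<Phi> (\<Psi> x)) has_derivative (\<lambda>v. DF q (DP q v))) (at (\<Phi> q))" .
    moreover have "((\<lambda>x. \<Phi> (\<Psi> x)) has_derivative (\<lambda>v. v)) (at (\<Phi> q))"
      by (rule has_derivative_transform_within_open[OF has_derivative_ident oV]) (use inv q in auto)
    ultimately show ?thesis using has_derivative_unique by metis
  qed
  obtain B where B: "B \<subseteq> orthogonal_comp L" "independent B" "orthogonal_comp L \<subseteq> span B"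
    using basis_exists by metis
  have finB: "finite B" using B(2) by (rule independent_imp_finite)
  have L: "v \<in> L \<longleftrightarrow> (\<forall>l\<in>B. l \<bullet> v = 0)" for v
  proof
    assume "v \<in> L"
    then show "\<forall>l\<in>B. l \<bullet> v = 0"
      using B(1) by (auto simp: orthogonal_comp_def orthogonal_def inner_commute)
  next
    assume *: "\<forall>l\<in>B. l \<bullet> v = 0"
    have "orthogonal v l" if "l \<in> span B" for l
      using that by (rule orthogonal_to_span) (use * in \<open>auto simp: orthogonal_def inner_commute\<close>)
    then have "v \<in> orthogonal_comp (orthogonal_comp L)"
      using B(3) by (auto simp: orthogonal_comp_def[of "orthogonal_comp L"] orthogonal_commute subset_iff)
    then show "v \<in> L" using orthogonal_comp_self[OF ch(5)] by simp
  qed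
  \<comment> \<open>The adjoint of \<open>DF q\<close> applied to \<open>l\<close>.\<close>
  define N where "N l q = (\<Sum>b\<in>Basis. (DF q b \<bullet> l) *\<^sub>R b)" for l q
  have Nv: "N l q \<bullet> v = DF q v \<bullet> l" if q: "q \<in> U" for l q v
  proof -
    have "DF q v = (\<Sum>b\<in>Basis. (v \<bullet> b) *\<^sub>R DF q b)"
      by (rule linear_representation[OF has_derivative_linear[OF DF[OF q]]])
    then show ?thesis by (simp add: N_def inner_sum_left inner_sum_right inner_commute mult.commute)
  qed
  have curve: "N l (c t) \<bullet> v = 0"
    if "l \<in> B" "c t \<in> Q \<inter> U" "\<forall>\<^sub>F s in nhds t. c s \<in> Q" "(c has_vector_derivative v) (at t)" for c t v l
  proof -
    have "((\<lambda>s. \<Phi> (c s)) has_vector_derivative DF (c t) v) (at t)"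
      by (rule has_derivative_along_curve[OF DF that(4)]) (use that(2) in blast)
    then have "((\<lambda>s. \<Phi> (c s) \<bullet> l) has_vector_derivative DF (c t) v \<bullet> l) (at t)"
      by (rule bounded_linear.has_vector_derivative[OF bounded_linear_inner_left])
    moreover have "\<forall>\<^sub>F s in nhds t. c s \<in> U" using curve_eventually[OF that(4) oU] that(2) by auto
    then have "\<forall>\<^sub>F s in nhds t. \<Phi> (c s) \<bullet> l = 0"
      using that(3)
    proof eventually_elim
      case (elim s)
      then have "\<Phi> (c s) \<in> L" using ch(6) by blast
      then show ?case using L that(1) by (simp add: inner_commute)
    qed
    ultimately have "DF (c t) v \<bullet> l = 0"
      by (rule has_vector_derivative_unique_eventually[OF _ has_vector_derivative_const])
    then show ?thesis using Nv that(2) by simp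
  qed
  show ?thesis
  proof (rule that[OF oU ch(1) finB _ _ _ curve])
    show "smooth_on_open U (N l)" if "l \<in> B" for l
    proof -
      have "C_diff m U (\<lambda>q. DF q b)" for m b
        using smooth_on_openD(2)[OF smooth_on_open_frechet[OF ch(2)]] unfolding DF_def .
      then have "C_diff m U (N l)" for m unfolding N_def
        by (intro C_diff_sum oU C_diff_bilinear[OF bounded_bilinear_scaleR]
          C_diff_bilinear[OF bounded_bilinear_inner] C_diff_const) auto
      then show ?thesis using oU by (simp add: smooth_on_open_def)
    qed
    show "\<exists>v. (\<forall>l'\<in>B'. N l' q \<bullet> v = 0) \<and> N l q \<bullet> v \<noteq> 0" if "B' \<subseteq> B" "l \<in> B - B'" "q \<in> U" for B' l q
    proof -
      have "l \<notin> span B'"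
        using B(2) that unfolding dependent_def by (metis DiffD1 DiffD2 Diff_empty in_mono span_mono subset_Diff_insert)
      \<comment> \<open>The component \<open>z\<close> of \<open>l\<close> orthogonal to the span of
        \<open>B'\<close> is nonzero. Pulled back by the inverse derivative \<open>DP q\<close>, it
        is annihilated by the covectors of \<open>B'\<close> but not by that of
        \<open>l\<close>.\<close>
      obtain y z where yz: "y \<in> span B'" "\<And>w. w \<in> span B' \<Longrightarrow> orthogonal z w" "l = y + z"
        using orthogonal_subspace_decomp_exists[of B' l] by metis
      have "z \<noteq> 0" using yz(1,3) \<open>l \<notin> span B'\<close> by auto
      have "z \<bullet> l = z \<bullet> z" using yz by (simp add: inner_add_right orthogonal_def)
      then have "z \<bullet> l \<noteq> 0" using \<open>z \<noteq> 0\<close> by simp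
      moreover have "z \<bullet> l' = 0" if "l' \<in> B'" for l' using yz(2)[of l'] that by (simp add: orthogonal_def span_base)
      ultimately show ?thesis using Nv[OF that(3)] DFDP[OF that(3)] by (intro exI[of _ "DP q z"]) auto
    qed
    show "v \<in> TS q \<longleftrightarrow> (\<forall>l\<in>B. N l q \<bullet> v = 0)" if q: "q \<in> Q \<inter> U" for q v
    proof
      assume "v \<in> TS q"
      then obtain c where c: "smooth_curve_through Q q v c" unfolding tangent_space_def by blast
      show "\<forall>l\<in>B. N l q \<bullet> v = 0"
        using curve[of _ c 0 v] smooth_curve_throughD[OF c] q by auto
    next
      assume "\<forall>l\<in>B. N l q \<bullet> v = 0"
      then have dL: "DF q v \<in> L" using L Nv q by (simp add: inner_commute)
      define d where "d = DF q v"
      have "\<Phi> q \<in> V \<inter> L" using q ch(6) by blast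
      have "open ((\<lambda>s. \<Phi> q + s *\<^sub>R d) -` V)"
        by (rule open_vimage[OF oV]) (intro continuous_intros)
      moreover have "0 \<in> (\<lambda>s. \<Phi> q + s *\<^sub>R d) -` V" using \<open>\<Phi> q \<in> V \<inter> L\<close> by simp
      ultimately obtain e where e: "e > 0" "ball 0 e \<subseteq> (\<lambda>s. \<Phi> q + s *\<^sub>R d) -` V"
        unfolding open_contains_ball by blast
      \<comment> \<open>A straight line in the chart; it stays in \<open>L\<close> because its
        direction \<open>d\<close> lies in \<open>L\<close>.\<close>
      define c where "c s = \<Psi> (\<Phi> q + s *\<^sub>R d)" for s
      have eV: "\<Phi> q + s *\<^sub>R d \<in> V" if "s \<in> {-e<..<e}" for s
        using e(2) that by (auto simp: subset_iff dist_real_def)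
      have "smooth_on_open {-e<..<e} c"
        unfolding smooth_on_open_def c_def
        using C_diff_affine[OF oV, of "{-e<..<e}" "\<Phi> q" d _ \<Psi>] eV smooth_on_openD(2)[OF ch(3)] by auto
      moreover have "c s \<in> Q" if "s \<in> {-e<..<e}" for s
      proof -
        have "\<Phi> q + s *\<^sub>R d \<in> V \<inter> L"
          using eV[OF that] \<open>\<Phi> q \<in> V \<inter> L\<close> dL ch(5) by (auto simp: d_def intro: subspace_add subspace_scale)
        then obtain x where "x \<in> Q \<inter> U" "\<Phi> x = \<Phi> q + s *\<^sub>R d" using ch(6) by (metis imageE)
        then show ?thesis using inv(1)[of x] by (auto simp: c_def)
      qed
      moreover have "c 0 = q" using inv q by (simp add: c_def)
      moreover have "(c has_vector_derivative v) (at 0)"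
      proof -
        have "((\<lambda>s. \<Phi> q + s *\<^sub>R d) has_vector_derivative d) (at 0)"
          by (auto intro!: derivative_eq_intros)
        from has_derivative_along_curve[of \<Psi> "DP q" "\<lambda>s. \<Phi> q + s *\<^sub>R d", OF _ this] DP q DPDF
        show ?thesis using q by (simp add: c_def[abs_def] d_def)
      qed
      ultimately have "smooth_curve_through Q q v c" unfolding smooth_curve_through_def using e(1) by blast
      then show "v \<in> TS q" unfolding tangent_space_def by blast
    qed
  qed
qed

text \<open>The covectors of \<open>tangent_space_kernel\<close> annihilate velocities of all
  differentiable curves in \<open>Q\<close>, not just of the smooth ones in the definition of
  \<open>tangent_space\<close>.\<close>

lemma velocity_tangent:
  assumes "c t \<in> Q" "\<forall>\<^sub>F s in nhds t. c s \<in> Q" "(c has_vector_derivative v) (at t)"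
  shows "v \<in> TS (c t)"
proof -
  obtain U B N where "c t \<in> U" "finite (B :: 'a set)" "\<And>q v. q \<in> Q \<inter> U \<Longrightarrow> v \<in> TS q \<longleftrightarrow> (\<forall>l\<in>B. N l q \<bullet> v = 0)"
    "\<And>c t v l. l \<in> B \<Longrightarrow> c t \<in> Q \<inter> U \<Longrightarrow> (\<forall>\<^sub>F s in nhds t. c s \<in> Q) \<Longrightarrow> (c has_vector_derivative v) (at t) \<Longrightarrow>
       N l (c t) \<bullet> v = 0"
    by (rule tangent_space_kernel[OF assms(1)]) (rule that)
  then show ?thesis using assms by blast
qed

lemma subspace_tangent: "q \<in> Q \<Longrightarrow> subspace (TS q)"
proof -
  assume q: "q \<in> Q"
  obtain U B N where "q \<in> U" "\<And>q v. q \<in> Q \<inter> U \<Longrightarrow> v \<in> TS q \<longleftrightarrow> (\<forall>l\<in>(B::'a set). N l q \<bullet> v = 0)"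
    by (rule tangent_space_kernel[OF q]) (rule that)
  then show ?thesis using q by (auto simp: subspace_def inner_add_right)
qed

lemma tangent_projI:
  assumes "q \<in> Q" "y \<in> TS q" "\<And>z. z \<in> TS q \<Longrightarrow> (x - y) \<bullet> z = 0"
  shows "P q x = y"
  unfolding tangent_proj_def
proof (rule the_equality)
  show "y \<in> TS q \<and> (\<forall>z\<in>TS q. (x - y) \<bullet> z = 0)" using assms by auto
  fix y' assume y': "y' \<in> TS q \<and> (\<forall>z\<in>TS q. (x - y') \<bullet> z = 0)"
  then have "y' - y \<in> TS q" using assms subspace_tangent subspace_diff by blast
  then have "(x - y) \<bullet> (y' - y) - (x - y') \<bullet> (y' - y) = 0" using assms y' by auto
  then have "(y' - y) \<bullet> (y' - y) = 0" by (simp add: inner_diff_left)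
  then show "y' = y" by simp
qed

lemma tangent_proj_local:
  assumes "q0 \<in> Q"
  obtains U Pr where "open U" "q0 \<in> U" "\<And>x. smooth_on_open U (\<lambda>q. Pr q x)"
    "\<And>q x. q \<in> Q \<inter> U \<Longrightarrow> P q x = Pr q x" "\<And>q. q \<in> Q \<inter> U \<Longrightarrow> linear (Pr q)"
    "\<And>q x. q \<in> Q \<inter> U \<Longrightarrow> Pr q x \<in> TS q"
proof -
  obtain U B N where U: "open U" "q0 \<in> U" "finite (B :: 'a set)" "\<And>l. l \<in> B \<Longrightarrow> smooth_on_open U (N l)"
    "\<And>B' l q. B' \<subseteq> B \<Longrightarrow> l \<in> B - B' \<Longrightarrow> q \<in> U \<Longrightarrow> \<exists>v. (\<forall>l'\<in>B'. N l' q \<bullet> v = 0) \<and> N l q \<bullet> (v :: 'a) \<noteq> 0"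
    "\<And>q v. q \<in> Q \<inter> U \<Longrightarrow> v \<in> TS q \<longleftrightarrow> (\<forall>l\<in>B. N l q \<bullet> v = 0)"
    by (rule tangent_space_kernel[OF assms(1)]) (rule that)
  have "\<exists>Pr. (\<forall>x. smooth_on_open U (\<lambda>q. Pr q x)) \<and> (\<forall>q\<in>U. linear (Pr q) \<and>
      (\<forall>x. (\<forall>l\<in>B. N l q \<bullet> Pr q x = 0) \<and> (\<forall>v. (\<forall>l\<in>B. N l q \<bullet> v = 0) \<longrightarrow> (x - Pr q x) \<bullet> v = 0)))"
    by (rule smooth_kernel_projection[OF U(1,3)]) (fact U(4), fact U(5))
  then obtain Pr where Pr: "\<And>x. smooth_on_open U (\<lambda>q. Pr q x)" "\<And>q. q \<in> U \<Longrightarrow> linear (Pr q)"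
    "\<And>q x l'. q \<in> U \<Longrightarrow> l' \<in> B \<Longrightarrow> N l' q \<bullet> Pr q x = 0"
    "\<And>q x v. q \<in> U \<Longrightarrow> (\<forall>l'\<in>B. N l' q \<bullet> v = 0) \<Longrightarrow> (x - Pr q x) \<bullet> v = 0" by blast
  have 1: "P q x = Pr q x" if "q \<in> Q \<inter> U" for q x
    by (rule tangent_projI) (use that U Pr in auto)
  have 2: "Pr q x \<in> TS q" if "q \<in> Q \<inter> U" for q x using that U Pr by auto
  show ?thesis by (rule that[of U Pr]) (use U Pr 1 2 in auto)
qed

lemma tangent_proj_in: "q \<in> Q \<Longrightarrow> P q x \<in> TS q"
  by (rule tangent_proj_local[of q]) auto

lemma linear_tangent_proj: "q \<in> Q \<Longrightarrow> linear (P q)"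
proof -
  assume q: "q \<in> Q"
  show "linear (P q)"
  proof (rule tangent_proj_local[OF q])
    fix U Pr assume "q \<in> U" "\<And>q x. q \<in> Q \<inter> U \<Longrightarrow> P q x = Pr q x" "\<And>q. q \<in> Q \<inter> U \<Longrightarrow> linear (Pr q)"
    then show ?thesis using q by (metis Int_iff ext)
  qed
qed

lemma tangent_proj_id: "q \<in> Q \<Longrightarrow> v \<in> TS q \<Longrightarrow> P q v = v"
  by (rule tangent_projI) auto

lemma tangent_proj_iff: "q \<in> Q \<Longrightarrow> v \<in> TS q \<longleftrightarrow> P q v = v"
  using tangent_proj_id tangent_proj_in by metis

lemma smooth_tangent_proj: "smooth_map_on Q (\<lambda>q. P q x)"
proof (rule smooth_map_on_locally)
  fix q0 assume "q0 \<in> Q"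
  then obtain U Pr where U: "open U" "q0 \<in> U" "\<And>x. smooth_on_open U (\<lambda>q. Pr q x)"
    "\<And>q x. q \<in> Q \<inter> U \<Longrightarrow> P q x = Pr q x" "\<And>q. q \<in> Q \<inter> U \<Longrightarrow> linear (Pr q)"
    "\<And>q x. q \<in> Q \<inter> U \<Longrightarrow> Pr q x \<in> TS q" by (rule tangent_proj_local) (rule that)
  have "smooth_map_on (Q \<inter> U) (\<lambda>q. Pr q x)"
    by (rule smooth_on_open_imp_map_on[OF U(3)]) auto
  then have "smooth_map_on (Q \<inter> U) (\<lambda>q. P q x)"
    by (rule smooth_map_on_cong[rotated]) (use U(4) in auto)
  then show "\<exists>W. open W \<and> q0 \<in> W \<and> smooth_map_on (Q \<inter> W) (\<lambda>q. P q x)" using U by blast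
qed

lemma tangent_proj_expand: "q \<in> Q \<Longrightarrow> P q v = (\<Sum>j\<in>Basis. (v \<bullet> j) *\<^sub>R P q j)"
  using linear_tangent_proj by (rule linear_representation)

text \<open>Tangency is the equation P q v = v. Written out in the basis, its left side is visibly
  continuous in both variables on the closed set \<open>Q \<times> UNIV\<close>.\<close>

lemma closed_tangent_bundle: "closed (tangent_bundle Q)"
proof -
  have eq: "tangent_bundle Q = (Q \<times> UNIV) \<inter> (\<lambda>z. (\<Sum>j\<in>Basis. (snd z \<bullet> j) *\<^sub>R P (fst z) j) - snd z) -` {0}"
    using tangent_proj_iff tangent_proj_expand unfolding tangent_bundle_def by (auto simp: split_beta)
  have "continuous_on Q (\<lambda>q. P q j)" for j
    using smooth_imp_locally_lipschitz[OF smooth_tangent_proj] by (rule locally_lipschitz_on_continuous)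
  then have "continuous_on (Q \<times> UNIV) (\<lambda>z. P (fst z) j)" for j
    by (rule continuous_on_compose2) (auto intro: continuous_intros)
  then have "continuous_on (Q \<times> UNIV) (\<lambda>z. (\<Sum>j\<in>Basis. (snd z \<bullet> j) *\<^sub>R P (fst z) j) - snd z)"
    by (intro continuous_intros)
  then show ?thesis
    unfolding eq by (rule continuous_closed_preimage) (auto intro: closed_Times closed_Q)
qed

section \<open>Derivatives of smooth maps on the submanifold\<close>

text \<open>The derivative of an arbitrarily chosen local extension. On tangent vectors the choice
  is immaterial; elsewhere the value depends on it, but the map is linear on the whole ambient
  space, which the later sums rely on.\<close>

definition deriv_on :: "('a \<Rightarrow> 'b::euclidean_space) \<Rightarrow> 'a \<Rightarrow> 'a \<Rightarrow> 'b" where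
  "deriv_on f q = (SOME A. \<exists>W F. q \<in> W \<and> smooth_on_open W F \<and> (\<forall>y\<in>Q \<inter> W. F y = f y) \<and>
     A = frechet_derivative F (at q))"

lemma deriv_on_extension:
  assumes "smooth_map_on Q f" "q \<in> Q"
  obtains W F where "q \<in> W" "smooth_on_open W F" "\<And>y. y \<in> Q \<inter> W \<Longrightarrow> F y = f y"
    "deriv_on f q = frechet_derivative F (at q)"
proof -
  have "\<exists>A W F. q \<in> W \<and> smooth_on_open W F \<and> (\<forall>y\<in>Q \<inter> W. F y = f y) \<and> A = frechet_derivative F (at q)"
    using assms unfolding smooth_map_on_def by blast
  from someI_ex[OF this] show ?thesis using that unfolding deriv_on_def by blast
qed

lemma extension_along_curve:
  assumes "smooth_on_open W F" "\<And>y. y \<in> Q \<inter> W \<Longrightarrow> F y = f y" "c t \<in> W"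
    "\<forall>\<^sub>F s in nhds t. c s \<in> Q" "(c has_vector_derivative v) (at t)"
  shows "((\<lambda>s. f (c s)) has_vector_derivative frechet_derivative F (at (c t)) v) (at t)"
proof -
  have F: "((\<lambda>s. F (c s)) has_vector_derivative frechet_derivative F (at (c t)) v) (at t)"
    using smooth_on_open_has_derivative[OF assms(1,3)] assms(5) by (rule has_derivative_along_curve)
  have "\<forall>\<^sub>F s in nhds t. c s \<in> W"
    using curve_eventually[OF assms(5) smooth_on_openD(1)[OF assms(1)] assms(3)] .
  then have "\<forall>\<^sub>F s in nhds t. F (c s) = f (c s)"
    using assms(4) by eventually_elim (use assms(2) in auto)
  then obtain S where S: "open S" "t \<in> S" "\<And>s. s \<in> S \<Longrightarrow> F (c s) = f (c s)" unfolding eventually_nhds by blast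
  show ?thesis by (rule has_vector_derivative_transform_within_open[OF F S])
qed

lemma deriv_on_along_curve:
  assumes "smooth_map_on Q f" "c t \<in> Q" "\<forall>\<^sub>F s in nhds t. c s \<in> Q" "(c has_vector_derivative v) (at t)"
  shows "((\<lambda>s. f (c s)) has_vector_derivative deriv_on f (c t) v) (at t)"
proof -
  obtain W F where W: "c t \<in> W" "smooth_on_open W F" "\<And>y. y \<in> Q \<inter> W \<Longrightarrow> F y = f y"
    "deriv_on f (c t) = frechet_derivative F (at (c t))"
    using deriv_on_extension[OF assms(1,2)] by blast
  show ?thesis unfolding W(4) by (rule extension_along_curve[OF W(2) W(3) W(1) assms(3,4)])
qed

lemma deriv_on_eqI:
  assumes "smooth_map_on Q f" "q \<in> Q" "v \<in> TS q"
    "\<And>c. c 0 = q \<Longrightarrow> \<forall>\<^sub>F s in nhds 0. c s \<in> Q \<Longrightarrow> (c has_vector_derivative v) (at 0) \<Longrightarrow>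
       ((\<lambda>s. f (c s)) has_vector_derivative d) (at (0::real))"
  shows "deriv_on f q v = d"
proof -
  obtain c where "smooth_curve_through Q q v c" using assms(3) unfolding tangent_space_def by blast
  note c = smooth_curve_throughD[OF this]
  have "((\<lambda>s. f (c s)) has_vector_derivative deriv_on f q v) (at 0)"
    using deriv_on_along_curve[of f c 0 v] assms c by simp
  from vector_derivative_unique_at[OF this assms(4)[OF c]] show ?thesis .
qed

lemma linear_deriv_on:
  assumes "smooth_map_on Q f" "q \<in> Q"
  shows "linear (deriv_on f q)"
proof -
  obtain W F where W: "q \<in> W" "smooth_on_open W F" "\<And>y. y \<in> Q \<inter> W \<Longrightarrow> F y = f y"
    "deriv_on f q = frechet_derivative F (at q)"
    by (rule deriv_on_extension[OF assms]) (rule that)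
  show ?thesis unfolding W(4) by (rule has_derivative_linear[OF smooth_on_open_has_derivative[OF W(2,1)]])
qed

lemma deriv_on_extension_eq:
  assumes "smooth_map_on Q f" "q \<in> Q \<inter> W" "v \<in> TS q" "smooth_on_open W F" "\<And>y. y \<in> Q \<inter> W \<Longrightarrow> F y = f y"
  shows "deriv_on f q v = frechet_derivative F (at q) v"
proof (rule deriv_on_eqI)
  fix c :: "real \<Rightarrow> 'a" assume "c 0 = q" "\<forall>\<^sub>F s in nhds 0. c s \<in> Q" "(c has_vector_derivative v) (at 0)"
  then show "((\<lambda>s. f (c s)) has_vector_derivative frechet_derivative F (at q) v) (at 0)"
    using extension_along_curve[OF assms(4,5), of c 0 v] assms(2) by auto
qed (use assms in auto)

lemma deriv_on_inner:
  assumes "smooth_map_on Q f" "q \<in> Q" "v \<in> TS q"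
  shows "deriv_on (\<lambda>p. f p \<bullet> e) q v = deriv_on f q v \<bullet> e"
proof (rule deriv_on_eqI)
  show "smooth_map_on Q (\<lambda>p. f p \<bullet> e)" by (intro smooth_map_on_inner assms smooth_map_on_const)
  fix c :: "real \<Rightarrow> 'a" assume c: "c 0 = q" "\<forall>\<^sub>F s in nhds 0. c s \<in> Q" "(c has_vector_derivative v) (at 0)"
  then have "((\<lambda>s. f (c s)) has_vector_derivative deriv_on f q v) (at 0)"
    using deriv_on_along_curve[OF assms(1), of c 0 v] assms(2) by simp
  then show "((\<lambda>s. f (c s) \<bullet> e) has_vector_derivative deriv_on f q v \<bullet> e) (at 0)"
    by (rule bounded_linear.has_vector_derivative[OF bounded_linear_inner_left])
qed (use assms in auto)

lemma lie_derivative_eq: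
  assumes "smooth_map_on Q f" "q \<in> Q" "X q \<in> TS q"
  shows "lie_derivative Q X f q = deriv_on f q (X q)"
  unfolding lie_derivative_def
proof (rule the_equality)
  show "\<forall>c. smooth_curve_through Q q (X q) c \<longrightarrow> ((\<lambda>s. f (c s)) has_real_derivative deriv_on f q (X q)) (at 0)"
  proof (intro allI impI)
    fix c assume "smooth_curve_through Q q (X q) c"
    note c = smooth_curve_throughD[OF this]
    show "((\<lambda>s. f (c s)) has_real_derivative deriv_on f q (X q)) (at 0)"
      using deriv_on_along_curve[of f c 0 "X q"] c assms
      unfolding has_real_derivative_iff_has_vector_derivative by simp
  qed
  fix d assume d: "\<forall>c. smooth_curve_through Q q (X q) c \<longrightarrow> ((\<lambda>s. f (c s)) has_real_derivative d) (at 0)"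
  obtain c where c: "smooth_curve_through Q q (X q) c" using assms(3) unfolding tangent_space_def by blast
  have "((\<lambda>s. f (c s)) has_vector_derivative deriv_on f q (X q)) (at 0)"
    using deriv_on_along_curve[OF assms(1), of c 0 "X q"] smooth_curve_throughD[OF c] assms(2) by simp
  moreover have "((\<lambda>s. f (c s)) has_vector_derivative d) (at 0)"
    using d[rule_format, OF c] unfolding has_real_derivative_iff_has_vector_derivative .
  ultimately show "d = deriv_on f q (X q)" by (rule vector_derivative_unique_at[symmetric])
qed

text \<open>The extension chosen by \<open>deriv_on\<close> may jump from point to point. Since
  \<open>X a\<close> is tangent, the value can be computed near \<open>a0\<close> from one fixed
  extension, whose derivatives are smooth.\<close>

lemma locally_lipschitz_deriv_on:
  fixes g :: "'c::metric_space \<Rightarrow> 'a"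
  assumes f: "smooth_map_on Q f" and g: "locally_lipschitz_on A g" "\<And>a. a \<in> A \<Longrightarrow> g a \<in> Q"
    and X: "locally_lipschitz_on A X" "\<And>a. a \<in> A \<Longrightarrow> X a \<in> TS (g a)"
  shows "locally_lipschitz_on A (\<lambda>a. deriv_on f (g a) (X a))"
proof (rule locally_lipschitz_on_locally)
  fix a0 assume a0: "a0 \<in> A"
  obtain W F where W: "g a0 \<in> W" "smooth_on_open W F" "\<And>y. y \<in> Q \<inter> W \<Longrightarrow> F y = f y"
    by (rule deriv_on_extension[OF f g(2)[OF a0]]) (rule that)
  have "openin (top_of_set A) (A \<inter> g -` W)"
    using locally_lipschitz_on_continuous[OF g(1)] smooth_on_openD(1)[OF W(2)]
    by (simp add: continuous_openin_preimage_gen)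
  then obtain V where V: "open V" "A \<inter> g -` W = A \<inter> V" unfolding openin_open by auto
  have eq: "deriv_on f (g a) (X a) = (\<Sum>b\<in>Basis. (X a \<bullet> b) *\<^sub>R frechet_derivative F (at (g a)) b)"
    if "a \<in> A \<inter> V" for a
  proof -
    have a: "g a \<in> Q \<inter> W" "X a \<in> TS (g a)" using that V g X by auto
    then have lin: "linear (frechet_derivative F (at (g a)))"
      using has_derivative_linear[OF smooth_on_open_has_derivative[OF W(2)]] by auto
    have "deriv_on f (g a) (X a) = frechet_derivative F (at (g a)) (X a)"
      by (rule deriv_on_extension_eq[OF f a W(2) W(3)])
    also have "\<dots> = (\<Sum>b\<in>Basis. (X a \<bullet> b) *\<^sub>R frechet_derivative F (at (g a)) b)"
      using lin by (rule linear_representation)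
    finally show ?thesis .
  qed
  have D: "locally_lipschitz_on W (\<lambda>y. frechet_derivative F (at y) b)" for b
    by (rule smooth_imp_locally_lipschitz[OF smooth_on_open_imp_map_on[OF smooth_on_open_frechet[OF W(2)]]]) auto
  have gV: "locally_lipschitz_on (A \<inter> V) g" "locally_lipschitz_on (A \<inter> V) X"
    using g X locally_lipschitz_on_subset by blast+
  have gW: "g ` (A \<inter> V) \<subseteq> W" using V by auto
  have "locally_lipschitz_on (A \<inter> V) (\<lambda>a. \<Sum>b\<in>Basis. (X a \<bullet> b) *\<^sub>R frechet_derivative F (at (g a)) b)"
    by (intro locally_lipschitz_on_sum locally_lipschitz_on_scaleR locally_lipschitz_on_inner gV
      locally_lipschitz_on_const locally_lipschitz_on_compose[OF gV(1) D gW] finite_Basis)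
  then have "locally_lipschitz_on (A \<inter> V) (\<lambda>a. deriv_on f (g a) (X a))"
    by (rule locally_lipschitz_on_cong[rotated]) (simp add: eq)
  then show "\<exists>W. open W \<and> a0 \<in> W \<and> locally_lipschitz_on (A \<inter> W) (\<lambda>a. deriv_on f (g a) (X a))"
    using V W a0 by blast
qed

end

section \<open>Affine connections in ambient coordinates\<close>

locale connection = submanifold Q k for Q :: "'a::euclidean_space set" and k +
  fixes nabla :: "('a \<Rightarrow> 'a) \<Rightarrow> ('a \<Rightarrow> 'a) \<Rightarrow> 'a \<Rightarrow> 'a"
  assumes conn: "affine_connection Q nabla"
begin

abbreviation "VF \<equiv> smooth_vector_fields Q"

lemma VF_smooth: "X \<in> VF \<Longrightarrow> smooth_map_on Q X" and VF_tangent: "X \<in> VF \<Longrightarrow> q \<in> Q \<Longrightarrow> X q \<in> TS q"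
  by (auto simp: smooth_vector_fields_def)

lemma VF_scale: "smooth_map_on Q f \<Longrightarrow> X \<in> VF \<Longrightarrow> (\<lambda>q. f q *\<^sub>R X q) \<in> VF"
  using subspace_tangent by (auto simp: smooth_vector_fields_def subspace_scale intro: smooth_map_on_scaleR)

lemma VF_sum: "finite I \<Longrightarrow> (\<And>i. i \<in> I \<Longrightarrow> X i \<in> VF) \<Longrightarrow> (\<lambda>q. \<Sum>i\<in>I. X i q) \<in> VF"
  using subspace_tangent by (auto simp: smooth_vector_fields_def intro: smooth_map_on_sum subspace_sum)

lemma VF_proj: "(\<lambda>q. P q e) \<in> VF"
  by (simp add: smooth_vector_fields_def smooth_tangent_proj tangent_proj_in)

lemma nabla_cong:
  "X \<in> VF \<Longrightarrow> X' \<in> VF \<Longrightarrow> E \<in> VF \<Longrightarrow> E' \<in> VF \<Longrightarrow> (\<And>q. q \<in> Q \<Longrightarrow> X q = X' q) \<Longrightarrow> (\<And>q. q \<in> Q \<Longrightarrow> E q = E' q) \<Longrightarrow>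
   q \<in> Q \<Longrightarrow> nabla X E q = nabla X' E' q"
  using conn[unfolded affine_connection_def, THEN conjunct1] by blast

lemma nabla_VF: "X \<in> VF \<Longrightarrow> E \<in> VF \<Longrightarrow> nabla X E \<in> VF"
  using conn[unfolded affine_connection_def, THEN conjunct2, THEN conjunct1] by blast

lemma nabla_add_left: "X \<in> VF \<Longrightarrow> X' \<in> VF \<Longrightarrow> E \<in> VF \<Longrightarrow> q \<in> Q \<Longrightarrow>
    nabla (\<lambda>p. X p + X' p) E q = nabla X E q + nabla X' E q"
  using conn[unfolded affine_connection_def, THEN conjunct2, THEN conjunct2, THEN conjunct1] by blast

lemma nabla_scale_left: "X \<in> VF \<Longrightarrow> E \<in> VF \<Longrightarrow> smooth_map_on Q f \<Longrightarrow> q \<in> Q \<Longrightarrow>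
    nabla (\<lambda>p. f p *\<^sub>R X p) E q = f q *\<^sub>R nabla X E q"
  using conn[unfolded affine_connection_def, THEN conjunct2, THEN conjunct2, THEN conjunct2, THEN conjunct1] by blast

lemma nabla_add_right: "X \<in> VF \<Longrightarrow> E \<in> VF \<Longrightarrow> E' \<in> VF \<Longrightarrow> q \<in> Q \<Longrightarrow>
    nabla X (\<lambda>p. E p + E' p) q = nabla X E q + nabla X E' q"
  using conn[unfolded affine_connection_def, THEN conjunct2, THEN conjunct2, THEN conjunct2, THEN conjunct2, THEN conjunct1]
  by blast

lemma nabla_product: "X \<in> VF \<Longrightarrow> E \<in> VF \<Longrightarrow> smooth_map_on Q f \<Longrightarrow> q \<in> Q \<Longrightarrow>
    nabla X (\<lambda>p. f p *\<^sub>R E p) q = f q *\<^sub>R nabla X E q + deriv_on f q (X q) *\<^sub>R E q"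
  using conn[unfolded affine_connection_def, THEN conjunct2, THEN conjunct2, THEN conjunct2, THEN conjunct2, THEN conjunct2]
    lie_derivative_eq[of f q X] VF_tangent by auto

lemma VF_zero: "(\<lambda>q. 0) \<in> VF"
  using VF_sum[of "{}"] by simp

lemma deriv_on_zero: "q \<in> Q \<Longrightarrow> v \<in> TS q \<Longrightarrow> deriv_on (\<lambda>q. 0::'c::euclidean_space) q v = 0"
  by (rule deriv_on_eqI) (auto intro: smooth_map_on_const)

lemma nabla_sum_left: "finite I \<Longrightarrow> (\<And>i. i \<in> I \<Longrightarrow> X i \<in> VF) \<Longrightarrow> E \<in> VF \<Longrightarrow> q \<in> Q \<Longrightarrow>
    nabla (\<lambda>p. \<Sum>i\<in>I. X i p) E q = (\<Sum>i\<in>I. nabla (X i) E q)"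
proof (induction I rule: finite_induct)
  \<comment> \<open>The empty sum is the zero field, which is 0 times itself, so the scaling rule
    gives 0.\<close>
  case empty
  then show ?case
    using nabla_scale_left[OF VF_zero, of E "\<lambda>p. 0" q] smooth_map_on_const[of Q "0::real"] by simp
next
  case (insert i I)
  then show ?case using nabla_add_left[of "X i" "\<lambda>p. \<Sum>i\<in>I. X i p" E q] by (simp add: VF_sum)
qed

lemma nabla_sum_right: "finite I \<Longrightarrow> X \<in> VF \<Longrightarrow> (\<And>i. i \<in> I \<Longrightarrow> E i \<in> VF) \<Longrightarrow> q \<in> Q \<Longrightarrow>
    nabla X (\<lambda>p. \<Sum>i\<in>I. E i p) q = (\<Sum>i\<in>I. nabla X (E i) q)"
proof (induction I rule: finite_induct)
  case empty
  then show ?case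
    using nabla_product[OF _ VF_zero, of X "\<lambda>p. 0" q] smooth_map_on_const[of Q "0::real"]
      deriv_on_zero[of q "X q", where ?'c = real] VF_tangent[of X q] by simp
next
  case (insert i I)
  then show ?case using nabla_add_right[of X "E i" "\<lambda>p. \<Sum>i\<in>I. E i p" q] by (simp add: VF_sum)
qed

text \<open>The projections of the standard basis span every tangent space, so \<open>nabla\<close> is determined by
  its values on them: these are the Christoffel symbols.\<close>

definition christoffel :: "'a \<Rightarrow> 'a \<Rightarrow> 'a \<Rightarrow> 'a" where
  "christoffel q v w = (\<Sum>j\<in>Basis. \<Sum>l\<in>Basis. ((w \<bullet> j) * (v \<bullet> l)) *\<^sub>R nabla (\<lambda>p. P p l) (\<lambda>p. P p j) q)"

lemma christoffel_in: "q \<in> Q \<Longrightarrow> christoffel q v w \<in> TS q"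
  unfolding christoffel_def
  by (intro subspace_sum subspace_scale subspace_tangent VF_tangent nabla_VF VF_proj)

lemma linear_christoffel: "linear (christoffel q v)"
  unfolding christoffel_def
  by (rule linearI) (simp_all add: inner_add_left algebra_simps sum.distrib scaleR_sum_right)

lemma linear_christoffel_left: "linear (\<lambda>v. christoffel q v w)"
  unfolding christoffel_def
  by (rule linearI) (simp_all add: inner_add_left algebra_simps sum.distrib scaleR_sum_right)

text \<open>On \<open>Q\<close> the field \<open>X\<close> is the combination of the projected basis
  fields with coefficients \<open>X p \<bullet> l\<close>. Function-linearity of
  \<open>nabla\<close> in its first argument leaves only the values of these coefficients at
  \<open>q\<close>.\<close>

lemma nabla_frame:
  assumes "X \<in> VF" "q \<in> Q"
  shows "(\<Sum>j\<in>Basis. (w \<bullet> j) *\<^sub>R nabla X (\<lambda>p. P p j) q) = christoffel q (X q) w"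
proof -
  have "nabla X (\<lambda>p. P p j) q = (\<Sum>l\<in>Basis. (X q \<bullet> l) *\<^sub>R nabla (\<lambda>p. P p l) (\<lambda>p. P p j) q)" for j
  proof -
    have sm: "smooth_map_on Q (\<lambda>p. X p \<bullet> l)" for l
      by (intro smooth_map_on_inner VF_smooth assms smooth_map_on_const)
    have V: "(\<lambda>p. (X p \<bullet> l) *\<^sub>R P p l) \<in> VF" for l by (intro VF_scale sm VF_proj)
    have "nabla X (\<lambda>p. P p j) q = nabla (\<lambda>p. \<Sum>l\<in>Basis. (X p \<bullet> l) *\<^sub>R P p l) (\<lambda>p. P p j) q"
    proof (rule nabla_cong)
      show "X p = (\<Sum>l\<in>Basis. (X p \<bullet> l) *\<^sub>R P p l)" if "p \<in> Q" for p
        using tangent_proj_expand[OF that, of "X p"] tangent_proj_id[OF that VF_tangent[OF assms(1) that]] by simp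
    qed (use assms V in \<open>auto intro: VF_sum VF_proj\<close>)
    also have "\<dots> = (\<Sum>l\<in>Basis. nabla (\<lambda>p. (X p \<bullet> l) *\<^sub>R P p l) (\<lambda>p. P p j) q)"
      by (rule nabla_sum_left) (use V VF_proj assms in auto)
    also have "\<dots> = (\<Sum>l\<in>Basis. (X q \<bullet> l) *\<^sub>R nabla (\<lambda>p. P p l) (\<lambda>p. P p j) q)"
      by (intro sum.cong refl nabla_scale_left VF_proj sm assms)
    finally show ?thesis .
  qed
  then show ?thesis by (simp add: christoffel_def scaleR_sum_right)
qed

text \<open>Expand \<open>E\<close> in the projected basis fields and apply the product rule: the
  undifferentiated coefficients produce the Christoffel term, the differentiated ones the tangential
  part of the ambient derivative of \<open>E\<close>.\<close>

lemma nabla_eq: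
  assumes X: "X \<in> VF" and E: "E \<in> VF" and q: "q \<in> Q"
  shows "nabla X E q = christoffel q (X q) (E q) + P q (deriv_on E q (X q))"
proof -
  have sm: "smooth_map_on Q (\<lambda>p. E p \<bullet> j)" for j
    by (intro smooth_map_on_inner VF_smooth E smooth_map_on_const)
  have V: "(\<lambda>p. (E p \<bullet> j) *\<^sub>R P p j) \<in> VF" for j by (intro VF_scale sm VF_proj)
  have "nabla X E q = nabla X (\<lambda>p. \<Sum>j\<in>Basis. (E p \<bullet> j) *\<^sub>R P p j) q"
  proof (rule nabla_cong)
    show "E p = (\<Sum>l\<in>Basis. (E p \<bullet> l) *\<^sub>R P p l)" if "p \<in> Q" for p
      using tangent_proj_expand[OF that, of "E p"] tangent_proj_id[OF that VF_tangent[OF E that]] by simp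
  qed (use assms V in \<open>auto intro: VF_sum VF_proj\<close>)
  also have "\<dots> = (\<Sum>j\<in>Basis. nabla X (\<lambda>p. (E p \<bullet> j) *\<^sub>R P p j) q)"
    by (rule nabla_sum_right) (use V assms in auto)
  also have "\<dots> = (\<Sum>j\<in>Basis. (E q \<bullet> j) *\<^sub>R nabla X (\<lambda>p. P p j) q + deriv_on (\<lambda>p. E p \<bullet> j) q (X q) *\<^sub>R P q j)"
    by (intro sum.cong refl nabla_product VF_proj sm assms)
  also have "\<dots> = christoffel q (X q) (E q) + (\<Sum>j\<in>Basis. (deriv_on E q (X q) \<bullet> j) *\<^sub>R P q j)"
    using deriv_on_inner[OF VF_smooth[OF E] q VF_tangent[OF X q]] nabla_frame[OF X q]
    by (simp add: sum.distrib)
  also have "(\<Sum>j\<in>Basis. (deriv_on E q (X q) \<bullet> j) *\<^sub>R P q j) = P q (deriv_on E q (X q))"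
    by (rule tangent_proj_expand[OF q, symmetric])
  finally show ?thesis .
qed

text \<open>The derivative of the projection along \<open>v\<close>, applied to \<open>w\<close>.
  For tangent \<open>v\<close> and \<open>w\<close> it is the second fundamental form of
  \<open>Q\<close>.\<close>

definition proj_deriv :: "'a \<Rightarrow> 'a \<Rightarrow> 'a \<Rightarrow> 'a" where
  "proj_deriv q v w = (\<Sum>j\<in>Basis. (w \<bullet> j) *\<^sub>R deriv_on (\<lambda>p. P p j) q v)"

lemma proj_deriv_along_curve:
  assumes c: "c t \<in> Q" "\<forall>\<^sub>F s in nhds t. c s \<in> Q" "(c has_vector_derivative v) (at t)"
    and V: "(V has_vector_derivative V') (at t)"
  shows "((\<lambda>s. P (c s) (V s)) has_vector_derivative P (c t) V' + proj_deriv (c t) v (V t)) (at t)"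
proof -
  have "((\<lambda>s. \<Sum>j\<in>Basis. (V s \<bullet> j) *\<^sub>R P (c s) j) has_vector_derivative
      (\<Sum>j\<in>Basis. (V t \<bullet> j) *\<^sub>R deriv_on (\<lambda>p. P p j) (c t) v + (V' \<bullet> j) *\<^sub>R P (c t) j)) (at t)"
  proof (rule has_vector_derivative_sum)
    fix j :: 'a
    have "((\<lambda>s. V s \<bullet> j) has_real_derivative V' \<bullet> j) (at t)"
      unfolding has_real_derivative_iff_has_vector_derivative
      by (rule bounded_linear.has_vector_derivative[OF bounded_linear_inner_left V])
    then show "((\<lambda>s. (V s \<bullet> j) *\<^sub>R P (c s) j) has_vector_derivative
        (V t \<bullet> j) *\<^sub>R deriv_on (\<lambda>p. P p j) (c t) v + (V' \<bullet> j) *\<^sub>R P (c t) j) (at t)"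
      by (rule has_vector_derivative_scaleR[OF _ deriv_on_along_curve[OF smooth_tangent_proj c]])
  qed
  also have "(\<Sum>j\<in>Basis. (V t \<bullet> j) *\<^sub>R deriv_on (\<lambda>p. P p j) (c t) v + (V' \<bullet> j) *\<^sub>R P (c t) j)
      = P (c t) V' + proj_deriv (c t) v (V t)"
    unfolding tangent_proj_expand[OF c(1), of V'] proj_deriv_def by (simp add: sum.distrib add.commute)
  finally have *: "((\<lambda>s. \<Sum>j\<in>Basis. (V s \<bullet> j) *\<^sub>R P (c s) j) has_vector_derivative
      P (c t) V' + proj_deriv (c t) v (V t)) (at t)" .
  from c(2) obtain S where S: "open S" "t \<in> S" "\<And>s. s \<in> S \<Longrightarrow> c s \<in> Q" unfolding eventually_nhds by blast
  show ?thesis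
    by (rule has_vector_derivative_transform_within_open[OF * S(1,2)]) (use S(3) in \<open>auto intro!: tangent_proj_expand[symmetric]\<close>)
qed

text \<open>Differentiate the identity V = P V along the curve. The normal part of \<open>V'\<close>
  is thus fixed by position, velocity and \<open>V\<close>, so a covariant derivative determines the
  full ambient derivative.\<close>

lemma tangent_field_derivative:
  assumes c: "c t \<in> Q" "\<forall>\<^sub>F s in nhds t. c s \<in> Q \<and> V s \<in> TS (c s)" "(c has_vector_derivative v) (at t)"
    and V: "(V has_vector_derivative V') (at t)"
  shows "V' = P (c t) V' + proj_deriv (c t) v (V t)"
proof (rule has_vector_derivative_unique_eventually[OF V])
  show "((\<lambda>s. P (c s) (V s)) has_vector_derivative P (c t) V' + proj_deriv (c t) v (V t)) (at t)"
    using c by (intro proj_deriv_along_curve V) (auto elim: eventually_mono)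
  show "\<forall>\<^sub>F s in nhds t. V s = P (c s) (V s)"
    using c(2) by eventually_elim (use tangent_proj_id in auto)
qed

text \<open>\<open>nabla_eq\<close> identifies \<open>D\<close> with the tangential part of
  \<open>V'\<close> plus the Christoffel term, for whatever fields represent \<open>V\<close>;
  \<open>tangent_field_derivative\<close> adds the normal part.\<close>

lemma has_covariant_derivativeD:
  assumes c: "c t \<in> Q" "\<forall>\<^sub>F s in nhds t. c s \<in> Q \<and> V s \<in> TS (c s)" "(c has_vector_derivative v) (at t)"
    and D: "has_covariant_derivative Q nabla c V D t"
  shows "(V has_vector_derivative D - christoffel (c t) v (V t) + proj_deriv (c t) v (V t)) (at t)"
proof -
  obtain m :: nat and E a a' X where X: "X \<in> VF" "(c has_vector_derivative X (c t)) (at t)"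
    and E: "\<forall>i<m. E i \<in> VF \<and> (a i has_real_derivative a' i) (at t)"
    and Vs: "\<forall>\<^sub>F s in nhds t. V s = (\<Sum>i<m. a i s *\<^sub>R E i (c s))"
    and D: "D = (\<Sum>i<m. a' i *\<^sub>R E i (c t) + a i t *\<^sub>R nabla X (E i) (c t))"
    using D unfolding has_covariant_derivative_def by blast
  have v: "X (c t) = v" using vector_derivative_unique_at[OF X(2) c(3)] .
  have cQ: "\<forall>\<^sub>F s in nhds t. c s \<in> Q" using c(2) by (auto elim: eventually_mono)
  define V' where "V' = (\<Sum>i<m. a i t *\<^sub>R deriv_on (E i) (c t) v + a' i *\<^sub>R E i (c t))"
  have "((\<lambda>s. \<Sum>i<m. a i s *\<^sub>R E i (c s)) has_vector_derivative V') (at t)"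
    unfolding V'_def
  proof (rule has_vector_derivative_sum)
    fix i assume "i \<in> {..<m}"
    then have i: "E i \<in> VF" "(a i has_real_derivative a' i) (at t)" using E by auto
    show "((\<lambda>s. a i s *\<^sub>R E i (c s)) has_vector_derivative a i t *\<^sub>R deriv_on (E i) (c t) v + a' i *\<^sub>R E i (c t)) (at t)"
      by (rule has_vector_derivative_scaleR[OF i(2) deriv_on_along_curve[OF VF_smooth[OF i(1)] c(1) cQ c(3)]])
  qed
  moreover from Vs obtain S where S: "open S" "t \<in> S" "\<And>s. s \<in> S \<Longrightarrow> V s = (\<Sum>i<m. a i s *\<^sub>R E i (c s))"
    unfolding eventually_nhds by blast
  ultimately have V': "(V has_vector_derivative V') (at t)"
    using has_vector_derivative_transform_within_open[of "\<lambda>s. \<Sum>i<m. a i s *\<^sub>R E i (c s)" V' t S V] by simp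
  have Vt: "V t = (\<Sum>i<m. a i t *\<^sub>R E i (c t))" using S by auto
  have lin: "linear (P (c t))" by (rule linear_tangent_proj[OF c(1)])
  have "D = (\<Sum>i<m. a' i *\<^sub>R E i (c t) + a i t *\<^sub>R (christoffel (c t) v (E i (c t)) + P (c t) (deriv_on (E i) (c t) v)))"
    unfolding D using E nabla_eq[OF X(1) _ c(1)] v by (intro sum.cong) auto
  also have "\<dots> = christoffel (c t) v (V t) + (\<Sum>i<m. a i t *\<^sub>R P (c t) (deriv_on (E i) (c t) v) + a' i *\<^sub>R E i (c t))"
    unfolding Vt linear_sum[OF linear_christoffel] linear_scale[OF linear_christoffel]
    by (simp add: scaleR_add_right sum.distrib algebra_simps)
  also have "(\<Sum>i<m. a i t *\<^sub>R P (c t) (deriv_on (E i) (c t) v) + a' i *\<^sub>R E i (c t)) = P (c t) V'"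
    unfolding V'_def linear_sum[OF lin] linear_add[OF lin] linear_scale[OF lin]
    using E tangent_proj_id[OF c(1)] VF_tangent[OF _ c(1)] by (intro sum.cong) auto
  finally have "D = christoffel (c t) v (V t) + P (c t) V'" .
  moreover have "V' = P (c t) V' + proj_deriv (c t) v (V t)"
    by (rule tangent_field_derivative[OF c V'])
  ultimately have "V' = D - christoffel (c t) v (V t) + proj_deriv (c t) v (V t)"
    by (metis add_diff_cancel_left')
  then show ?thesis using V' by simp
qed

text \<open>The representing fields are the projected basis fields, with coefficients
  \<open>V s \<bullet> e i\<close>. These are differentiable at \<open>t\<close> as soon as
  \<open>V\<close> is.\<close>

lemma has_covariant_derivativeI:
  assumes c: "c t \<in> Q" "\<forall>\<^sub>F s in nhds t. c s \<in> Q \<and> V s \<in> TS (c s)" "(c has_vector_derivative v) (at t)"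
    and V: "(V has_vector_derivative V') (at t)"
  shows "has_covariant_derivative Q nabla c V (P (c t) V' + christoffel (c t) v (V t)) t"
proof -
  have cQ: "\<forall>\<^sub>F s in nhds t. c s \<in> Q" using c(2) by (auto elim: eventually_mono)
  have vT: "v \<in> TS (c t)" by (rule velocity_tangent[OF c(1) cQ c(3)])
  define m where "m = card (Basis :: 'a set)"
  obtain e where e: "bij_betw e {..<m} (Basis :: 'a set)"
    using ex_bij_betw_nat_finite[OF finite_Basis[where 'a='a]] by (auto simp: m_def atLeast0LessThan)
  \<comment> \<open>Constant coefficients suffice: at \<open>c t\<close> the sum is the projection
    of the tangent vector \<open>v\<close>, hence \<open>v\<close> itself.\<close>
  define X where "X p = (\<Sum>l\<in>Basis. (v \<bullet> l) *\<^sub>R P p l)" for p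
  have X: "X \<in> VF" unfolding X_def[abs_def]
    by (intro VF_sum VF_scale smooth_map_on_const VF_proj finite_Basis)
  have Xv: "X (c t) = v"
    unfolding X_def using tangent_proj_expand[OF c(1), of v] tangent_proj_id[OF c(1) vT] by simp
  have reindex: "(\<Sum>i<m. f (e i)) = (\<Sum>j\<in>Basis. f j)" for f :: "'a \<Rightarrow> 'a"
    using sum.reindex_bij_betw[OF e] .
  show ?thesis
    unfolding has_covariant_derivative_def
  proof (intro exI conjI allI impI)
    show "X \<in> VF" by (rule X)
    show "(c has_vector_derivative X (c t)) (at t)" using c(3) Xv by simp
    show "(\<lambda>p. P p (e i)) \<in> VF" for i by (rule VF_proj)
    show "((\<lambda>s. V s \<bullet> e i) has_real_derivative V' \<bullet> e i) (at t)" for i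
      unfolding has_real_derivative_iff_has_vector_derivative
      by (rule bounded_linear.has_vector_derivative[OF bounded_linear_inner_left V])
    show "\<forall>\<^sub>F s in nhds t. V s = (\<Sum>i<m. (V s \<bullet> e i) *\<^sub>R P (c s) (e i))"
      using c(2)
    proof eventually_elim
      case (elim s)
      then show ?case
        using tangent_proj_id[of "c s" "V s"] tangent_proj_expand[of "c s" "V s"] reindex[of "\<lambda>j. (V s \<bullet> j) *\<^sub>R P (c s) j"]
        by simp
    qed
    show "P (c t) V' + christoffel (c t) v (V t) =
        (\<Sum>i<m. (V' \<bullet> e i) *\<^sub>R P (c t) (e i) + (V t \<bullet> e i) *\<^sub>R nabla X (\<lambda>p. P p (e i)) (c t))"
      unfolding reindex[of "\<lambda>j. (V' \<bullet> j) *\<^sub>R P (c t) j + (V t \<bullet> j) *\<^sub>R nabla X (\<lambda>p. P p j) (c t)"]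
      using nabla_frame[OF X c(1), of "V t"] tangent_proj_expand[OF c(1), of V'] Xv
      by (simp add: sum.distrib)
  qed
qed

end

section \<open>Absolutely continuous functions and indefinite integrals\<close>

lemma measure_disjoint_intervals_le:
  fixes c d :: "'i \<Rightarrow> real"
  assumes J: "finite J" and cd: "\<And>i. i \<in> J \<Longrightarrow> c i \<le> d i"
    and disj: "\<And>i j. i \<in> J \<Longrightarrow> j \<in> J \<Longrightarrow> i \<noteq> j \<Longrightarrow> {c i<..<d i} \<inter> {c j<..<d j} = {}"
    and T: "\<And>i. i \<in> J \<Longrightarrow> {c i<..<d i} \<subseteq> T" "T \<in> lmeasurable"
  shows "(\<Sum>i\<in>J. d i - c i) \<le> measure lebesgue T"
proof -
  have "(\<Sum>i\<in>J. d i - c i) = (\<Sum>i\<in>J. measure lebesgue {c i<..<d i})"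
    using cd by (intro sum.cong) auto
  also have "\<dots> = measure lebesgue (\<Union>i\<in>J. {c i<..<d i})"
    by (rule measure_finite_Union[symmetric]) (use J disj cd in \<open>auto simp: disjoint_family_on_def\<close>)
  also have "\<dots> \<le> measure lebesgue T"
    by (rule measure_mono_fmeasurable) (use T J in auto)
  finally show ?thesis .
qed

text \<open>The gauge treats two kinds of tags. Off \<open>N\<close>, differentiability controls the
  increment over a small interval. For tags in \<open>N\<close> the intervals lie in an open set
  \<open>T\<close> of measure below \<delta>, so absolute continuity makes the sum of their
  increments small, and \<open>g\<close> contributes nothing there.\<close>

lemma abs_cont_has_integral:
  fixes y :: "real \<Rightarrow> 'b::real_normed_vector"
  assumes ab: "a \<le> b" and ac: "abs_cont_on_interval a b y" and N: "negligible N"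
    and der: "\<And>t. t \<in> {a..b} - N \<Longrightarrow> (y has_vector_derivative g t) (at t)"
    and gN: "\<And>t. t \<in> N \<Longrightarrow> g t = 0"
  shows "(g has_integral (y b - y a)) {a..b}"
  unfolding has_integral_real
proof (intro allI impI)
  fix e :: real assume e: "e > 0"
  have "e / 3 > 0" using e by simp
  then obtain \<delta> where \<delta>: "\<delta> > 0" and ac': "\<forall>(m::nat) c d.
        (\<forall>i<m. a \<le> c i \<and> c i \<le> d i \<and> d i \<le> b) \<and>
        (\<forall>i<m. \<forall>j<m. i \<noteq> j \<longrightarrow> {c i<..<d i} \<inter> {c j<..<d j} = {}) \<and>
        (\<Sum>i<m. d i - c i) < \<delta> \<longrightarrow> (\<Sum>i<m. dist (y (c i)) (y (d i))) < e / 3"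
    using ac[unfolded abs_cont_on_interval_def, rule_format, of "e / 3"] by blast
  note ac' = ac'[rule_format]
  have Ns: "N \<in> sets lebesgue" "N \<in> null_sets lebesgue" using N negligible_iff_null_sets negligible_imp_sets by auto
  obtain T where T: "open T" "N \<subseteq> T" "T - N \<in> lmeasurable" "emeasure lebesgue (T - N) < ennreal \<delta>"
    using sets_lebesgue_outer_open[OF Ns(1) \<delta>] by metis
  have Tm: "T \<in> lmeasurable" "measure lebesgue T < \<delta>"
  proof -
    have "emeasure lebesgue (T - N) = emeasure lebesgue T"
      using Ns T(1) by (intro emeasure_Diff_null_set) auto
    then have em: "emeasure lebesgue T < ennreal \<delta>" using T by simp
    then show "T \<in> lmeasurable" using T(1) by (intro fmeasurableI) (auto simp: less_top[symmetric] intro: order_less_trans ennreal_less_top)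
    then show "measure lebesgue T < \<delta>" using em \<delta> by (simp add: emeasure_eq_measure2 ennreal_less_iff)
  qed
  \<comment> \<open>The tags off \<open>N\<close> then cost at most q (b - a), hence at most e / 3,
    and those in \<open>N\<close> less than e / 3. The summand 1 covers the case a = b.\<close>
  define q where "q = e / (3 * (b - a + 1))"
  have q: "q > 0" using e ab by (simp add: q_def)
  have "\<exists>r>0. \<forall>s. \<bar>s\<bar> < r \<longrightarrow> norm (y (t + s) - y t - s *\<^sub>R g t) \<le> q * \<bar>s\<bar>" if "t \<in> {a..b} - N" for t
    using der[OF that] q unfolding has_vector_derivative_alt by blast
  then obtain r where r: "\<And>t. t \<in> {a..b} - N \<Longrightarrow> r t > 0"
    "\<And>t s. t \<in> {a..b} - N \<Longrightarrow> \<bar>s\<bar> < r t \<Longrightarrow> norm (y (t + s) - y t - s *\<^sub>R g t) \<le> q * \<bar>s\<bar>" by metis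
  define \<gamma> where "\<gamma> t = (if t \<in> N then T else if t \<in> {a..b} then ball t (r t) else UNIV)" for t
  have "gauge \<gamma>" unfolding gauge_def \<gamma>_def using T r by auto
  moreover have "norm ((\<Sum>(x, k)\<in>p. measure lborel k *\<^sub>R g x) - (y b - y a)) < e"
    if p: "p tagged_division_of {a..b}" "\<gamma> fine p" for p
  proof -
    note pd = tagged_division_ofD[OF p(1)]
    define S where "S = (\<lambda>(x::real, k::real set). measure lborel k *\<^sub>R g x - (y (Sup k) - y (Inf k)))"
    have eq: "(\<Sum>(x, k)\<in>p. measure lborel k *\<^sub>R g x) - (y b - y a) = sum S p"
      unfolding additive_tagged_division_1[OF ab p(1), of y, symmetric] S_def
      by (simp add: sum_subtractf case_prod_unfold)
    define pN where "pN = {z \<in> p. fst z \<in> N}"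
    have fin: "finite p" "finite pN" using pd(1) by (auto simp: pN_def)
    have iv: "snd z = {Inf (snd z)..Sup (snd z)} \<and> Inf (snd z) \<le> fst z \<and> fst z \<le> Sup (snd z) \<and>
        a \<le> Inf (snd z) \<and> Sup (snd z) \<le> b" if "z \<in> p" for z
    proof -
      obtain x k where z: "z = (x, k)" by force
      then have xk: "(x, k) \<in> p" using that by simp
      obtain u v where k: "k = {u..v}" using pd(4)[OF xk] by auto
      have "u \<le> x" "x \<le> v" using pd(2)[OF xk] k by auto
      moreover have "a \<le> u" "v \<le> b" using pd(3)[OF xk] k calculation by auto
      ultimately show ?thesis using z k by simp
    qed
    have good: "norm (S z) \<le> q * measure lborel (snd z)" if z: "z \<in> p - pN" for z
    proof -
      obtain x k where xk: "z = (x, k)" by force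
      define u where "u = Inf k"
      define v where "v = Sup k"
      have k: "k = {u..v}" "u \<le> x" "x \<le> v" "a \<le> u" "v \<le> b"
        using iv[of z] z xk by (auto simp: u_def v_def)
      have x: "x \<in> {a..b} - N" using z xk k by (auto simp: pN_def)
      have "k \<subseteq> \<gamma> x" using p(2) z xk by (auto simp: fine_def)
      moreover have "u \<in> k" "v \<in> k" using k by auto
      moreover have "\<gamma> x = ball x (r x)" using x by (simp add: \<gamma>_def)
      ultimately have "u \<in> ball x (r x)" "v \<in> ball x (r x)" by blast+
      then have ur: "\<bar>u - x\<bar> < r x" "\<bar>v - x\<bar> < r x" by (auto simp: dist_real_def)
      have "S z = (y u - y x - (u - x) *\<^sub>R g x) - (y v - y x - (v - x) *\<^sub>R g x)"
        using k by (simp add: S_def xk u_def[symmetric] v_def[symmetric] algebra_simps)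
      also have "norm \<dots> \<le> q * \<bar>u - x\<bar> + q * \<bar>v - x\<bar>"
        using r(2)[OF x ur(1)] r(2)[OF x ur(2)]
        by (intro order_trans[OF norm_triangle_ineq4 add_mono]) (simp_all only: add_diff_cancel_left' le_add_diff_inverse add.commute[of x] diff_add_cancel)
      also have "\<dots> = q * measure lborel (snd z)" using k xk by (simp add: algebra_simps)
      finally show ?thesis .
    qed
    have bad: "(\<Sum>z\<in>pN. norm (S z)) < e / 3"
    proof -
      obtain h where h: "bij_betw h {..<card pN} pN"
        using ex_bij_betw_nat_finite[OF fin(2)] by (auto simp: atLeast0LessThan)
      define c where "c i = Inf (snd (h i))" for i
      define d where "d i = Sup (snd (h i))" for i
      have hp: "h i \<in> p" "fst (h i) \<in> N" if "i < card pN" for i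
        using h that by (auto simp: bij_betw_def pN_def)
      have i1: "a \<le> c i \<and> c i \<le> d i \<and> d i \<le> b" if "i < card pN" for i
        using iv[OF hp(1)[OF that]] by (auto simp: c_def d_def)
      have int: "interior (snd (h i)) = {c i<..<d i}" if "i < card pN" for i
        using iv[OF hp(1)[OF that]] interior_atLeastAtMost_real unfolding c_def d_def by metis
      have i2: "{c i<..<d i} \<inter> {c j<..<d j} = {}" if "i < card pN" "j < card pN" "i \<noteq> j" for i j
      proof -
        have "h i \<noteq> h j" using h that by (auto simp: bij_betw_def inj_on_def)
        then have "interior (snd (h i)) \<inter> interior (snd (h j)) = {}"
          using pd(5)[of "fst (h i)" "snd (h i)" "fst (h j)" "snd (h j)"] hp that by simp
        then show ?thesis using int that by simp
      qed
      have "(\<Sum>i<card pN. d i - c i) \<le> measure lebesgue T"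
      proof (rule measure_disjoint_intervals_le)
        show "{c i<..<d i} \<subseteq> T" if "i \<in> {..<card pN}" for i
        proof -
          have "(fst (h i), snd (h i)) \<in> p" using hp that by simp
          then have "snd (h i) \<subseteq> \<gamma> (fst (h i))" using p(2) unfolding fine_def by blast
          then have "snd (h i) \<subseteq> T" using hp that by (simp add: \<gamma>_def)
          then show ?thesis using int[of i] interior_subset that by blast
        qed
      qed (use i1 i2 Tm in auto)
      then have "(\<Sum>i<card pN. d i - c i) < \<delta>" using Tm by simp
      with i1 i2 have "(\<Sum>i<card pN. dist (y (c i)) (y (d i))) < e / 3" by (intro ac') auto
      also have "(\<Sum>i<card pN. dist (y (c i)) (y (d i))) = (\<Sum>i<card pN. norm (S (h i)))"
      proof (rule sum.cong)
        fix i assume "i \<in> {..<card pN}"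
        then have "g (fst (h i)) = 0" using hp gN by simp
        then have "S (h i) = - (y (d i) - y (c i))" by (simp add: S_def case_prod_unfold c_def d_def)
        then show "dist (y (c i)) (y (d i)) = norm (S (h i))" by (simp add: dist_norm)
      qed simp
      also have "\<dots> = (\<Sum>z\<in>pN. norm (S z))" by (rule sum.reindex_bij_betw[OF h])
      finally show ?thesis .
    qed
    have "norm (sum S p) \<le> (\<Sum>z\<in>p. norm (S z))" by (rule norm_sum)
    also have "\<dots> = (\<Sum>z\<in>p - pN. norm (S z)) + (\<Sum>z\<in>pN. norm (S z))"
      by (rule sum.subset_diff) (use fin in \<open>auto simp: pN_def\<close>)
    also have "(\<Sum>z\<in>p - pN. norm (S z)) \<le> (\<Sum>z\<in>p - pN. q * measure lborel (snd z))"
      by (rule sum_mono) (rule good)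
    also have "\<dots> \<le> (\<Sum>z\<in>p. q * measure lborel (snd z))"
      by (rule sum_mono2) (use fin q in auto)
    also have "\<dots> = q * (b - a)"
      using additive_content_tagged_division[of p a b] p(1) ab
      by (simp add: sum_distrib_left[symmetric] case_prod_unfold)
    also have "\<dots> \<le> e / 3"
      using e ab by (simp add: q_def field_simps)
    finally show ?thesis unfolding eq using bad e by linarith
  qed
  ultimately show "\<exists>\<gamma>. gauge \<gamma> \<and> (\<forall>p. p tagged_division_of {a..b} \<and> \<gamma> fine p \<longrightarrow>
      norm ((\<Sum>(x, k)\<in>p. measure lborel k *\<^sub>R g x) - (y b - y a)) < e)"
    by (intro exI[of _ \<gamma>] conjI allI impI) simp_all
qed

text \<open>An absolutely continuous curve is the integral of its almost everywhere derivative, and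
  the integral of a continuous function is differentiable everywhere. This turns almost everywhere
  solutions in the new variables into classical ones.\<close>

lemma abs_cont_imp_has_vector_derivative:
  fixes y :: "real \<Rightarrow> 'b::banach"
  assumes J: "open J" "is_interval J" and ac: "\<And>a b. {a..b} \<subseteq> J \<Longrightarrow> abs_cont_on_interval a b y"
    and ae: "AE t in lebesgue. t \<in> J \<longrightarrow> (y has_vector_derivative g t) (at t)"
    and g: "continuous_on J g" and t: "t \<in> J"
  shows "(y has_vector_derivative g t) (at t)"
proof -
  from ae obtain N where N: "negligible N" "{t. \<not> (t \<in> J \<longrightarrow> (y has_vector_derivative g t) (at t))} \<subseteq> N"
    unfolding eventually_ae_filter_negligible by blast
  obtain r where r: "r > 0" "cball t r \<subseteq> J" using J(1) t open_contains_cball by blast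
  define a where "a = t - r"
  define b where "b = t + r"
  have ab: "{a..b} \<subseteq> J" "t \<in> {a<..<b}" using r by (auto simp: a_def b_def cball_eq_atLeastAtMost)
  have gc: "continuous_on {a..b} g" using g ab continuous_on_subset by blast
  have y: "y s = y a + integral {a..s} g" if s: "s \<in> {a..b}" for s
  proof -
    have sub: "{a..s} \<subseteq> J" using s ab(1) by auto
    have "((\<lambda>t. if t \<in> N then 0 else g t) has_integral (y s - y a)) {a..s}"
      by (rule abs_cont_has_integral[OF _ ac[OF sub] N(1)]) (use s sub N(2) in auto)
    then have "(g has_integral (y s - y a)) {a..s}"
      by (rule has_integral_spike[OF N(1), rotated]) auto
    then have "integral {a..s} g = y s - y a" by (rule integral_unique)
    then show ?thesis by simp
  qed
  have "((\<lambda>u. y a + integral {a..u} g) has_vector_derivative g t) (at t)"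
  proof -
    have "((\<lambda>u. integral {a..u} g) has_vector_derivative g t) (at t within {a..b})"
      using ab(2) by (intro integral_has_vector_derivative gc) auto
    then have "((\<lambda>u. integral {a..u} g) has_vector_derivative g t) (at t)"
      using ab(2) at_within_interior[of t "{a..b}"] by (simp add: interior_atLeastAtMost_real)
    from has_vector_derivative_add[OF has_vector_derivative_const this] show ?thesis by simp
  qed
  then show ?thesis
    by (rule has_vector_derivative_transform_within_open[where S="{a<..<b}"]) (use ab(2) y[symmetric] in auto)
qed

text \<open>Every bad point is the endpoint of arbitrarily short intervals on which the Riemann term
  misses the integral by more than \<eta> times the length. Vitali's theorem covers almost all bad
  points by countably many disjoint such intervals. By the Henstock lemma the misses of any finite
  subfamily add up to less than \<open>e * \<eta>\<close>, so the total length is at most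
  \<open>e\<close>.\<close>

lemma indefinite_integral_bad_negligible:
  fixes u U :: "real \<Rightarrow> real"
  assumes U: "\<And>a b. a \<le> b \<Longrightarrow> (u has_integral (U b - U a)) {a..b}" and \<eta>: "\<eta> > 0"
  shows "negligible {t \<in> {-n<..<n}. \<forall>d>0. \<exists>s. s \<noteq> t \<and> \<bar>s - t\<bar> < d \<and> \<eta> * \<bar>s - t\<bar> < \<bar>U s - U t - u t * (s - t)\<bar>}"
    (is "negligible ?E")
proof (cases "n > 0")
  case False
  then have "?E = {}" by auto
  then show ?thesis by (simp only: negligible_empty)
next
  case n: True
  show ?thesis
    unfolding negligible_outer_le
  proof (intro allI impI)
    fix e :: real assume "e > 0"
    then have "e * \<eta> > 0" using \<eta> by simp
    have "u integrable_on cbox (-n) n" using U[of "-n" n] n by auto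
    from Henstock_lemma[OF this \<open>e * \<eta> > 0\<close>] obtain \<gamma> where \<gamma>: "gauge \<gamma>"
      "\<And>p. p tagged_partial_division_of cbox (-n) n \<Longrightarrow> \<gamma> fine p \<Longrightarrow>
         (\<Sum>(x, k)\<in>p. norm (measure lborel k *\<^sub>R u x - integral k u)) < e * \<eta>" by blast
    \<comment> \<open>An interval is encoded as the pair of its tag and its other endpoint, in
      either order, and then as a ball, the form in which the covering theorem takes it.\<close>
    define ctr where "ctr z = (fst z + snd z) / 2" for z :: "real \<times> real"
    define rad where "rad z = \<bar>snd z - fst z\<bar> / 2" for z :: "real \<times> real"
    define K where "K = {z. fst z \<in> ?E \<and> snd z \<noteq> fst z \<and> cball (ctr z) (rad z) \<subseteq> \<gamma> (fst z) \<inter> {-n<..<n} \<and>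
       \<eta> * \<bar>snd z - fst z\<bar> < \<bar>U (snd z) - U (fst z) - u (fst z) * (snd z - fst z)\<bar>}"
    have in_cball: "fst z \<in> cball (ctr z) (rad z)" for z
      by (auto simp: ctr_def rad_def dist_real_def field_simps)
    have cb: "cball (ctr z) (rad z) = {min (fst z) (snd z)..max (fst z) (snd z)}" for z
      unfolding cball_eq_atLeastAtMost by (auto simp: ctr_def rad_def min_def max_def field_simps abs_if)
    obtain C where C: "countable C" "C \<subseteq> K"
      "pairwise (\<lambda>i j. disjnt (cball (ctr i) (rad i)) (cball (ctr j) (rad j))) C"
      "negligible (?E - (\<Union>i\<in>C. cball (ctr i) (rad i)))"
    proof (rule Vitali_covering_theorem_cballs[of K rad ?E ctr])
      show "0 < rad z" if "z \<in> K" for z using that by (auto simp: K_def rad_def)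
      fix x d :: real assume x: "x \<in> ?E" and d: "0 < d"
      have "open (\<gamma> x \<inter> {-n<..<n})" using \<gamma>(1) by (auto simp: gauge_def)
      moreover have "x \<in> \<gamma> x \<inter> {-n<..<n}" using x \<gamma>(1) by (auto simp: gauge_def)
      ultimately obtain r where r: "r > 0" "ball x r \<subseteq> \<gamma> x \<inter> {-n<..<n}" unfolding open_contains_ball by blast
      have "min r d > 0" using r(1) d by simp
      moreover have "\<forall>d>0. \<exists>s. s \<noteq> x \<and> \<bar>s - x\<bar> < d \<and> \<eta> * \<bar>s - x\<bar> < \<bar>U s - U x - u x * (s - x)\<bar>"
        using x by simp
      ultimately obtain s where s: "s \<noteq> x" "\<bar>s - x\<bar> < min r d" "\<eta> * \<bar>s - x\<bar> < \<bar>U s - U x - u x * (s - x)\<bar>"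
        by blast
      have "cball (ctr (x, s)) (rad (x, s)) \<subseteq> ball x r"
        unfolding cb using s by (auto simp: dist_real_def)
      then have "(x, s) \<in> K" using x s r by (auto simp: K_def)
      moreover have "rad (x, s) < d" using s d by (auto simp: rad_def)
      ultimately show "\<exists>i. i \<in> K \<and> x \<in> cball (ctr i) (rad i) \<and> rad i < d"
        using in_cball[of "(x, s)"] by (intro exI[of _ "(x, s)"]) auto
    qed (rule that)
    have finJ: "measure lebesgue (\<Union>i\<in>J. cball (ctr i) (rad i)) \<le> e" if J: "J \<subseteq> C" "finite J" for J
    proof -
      have JK: "z \<in> K" if "z \<in> J" for z using that J C by auto
      have disj: "cball (ctr i) (rad i) \<inter> cball (ctr j) (rad j) = {}" if "i \<in> J" "j \<in> J" "i \<noteq> j" for i j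
        using C(3) that J unfolding pairwise_def disjnt_def by blast
      define h where "h z = (fst z, cball (ctr z) (rad z))" for z
      have inj: "inj_on h J"
        using disj in_cball unfolding inj_on_def h_def by fastforce
      have "h ` J tagged_partial_division_of cbox (-n) n"
        unfolding tagged_partial_division_of_def
      proof (intro conjI allI impI)
        show "finite (h ` J)" using J by simp
        fix x k assume "(x, k) \<in> h ` J"
        then obtain z where z: "z \<in> J" "x = fst z" "k = cball (ctr z) (rad z)" by (auto simp: h_def)
        show "x \<in> k" using z in_cball by simp
        have "k \<subseteq> {-n<..<n}" using JK[OF z(1)] unfolding z(3) K_def by simp
        also have "\<dots> \<subseteq> cbox (-n) n" by auto
        finally show "k \<subseteq> cbox (-n) n" .
        show "\<exists>a b. k = cbox a b" using z(3) cb by auto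
      next
        fix x1 k1 x2 k2 assume "(x1, k1) \<in> h ` J \<and> (x2, k2) \<in> h ` J \<and> (x1, k1) \<noteq> (x2, k2)"
        then obtain z1 z2 where "z1 \<in> J" "z2 \<in> J" "z1 \<noteq> z2" "k1 = cball (ctr z1) (rad z1)" "k2 = cball (ctr z2) (rad z2)"
          by (auto simp: h_def)
        then have "k1 \<inter> k2 = {}" using disj by simp
        then show "interior k1 \<inter> interior k2 = {}" using interior_subset by blast
      qed
      moreover have "\<gamma> fine h ` J"
      proof (rule fineI)
        fix x k assume "(x, k) \<in> h ` J"
        then obtain z where z: "z \<in> J" "x = fst z" "k = cball (ctr z) (rad z)" by (auto simp: h_def)
        show "k \<subseteq> \<gamma> x" using JK[OF z(1)] unfolding z(2,3) K_def by simp
      qed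
      ultimately have "(\<Sum>(x, k)\<in>h ` J. norm (measure lborel k *\<^sub>R u x - integral k u)) < e * \<eta>" by (rule \<gamma>(2))
      then have "(\<Sum>z\<in>J. norm (measure lborel (cball (ctr z) (rad z)) *\<^sub>R u (fst z) - integral (cball (ctr z) (rad z)) u)) < e * \<eta>"
        unfolding sum.reindex[OF inj] by (simp only: o_def h_def prod.case)
      moreover have "\<eta> * \<bar>snd z - fst z\<bar> \<le> norm (measure lborel (cball (ctr z) (rad z)) *\<^sub>R u (fst z) - integral (cball (ctr z) (rad z)) u)"
        if z: "z \<in> J" for z
      proof -
        have lt: "\<eta> * \<bar>snd z - fst z\<bar> < \<bar>U (snd z) - U (fst z) - u (fst z) * (snd z - fst z)\<bar>"
          using JK[OF z] by (simp add: K_def)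
        show ?thesis
        proof (cases "fst z \<le> snd z")
          case True
          then have "integral (cball (ctr z) (rad z)) u = U (snd z) - U (fst z)"
            unfolding cb using integral_unique[OF U[OF True]] by simp
          then show ?thesis using lt True unfolding cb by (simp add: abs_minus_commute mult.commute)
        next
          case False
          then have i: "integral (cball (ctr z) (rad z)) u = U (fst z) - U (snd z)"
            unfolding cb using integral_unique[OF U[of "snd z" "fst z"]] by simp
          have m: "measure lborel (cball (ctr z) (rad z)) = fst z - snd z" unfolding cb using False by simp
          have "measure lborel (cball (ctr z) (rad z)) *\<^sub>R u (fst z) - integral (cball (ctr z) (rad z)) u
             = U (snd z) - U (fst z) - u (fst z) * (snd z - fst z)" unfolding i m by (simp add: algebra_simps)
          then show ?thesis using lt by simp
        qed
      qed
      then have "(\<Sum>z\<in>J. \<eta> * \<bar>snd z - fst z\<bar>) \<le> (\<Sum>z\<in>J. norm (measure lborel (cball (ctr z) (rad z)) *\<^sub>R u (fst z) - integral (cball (ctr z) (rad z)) u))"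
        by (rule sum_mono)
      ultimately have "\<eta> * (\<Sum>z\<in>J. \<bar>snd z - fst z\<bar>) < e * \<eta>" by (simp add: sum_distrib_left)
      then have sm: "(\<Sum>z\<in>J. \<bar>snd z - fst z\<bar>) \<le> e" using \<eta> by (simp add: mult.commute)
      have "measure lebesgue (\<Union>i\<in>J. cball (ctr i) (rad i)) \<le> (\<Sum>i\<in>J. measure lebesgue (cball (ctr i) (rad i)))"
        using J(2) by (intro measure_UNION_le) auto
      also have "\<dots> = (\<Sum>z\<in>J. \<bar>snd z - fst z\<bar>)" unfolding cb by (intro sum.cong) auto
      finally show ?thesis using sm by simp
    qed
    have meas: "cball (ctr i) (rad i) \<in> lmeasurable" for i by simp
    define T where "T = (\<Union>i\<in>C. cball (ctr i) (rad i))"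
    have T: "T \<in> lmeasurable" "measure lebesgue T \<le> e"
      unfolding T_def
      by (rule fmeasurable_UN_bound[OF C(1) meas finJ], assumption, assumption,
          rule measure_UN_bound[OF C(1) meas finJ])
    have N: "?E - T \<in> lmeasurable" "measure lebesgue (?E - T) = 0"
      using C(4) negligible_imp_measurable negligible_imp_measure0 unfolding T_def by blast+
    have le: "measure lebesgue (T \<union> (?E - T)) \<le> measure lebesgue T + measure lebesgue (?E - T)"
      using T N by (intro measure_Un_le fmeasurableD)
    show "\<exists>T. ?E \<subseteq> T \<and> T \<in> lmeasurable \<and> measure lebesgue T \<le> e"
    proof (intro exI conjI)
      show "?E \<subseteq> T \<union> (?E - T)" by blast
      show "T \<union> (?E - T) \<in> lmeasurable" by (rule fmeasurable.Un[OF T(1) N(1)])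
      show "measure lebesgue (T \<union> (?E - T)) \<le> e" using le T(2) N(2) by linarith
    qed
  qed
qed

text \<open>A point where the derivative fails is already bad for some tolerance 1 / (m + 1) and
  lies in some bounded interval, so countably many negligible sets catch all of them.\<close>

lemma indefinite_integral_has_derivative_AE:
  fixes u U :: "real \<Rightarrow> real"
  assumes U: "\<And>a b. a \<le> b \<Longrightarrow> (u has_integral (U b - U a)) {a..b}"
  shows "AE t in lebesgue. (U has_real_derivative u t) (at t)"
  unfolding eventually_ae_filter_negligible
proof (intro exI conjI)
  define E where "E \<eta> n = {t \<in> {-n<..<n}. \<forall>d>0. \<exists>s. s \<noteq> t \<and> \<bar>s - t\<bar> < d \<and>
     \<eta> * \<bar>s - t\<bar> < \<bar>U s - U t - u t * (s - t)\<bar>}" for \<eta> n :: real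
  define N where "N = (\<Union>(m, n). E (1 / real (Suc m)) (real n))"
  have "negligible (E (1 / real (Suc m)) (real n))" for m n
    unfolding E_def by (rule indefinite_integral_bad_negligible[OF U]) auto
  then show "negligible N" unfolding N_def
    by (intro negligible_countable_Union countable_image) auto
  show "{t. \<not> (U has_real_derivative u t) (at t)} \<subseteq> N"
  proof safe
    fix t assume nd: "\<not> (U has_real_derivative u t) (at t)"
    show "t \<in> N"
    proof (rule ccontr)
      assume "t \<notin> N"
      obtain n :: nat where n: "\<bar>t\<bar> < real n" using reals_Archimedean2 by blast
      have "(U has_vector_derivative u t) (at t)"
        unfolding has_vector_derivative_alt
      proof (intro allI impI)
        fix e :: real assume "e > 0"
        then obtain m :: nat where m: "1 / real (Suc m) < e" using nat_approx_posE by blast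
        have "t \<notin> E (1 / real (Suc m)) (real n)" using \<open>t \<notin> N\<close> unfolding N_def by auto
        moreover have "t \<in> {- real n<..<real n}" using n by auto
        ultimately have "\<not> (\<forall>d>0. \<exists>s. s \<noteq> t \<and> \<bar>s - t\<bar> < d \<and>
            1 / real (Suc m) * \<bar>s - t\<bar> < \<bar>U s - U t - u t * (s - t)\<bar>)"
          unfolding E_def by blast
        then obtain d where d0: "d > 0" "\<not> (\<exists>s. s \<noteq> t \<and> \<bar>s - t\<bar> < d \<and>
            1 / real (Suc m) * \<bar>s - t\<bar> < \<bar>U s - U t - u t * (s - t)\<bar>)" by blast
        have d: "d > 0" "\<bar>U s - U t - u t * (s - t)\<bar> \<le> 1 / real (Suc m) * \<bar>s - t\<bar>"
          if "s \<noteq> t" "\<bar>s - t\<bar> < d" for s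
          using d0 that by (auto simp only: not_less[symmetric])
        have "norm (U (t + s) - U t - s *\<^sub>R u t) \<le> e * \<bar>s\<bar>" if "\<bar>s\<bar> < d" for s
        proof (cases "s = 0")
          case False
          then have "norm (U (t + s) - U t - s *\<^sub>R u t) \<le> 1 / real (Suc m) * \<bar>s\<bar>"
            using d(2)[of "t + s"] that by (simp add: mult.commute)
          also have "\<dots> \<le> e * \<bar>s\<bar>" using m by (intro mult_right_mono) auto
          finally show ?thesis .
        qed simp
        then show "\<exists>d>0. \<forall>s. \<bar>s\<bar> < d \<longrightarrow> norm (U (t + s) - U t - s *\<^sub>R u t) \<le> e * \<bar>s\<bar>" using d0(1) by blast
      qed
      then show False using nd by (simp add: has_real_derivative_iff_has_vector_derivative)
    qed
  qed
qed

lemma abs_cont_compare: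
  fixes f :: "real \<Rightarrow> 'b::metric_space" and g :: "real \<Rightarrow> 'c::metric_space"
  assumes f: "abs_cont_on_interval a b f" and L: "L \<ge> 0"
    and g: "\<And>s t. s \<in> {a..b} \<Longrightarrow> t \<in> {a..b} \<Longrightarrow> dist (g s) (g t) \<le> L * (dist (f s) (f t) + \<bar>t - s\<bar>)"
  shows "abs_cont_on_interval a b g"
  unfolding abs_cont_on_interval_def
proof (intro allI impI)
  fix e :: real assume e: "e > 0"
  define e' where "e' = e / (2 * (L + 1))"
  have e': "e' > 0" using e L by (simp add: e'_def)
  obtain \<delta> where \<delta>: "\<delta> > 0" and ac: "\<forall>(m::nat) c d.
        (\<forall>i<m. a \<le> c i \<and> c i \<le> d i \<and> d i \<le> b) \<and>
        (\<forall>i<m. \<forall>j<m. i \<noteq> j \<longrightarrow> {c i<..<d i} \<inter> {c j<..<d j} = {}) \<and>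
        (\<Sum>i<m. d i - c i) < \<delta> \<longrightarrow> (\<Sum>i<m. dist (f (c i)) (f (d i))) < e'"
    using f[unfolded abs_cont_on_interval_def, rule_format, OF e'] by blast
  show "\<exists>\<delta>>0. \<forall>(m::nat) c d.
        (\<forall>i<m. a \<le> c i \<and> c i \<le> d i \<and> d i \<le> b) \<and>
        (\<forall>i<m. \<forall>j<m. i \<noteq> j \<longrightarrow> {c i<..<d i} \<inter> {c j<..<d j} = {}) \<and>
        (\<Sum>i<m. d i - c i) < \<delta> \<longrightarrow> (\<Sum>i<m. dist (g (c i)) (g (d i))) < e"
  proof (intro exI[of _ "min \<delta> e'"] conjI allI impI)
    show "min \<delta> e' > 0" using \<delta> e' by simp
    fix m :: nat and c d :: "nat \<Rightarrow> real"
    assume *: "(\<forall>i<m. a \<le> c i \<and> c i \<le> d i \<and> d i \<le> b) \<and>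
        (\<forall>i<m. \<forall>j<m. i \<noteq> j \<longrightarrow> {c i<..<d i} \<inter> {c j<..<d j} = {}) \<and>
        (\<Sum>i<m. d i - c i) < min \<delta> e'"
    then have F: "(\<Sum>i<m. dist (f (c i)) (f (d i))) < e'" by (intro ac[rule_format]) auto
    have "(\<Sum>i<m. dist (g (c i)) (g (d i))) \<le> (\<Sum>i<m. L * (dist (f (c i)) (f (d i)) + (d i - c i)))"
    proof (rule sum_mono)
      fix i assume "i \<in> {..<m}"
      then have "a \<le> c i" "c i \<le> d i" "d i \<le> b" using * by auto
      then show "dist (g (c i)) (g (d i)) \<le> L * (dist (f (c i)) (f (d i)) + (d i - c i))"
        using g[of "c i" "d i"] by auto
    qed
    also have "\<dots> = L * ((\<Sum>i<m. dist (f (c i)) (f (d i))) + (\<Sum>i<m. d i - c i))"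
      by (simp only: sum_distrib_left[symmetric] sum.distrib)
    also have "\<dots> \<le> L * (e' + e')" using F * L by (intro mult_left_mono) auto
    also have "\<dots> < (L + 1) * (e' + e')" using e' by (intro mult_strict_right_mono) auto
    also have "(L + 1) * (e' + e') = 2 * (L + 1) * e'" by (simp add: algebra_simps)
    also have "\<dots> = e" using L by (simp add: e'_def)
    finally show "(\<Sum>i<m. dist (g (c i)) (g (d i))) < e" .
  qed
qed

lemma abs_cont_ident: "abs_cont_on_interval a b (\<lambda>t. t)"
  unfolding abs_cont_on_interval_def
proof (intro allI impI)
  fix e :: real assume "e > 0"
  show "\<exists>\<delta>>0. \<forall>(m::nat) c d.
        (\<forall>i<m. a \<le> c i \<and> c i \<le> d i \<and> d i \<le> b) \<and>
        (\<forall>i<m. \<forall>j<m. i \<noteq> j \<longrightarrow> {c i<..<d i} \<inter> {c j<..<d j} = {}) \<and>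
        (\<Sum>i<m. d i - c i) < \<delta> \<longrightarrow> (\<Sum>i<m. dist (c i) (d i)) < e"
  proof (intro exI[of _ e] conjI allI impI)
    fix m :: nat and c d :: "nat \<Rightarrow> real"
    assume *: "(\<forall>i<m. a \<le> c i \<and> c i \<le> d i \<and> d i \<le> b) \<and>
        (\<forall>i<m. \<forall>j<m. i \<noteq> j \<longrightarrow> {c i<..<d i} \<inter> {c j<..<d j} = {}) \<and> (\<Sum>i<m. d i - c i) < e"
    then have "(\<Sum>i<m. dist (c i) (d i)) = (\<Sum>i<m. d i - c i)"
      by (intro sum.cong) (auto simp: dist_real_def)
    then show "(\<Sum>i<m. dist (c i) (d i)) < e" using * by simp
  qed fact
qed

lemma abs_cont_continuous:
  assumes "abs_cont_on_interval a b f"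
  shows "continuous_on {a..b} f"
  unfolding continuous_on_iff
proof (intro ballI allI impI)
  fix x e :: real assume x: "x \<in> {a..b}" and e: "e > 0"
  obtain \<delta> where \<delta>: "\<delta> > 0" and ac: "\<forall>(m::nat) c d.
        (\<forall>i<m. a \<le> c i \<and> c i \<le> d i \<and> d i \<le> b) \<and>
        (\<forall>i<m. \<forall>j<m. i \<noteq> j \<longrightarrow> {c i<..<d i} \<inter> {c j<..<d j} = {}) \<and>
        (\<Sum>i<m. d i - c i) < \<delta> \<longrightarrow> (\<Sum>i<m. dist (f (c i)) (f (d i))) < e"
    using assms[unfolded abs_cont_on_interval_def, rule_format, OF e] by blast
  have "dist (f x') (f x) < e" if x': "x' \<in> {a..b}" "dist x' x < \<delta>" for x'
    using ac[rule_format, of 1 "\<lambda>_. min x x'" "\<lambda>_. max x x'"] x x'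
    by (cases "x \<le> x'") (auto simp: min_def max_def dist_real_def dist_commute)
  then show "\<exists>d>0. \<forall>x'\<in>{a..b}. dist x' x < d \<longrightarrow> dist (f x') (f x) < e" using \<delta> by blast
qed

section \<open>Periodic functions\<close>

lemma periodic_continuous_bounded:
  fixes f :: "real \<Rightarrow> 'b::metric_space"
  assumes f: "continuous_on UNIV f" and per: "\<And>t. f (t + T) = f t" and T: "T > 0"
  shows "bounded (range f)"
proof -
  interpret periodic_fun_simple f T by standard (rule per)
  have "f t \<in> f ` {0..T}" for t
  proof -
    define k where "k = \<lfloor>t / T\<rfloor>"
    have "of_int k \<le> t / T" "t / T < of_int k + 1" unfolding k_def by linarith+
    then have "t - of_int k * T \<in> {0..T}" using T by (simp add: field_simps)
    moreover have "f (t - of_int k * T) = f t" by (rule minus_of_int)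
    ultimately show ?thesis by (metis imageI)
  qed
  then have "range f \<subseteq> f ` {0..T}" by blast
  moreover have "bounded (f ` {0..T})"
    by (intro compact_imp_bounded compact_continuous_image continuous_on_subset[OF f]) auto
  ultimately show ?thesis using bounded_subset by blast
qed

text \<open>The increment of a primitive over one period is constant, because its derivative
  vanishes, and equals the integral 0. So the primitive is itself periodic, and continuity makes it
  bounded.\<close>

lemma periodic_zero_mean_antiderivative:
  fixes g :: "real \<Rightarrow> real"
  assumes g: "continuous_on UNIV g" and per: "\<And>t. g (t + T) = g t" and T: "T > 0"
    and mean: "integral {0..T} g = 0"
  shows "\<exists>G. (\<forall>t. (G has_real_derivative g t) (at t)) \<and> bounded (range G)"
proof -
  obtain G where G: "G 0 = 0" "\<And>t. (G has_vector_derivative g t) (at t)"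
    using continuous_has_antiderivative[OF g] by blast
  have Gr: "(G has_real_derivative g t) (at t)" for t
    using G(2) by (simp add: has_real_derivative_iff_has_vector_derivative)
  have "((\<lambda>t. G (t + T) - G t) has_real_derivative 0) (at t)" for t
  proof -
    have "((\<lambda>s. G (s + T)) has_vector_derivative g (t + T)) (at t)"
      by (rule has_vector_derivative_shift[OF G(2)])
    from has_vector_derivative_diff[OF this G(2)] show ?thesis
      by (simp add: per has_real_derivative_iff_has_vector_derivative)
  qed
  then have const: "G (t + T) - G t = G (0 + T) - G 0" for t
    by (intro DERIV_isconst_all[where f="\<lambda>t. G (t + T) - G t"]) auto
  have "(g has_integral (G T - G 0)) {0..T}"
    using T G(2) by (intro fundamental_theorem_of_calculus) (auto intro: has_vector_derivative_at_within)
  then have "G T - G 0 = 0" using mean integral_unique by metis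
  then have "G (t + T) = G t" for t using const[of t] by simp
  moreover have "continuous_on UNIV G"
    using G(2) by (meson continuous_at_imp_continuous_on has_vector_derivative_continuous)
  ultimately have "bounded (range G)" using periodic_continuous_bounded T by blast
  then show ?thesis using Gr by blast
qed

lemma has_integral_shift:
  fixes f :: "real \<Rightarrow> real"
  assumes "(f has_integral i) {a + c..b + c}"
  shows "((\<lambda>x. f (x + c)) has_integral i) {a..b}"
proof -
  have "(\<lambda>x. x - c) ` {a + c..b + c} = {a..b}"
    by (auto simp: image_iff intro!: bexI[of _ "x + c" for x])
  then show ?thesis
    using has_integral_affinity'[of f i "a + c" "b + c" 1 c] assms by (simp add: add.commute)
qed

section \<open>The closed-loop system\<close>

locale control_system = connection Q k nabla
  for Q :: "'a::euclidean_space set" and k :: nat and nabla +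
  fixes n :: nat and Y :: "nat \<Rightarrow> 'a \<Rightarrow> 'a" and R :: "'a \<Rightarrow> 'a \<Rightarrow> 'a" and \<psi> :: "'a \<Rightarrow> real"
    and \<alpha> :: "real \<Rightarrow> real" and u U :: "nat \<Rightarrow> real \<Rightarrow> real" and lam mu :: "nat \<Rightarrow> real" and T h :: real
  assumes Y: "\<And>i. i \<le> n \<Longrightarrow> Y i \<in> VF"
    and R: "smooth_endomorphism_field Q R"
    and \<psi>: "smooth_map_on Q \<psi>"
    and \<alpha>: "smooth_on_open UNIV \<alpha>"
    and T: "T > 0"
    and u_bounded: "\<And>i. i \<in> {1..n} \<Longrightarrow> bounded (range (u i))"
    and u_periodic: "\<And>i t. i \<in> {1..n} \<Longrightarrow> u i (t + T) = u i t"
    and u_mean: "\<And>i. i \<in> {1..n} \<Longrightarrow> (u i has_integral 0) {0..T}"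
    and U: "\<And>i. i \<in> {1..n} \<Longrightarrow> zero_mean_antiderivative T (u i) (U i)"
    and U_orthonormal: "\<And>i j. i \<in> {1..n} \<Longrightarrow> j \<in> {1..n} \<Longrightarrow>
           1 / T * integral {0..T} (\<lambda>\<tau>. U i \<tau> * U j \<tau>) = (if i = j then 1 else 0)"
begin

abbreviation "M \<equiv> state_space Q"

subsection \<open>The oscillating coefficients\<close>

lemma U_integral: "i \<in> {1..n} \<Longrightarrow> a \<le> b \<Longrightarrow> (u i has_integral (U i b - U i a)) {a..b}"
  using U unfolding zero_mean_antiderivative_def by blast

lemma U_lipschitz: "i \<in> {1..n} \<Longrightarrow> \<exists>B. B-lipschitz_on UNIV (U i)"
proof -
  assume i: "i \<in> {1..n}"
  obtain B where B: "B > 0" "\<And>t. \<bar>u i t\<bar> \<le> B" using u_bounded[OF i] unfolding bounded_pos by auto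
  have *: "\<bar>U i b - U i a\<bar> \<le> B * (b - a)" if "a \<le> b" for a b
    using has_integral_bound_real[OF _ _ U_integral[OF i that], of B "{}"] B that by (auto simp: content_real)
  have "B-lipschitz_on UNIV (U i)"
  proof (rule lipschitz_onI)
    show "dist (U i x) (U i y) \<le> B * dist x y" for x y
      using *[of x y] *[of y x] by (cases "x \<le> y") (auto simp: dist_real_def)
  qed (use B in auto)
  then show ?thesis by blast
qed

text \<open>The increment of \<open>U i\<close> over one period does not depend on the base point,
  since \<open>u i\<close> is periodic; at base point 0 it is the integral of \<open>u i\<close>
  over a period.\<close>

lemma U_periodic: "i \<in> {1..n} \<Longrightarrow> U i (t + T) = U i t"
proof -
  assume i: "i \<in> {1..n}"
  have *: "U i (b + T) - U i b = U i (a + T) - U i a" if "a \<le> b" for a b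
  proof -
    have "((\<lambda>t. u i (t + T)) has_integral (U i (b + T) - U i (a + T))) {a..b}"
      by (rule has_integral_shift[OF U_integral[OF i]]) (use that in auto)
    then have "(u i has_integral (U i (b + T) - U i (a + T))) {a..b}"
      by (simp add: u_periodic[OF i])
    from has_integral_unique[OF this U_integral[OF i that]] show ?thesis by simp
  qed
  have "U i T - U i 0 = 0"
    using has_integral_unique[OF U_integral[OF i, of 0 T] u_mean[OF i]] T by simp
  then show ?thesis using *[of 0 t] *[of t 0] by (cases "0 \<le> t") auto
qed

definition V :: "nat \<Rightarrow> real \<Rightarrow> real" where "V i t = (if i = 0 then 1 else U i t)"

definition modes :: "(nat \<times> nat) set" where "modes = {..n} \<times> {..n}"

definition mode :: "nat \<times> nat \<Rightarrow> real \<Rightarrow> real" where "mode ij t = V (fst ij) t * V (snd ij) t"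

definition mode_avg :: "nat \<times> nat \<Rightarrow> real" where "mode_avg ij = (if fst ij = snd ij then 1 else 0)"

lemma V_cont: "i \<le> n \<Longrightarrow> continuous_on X (V i)"
proof -
  assume i: "i \<le> n"
  show ?thesis
  proof (cases "i = 0")
    case True
    then show ?thesis by (simp add: V_def[abs_def])
  next
    case False
    then have "continuous_on UNIV (U i)" using U_lipschitz[of i] i lipschitz_on_continuous_on by force
    then show ?thesis using False continuous_on_subset[OF _ subset_UNIV] by (auto simp: V_def[abs_def])
  qed
qed

lemma V_periodic: "i \<le> n \<Longrightarrow> V i (t + T) = V i t"
  using U_periodic[of i t] by (auto simp: V_def)

lemma mode_cont: "ij \<in> modes \<Longrightarrow> continuous_on UNIV (mode ij)"
  unfolding mode_def[abs_def] modes_def by (auto intro!: continuous_intros V_cont)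

lemma mode_periodic: "ij \<in> modes \<Longrightarrow> mode ij (t + T) = mode ij t"
  by (auto simp: mode_def modes_def V_periodic)

text \<open>The four cases are the blocks of a Gram matrix: zero mean of \<open>U i\<close> is
  orthogonality to the constant \<open>V 0\<close>, and the remaining block is the orthonormality
  assumed of the \<open>U i\<close>.\<close>

lemma mode_mean: "ij \<in> modes \<Longrightarrow> integral {0..T} (mode ij) = T * mode_avg ij"
proof -
  assume "ij \<in> modes"
  then obtain i j where ij: "ij = (i, j)" "i \<le> n" "j \<le> n" by (auto simp: modes_def)
  have U0: "integral {0..T} (U i) = 0" if "i \<in> {1..n}" for i
    using U[OF that] unfolding zero_mean_antiderivative_def by (auto intro: integral_unique)
  consider "i = 0" "j = 0" | "i = 0" "j \<noteq> 0" | "i \<noteq> 0" "j = 0" | "i \<noteq> 0" "j \<noteq> 0" by auto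
  then show ?thesis
  proof cases
    case 1
    then show ?thesis using T by (simp add: ij mode_def[abs_def] V_def mode_avg_def)
  next
    case 2
    then show ?thesis using U0[of j] ij by (simp add: mode_def[abs_def] V_def mode_avg_def)
  next
    case 3
    then show ?thesis using U0[of i] ij by (simp add: mode_def[abs_def] V_def mode_avg_def)
  next
    case 4
    then show ?thesis using U_orthonormal[of i j] ij T
      by (simp add: mode_def[abs_def] V_def mode_avg_def field_simps split: if_splits)
  qed
qed

definition mode_prim :: "nat \<times> nat \<Rightarrow> real \<Rightarrow> real" where
  "mode_prim ij = (SOME G. (\<forall>t. (G has_real_derivative mode ij t - mode_avg ij) (at t)) \<and> bounded (range G))"

lemma mode_prim:
  assumes "ij \<in> modes"
  shows "(mode_prim ij has_real_derivative mode ij t - mode_avg ij) (at t)" "bounded (range (mode_prim ij))"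
proof -
  have "\<exists>G. (\<forall>t. (G has_real_derivative mode ij t - mode_avg ij) (at t)) \<and> bounded (range G)"
  proof (rule periodic_zero_mean_antiderivative[OF _ _ T])
    show "continuous_on UNIV (\<lambda>t. mode ij t - mode_avg ij)" by (intro continuous_intros mode_cont assms)
    have "mode ij integrable_on {0..T}"
      by (intro integrable_continuous_real continuous_on_subset[OF mode_cont[OF assms]]) auto
    then show "integral {0..T} (\<lambda>t. mode ij t - mode_avg ij) = 0"
      using mode_mean[OF assms] T by (subst Henstock_Kurzweil_Integration.integral_diff) auto
  qed (simp add: mode_periodic[OF assms])
  from someI_ex[OF this] show "(mode_prim ij has_real_derivative mode ij t - mode_avg ij) (at t)" "bounded (range (mode_prim ij))"
    unfolding mode_prim_def by blast+
qed

subsection \<open>The vector field in the new variables\<close>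

definition pos :: "('a \<times> 'a) \<times> real \<Rightarrow> 'a" where "pos x = fst (fst x)"
definition tvel :: "('a \<times> 'a) \<times> real \<Rightarrow> 'a" where "tvel x = snd (fst x)"
definition eta :: "('a \<times> 'a) \<times> real \<Rightarrow> real" where "eta x = snd x"
definition gain :: "('a \<times> 'a) \<times> real \<Rightarrow> real" where "gain x = \<alpha> (\<psi> (pos x) - eta x)"
definition dgain :: "('a \<times> 'a) \<times> real \<Rightarrow> real" where "dgain x = deriv \<alpha> (\<psi> (pos x) - eta x)"
definition eta_rate :: "('a \<times> 'a) \<times> real \<Rightarrow> real" where "eta_rate x = - h * eta x + h * \<psi> (pos x)"
text \<open>The fields Z i in which the original velocity is expanded, see \<open>vel_eq\<close>;
  for index 0 this is the velocity in the new variables.\<close>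

definition osc_field :: "nat \<Rightarrow> ('a \<times> 'a) \<times> real \<Rightarrow> 'a" where
  "osc_field i x = (if i = 0 then tvel x else (lam i * gain x) *\<^sub>R Y i (pos x))"
text \<open>The derivative of \<open>osc_field j\<close> when the position moves with velocity
  \<open>w\<close> and \<open>eta\<close> is frozen; the contribution of \<open>eta\<close> is a
  separate term in \<open>mode_acc\<close>.\<close>

definition d_osc_field :: "nat \<Rightarrow> ('a \<times> 'a) \<times> real \<Rightarrow> 'a \<Rightarrow> 'a" where
  "d_osc_field j x w = (lam j * dgain x * deriv_on \<psi> (pos x) w) *\<^sub>R Y j (pos x) + (lam j * gain x) *\<^sub>R deriv_on (Y j) (pos x) w"
definition drift :: "('a \<times> 'a) \<times> real \<Rightarrow> 'a" where
  "drift x = Y 0 (pos x) + (\<Sum>i=1..n. (mu i * (gain x)\<^sup>2) *\<^sub>R Y i (pos x))"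

text \<open>The coefficient of \<open>V i V j\<close> in the acceleration in the new variables. Terms of degree less than
  two in \<open>U\<close> are made quadratic by factors \<open>V 0 = 1\<close>.\<close>

definition mode_acc :: "nat \<Rightarrow> nat \<Rightarrow> ('a \<times> 'a) \<times> real \<Rightarrow> 'a" where
  "mode_acc i j x = (if i = 0 \<and> j = 0 then drift x else 0) - (if j = 0 then R (pos x) (osc_field i x) else 0)
     - christoffel (pos x) (osc_field i x) (osc_field j x) + proj_deriv (pos x) (osc_field i x) (osc_field j x)
     - (if j = 0 then 0 else d_osc_field j x (osc_field i x))
     + (if i = 0 \<and> j \<noteq> 0 then (lam j * dgain x * eta_rate x) *\<^sub>R Y j (pos x) else 0)"

definition mode_field :: "nat \<times> nat \<Rightarrow> ('a \<times> 'a) \<times> real \<Rightarrow> ('a \<times> 'a) \<times> real" where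
  "mode_field ij x = ((if snd ij = 0 then osc_field (fst ij) x else 0, mode_acc (fst ij) (snd ij) x),
     if fst ij = 0 \<and> snd ij = 0 then eta_rate x else 0)"

text \<open>\<open>tvel\<close> is the velocity in the new variables, \<open>vel\<close> the original one.\<close>

definition osc_vel :: "real \<Rightarrow> ('a \<times> 'a) \<times> real \<Rightarrow> 'a" where
  "osc_vel t x = (\<Sum>i=1..n. U i t *\<^sub>R osc_field i x)"
definition vel :: "real \<Rightarrow> ('a \<times> 'a) \<times> real \<Rightarrow> 'a" where "vel t x = tvel x + osc_vel t x"

lemma state_space_iff: "x \<in> M \<longleftrightarrow> pos x \<in> Q \<and> tvel x \<in> TS (pos x)"
  by (cases x) (auto simp: state_space_def tangent_bundle_def pos_def tvel_def)

lemma state_sel: "x = ((pos x, tvel x), eta x)" by (simp add: pos_def tvel_def eta_def)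

lemma sel_simps [simp]: "pos ((q, v), e) = q" "tvel ((q, v), e) = v" "eta ((q, v), e) = e"
  by (simp_all add: pos_def tvel_def eta_def)

lemma sum_split0: "(\<Sum>i\<le>n. f i) = f 0 + (\<Sum>i=1..n. (f i :: 'c::ab_group_add))"
proof -
  have "{..n} = insert 0 {1..n}" by auto
  then show ?thesis by simp
qed

lemma vel_eq: "vel t x = (\<Sum>i\<le>n. V i t *\<^sub>R osc_field i x)"
  unfolding sum_split0 vel_def osc_vel_def by (simp add: V_def osc_field_def)

lemma Y_VF: "i \<in> {1..n} \<Longrightarrow> Y i \<in> VF" using Y by simp

lemma osc_field_tangent: "x \<in> M \<Longrightarrow> i \<le> n \<Longrightarrow> osc_field i x \<in> TS (pos x)"
  using Y[of i] VF_tangent[of "Y i" "pos x"] subspace_scale[OF subspace_tangent]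
  by (auto simp: osc_field_def state_space_iff)

lemma osc_vel_tangent: "x \<in> M \<Longrightarrow> osc_vel t x \<in> TS (pos x)"
  unfolding osc_vel_def
  by (intro subspace_sum subspace_scale subspace_tangent osc_field_tangent) (auto simp: state_space_iff)

lemma vel_tangent: "x \<in> M \<Longrightarrow> vel t x \<in> TS (pos x)"
  unfolding vel_def using osc_vel_tangent subspace_add[OF subspace_tangent] by (auto simp: state_space_iff)

lemma R_tangent: "q \<in> Q \<Longrightarrow> v \<in> TS q \<Longrightarrow> R q v \<in> TS q"
  using R unfolding smooth_endomorphism_field_def by blast

lemma R_linear: "q \<in> Q \<Longrightarrow> v \<in> TS q \<Longrightarrow> w \<in> TS q \<Longrightarrow> R q (a *\<^sub>R v + b *\<^sub>R w) = a *\<^sub>R R q v + b *\<^sub>R R q w"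
  using R unfolding smooth_endomorphism_field_def by blast

lemma R_sum:
  assumes "q \<in> Q" "finite I" "\<And>i. i \<in> I \<Longrightarrow> z i \<in> TS q"
  shows "R q (\<Sum>i\<in>I. c i *\<^sub>R z i) = (\<Sum>i\<in>I. c i *\<^sub>R R q (z i))"
  using assms(2,3)
proof (induction I rule: finite_induct)
  case empty
  have "0 \<in> TS q" using subspace_0[OF subspace_tangent[OF assms(1)]] .
  then show ?case using R_linear[OF assms(1), of 0 0 0 0] by simp
next
  case (insert i I)
  have "(\<Sum>i\<in>I. c i *\<^sub>R z i) \<in> TS q"
    using insert.prems by (intro subspace_sum subspace_scale subspace_tangent[OF assms(1)]) auto
  then show ?case using R_linear[OF assms(1), of "z i" "\<Sum>i\<in>I. c i *\<^sub>R z i" "c i" 1] insert by simp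
qed

lemma linear_proj_deriv: "linear (proj_deriv q v)"
  unfolding proj_deriv_def
  by (rule linearI) (simp_all add: inner_add_left algebra_simps sum.distrib scaleR_sum_right)

lemma linear_proj_deriv_left: "q \<in> Q \<Longrightarrow> linear (\<lambda>v. proj_deriv q v w)"
  unfolding proj_deriv_def
  using linear_add[OF linear_deriv_on[OF smooth_tangent_proj]] linear_scale[OF linear_deriv_on[OF smooth_tangent_proj]]
  by (intro linearI) (simp_all add: scaleR_add_right sum.distrib scaleR_sum_right mult.commute)

lemma linear_d_osc_field: "pos x \<in> Q \<Longrightarrow> j \<in> {1..n} \<Longrightarrow> linear (d_osc_field j x)"
  unfolding d_osc_field_def
  using linear_add[OF linear_deriv_on[OF \<psi>]] linear_scale[OF linear_deriv_on[OF \<psi>]]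
    linear_add[OF linear_deriv_on[OF VF_smooth[OF Y_VF]]] linear_scale[OF linear_deriv_on[OF VF_smooth[OF Y_VF]]]
  by (intro linearI) (simp_all add: algebra_simps)

lemma bilinear_double_sum:
  assumes "\<And>v. linear (B v)" "\<And>w. linear (\<lambda>v. B v w)"
  shows "(\<Sum>i\<le>n. \<Sum>j\<le>n. (V i t * V j t) *\<^sub>R B (osc_field i x) (osc_field j x)) = B (vel t x) (vel t x)"
proof -
  have "B (vel t x) (vel t x) = (\<Sum>i\<le>n. V i t *\<^sub>R B (osc_field i x) (vel t x))"
    unfolding vel_eq linear_sum[OF assms(2)] linear_scale[OF assms(2)] ..
  also have "\<dots> = (\<Sum>i\<le>n. \<Sum>j\<le>n. (V i t * V j t) *\<^sub>R B (osc_field i x) (osc_field j x))"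
    unfolding vel_eq linear_sum[OF assms(1)] linear_scale[OF assms(1)] by (simp add: scaleR_sum_right)
  finally show ?thesis by simp
qed

text \<open>The ambient derivative of the new velocity. The Christoffel and projection terms convert
  a covariant into an ambient derivative, and the last sum is the derivative of
  \<open>osc_vel\<close> at frozen phase. No derivative of \<open>U\<close> appears, because it
  cancels against the forcing.\<close>

definition acc :: "real \<Rightarrow> ('a \<times> 'a) \<times> real \<Rightarrow> 'a" where
  "acc t x = drift x - R (pos x) (vel t x) - christoffel (pos x) (vel t x) (vel t x)
     + proj_deriv (pos x) (vel t x) (vel t x)
     - (\<Sum>j=1..n. U j t *\<^sub>R (d_osc_field j x (vel t x) - (lam j * dgain x * eta_rate x) *\<^sub>R Y j (pos x)))"

text \<open>Each summand of \<open>mode_acc\<close> is treated alone. Where an index is pinned to 0,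
  the sum collapses because V 0 = 1; the remaining indices recombine into \<open>vel\<close> by
  linearity.\<close>

lemma sum_mode_acc:
  assumes x: "x \<in> M"
  shows "(\<Sum>i\<le>n. \<Sum>j\<le>n. (V i t * V j t) *\<^sub>R mode_acc i j x) = acc t x"
proof -
  have q: "pos x \<in> Q" using x by (simp add: state_space_iff)
  have S2: "(\<Sum>i\<le>n. \<Sum>j\<le>n. (V i t * V j t) *\<^sub>R (if i = 0 \<and> j = 0 then drift x else 0)) = drift x"
    by (simp add: sum_split0 V_def)
  have S1: "(\<Sum>i\<le>n. \<Sum>j\<le>n. (V i t * V j t) *\<^sub>R (if j = 0 then R (pos x) (osc_field i x) else 0)) = R (pos x) (vel t x)"
  proof -
    have "(\<Sum>i\<le>n. \<Sum>j\<le>n. (V i t * V j t) *\<^sub>R (if j = 0 then R (pos x) (osc_field i x) else 0)) = (\<Sum>i\<le>n. V i t *\<^sub>R R (pos x) (osc_field i x))"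
      unfolding sum_split0[of "\<lambda>j. (V i t * V j t) *\<^sub>R (if j = 0 then R (pos x) (osc_field i x) else 0)" for i]
      by (simp add: V_def)
    also have "\<dots> = R (pos x) (vel t x)"
      unfolding vel_eq using R_sum[OF q, of "{..n}" "\<lambda>i. osc_field i x"] osc_field_tangent[OF x] by simp
    finally show ?thesis .
  qed
  have S4: "(\<Sum>i\<le>n. \<Sum>j\<le>n. (V i t * V j t) *\<^sub>R (if j = 0 then 0 else d_osc_field j x (osc_field i x))) = (\<Sum>j=1..n. U j t *\<^sub>R d_osc_field j x (vel t x))"
  proof -
    have "(\<Sum>i\<le>n. \<Sum>j\<le>n. (V i t * V j t) *\<^sub>R (if j = 0 then 0 else d_osc_field j x (osc_field i x)))
       = (\<Sum>j\<le>n. \<Sum>i\<le>n. (V i t * V j t) *\<^sub>R (if j = 0 then 0 else d_osc_field j x (osc_field i x)))"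
      by (rule sum.swap)
    also have "\<dots> = (\<Sum>j=1..n. \<Sum>i\<le>n. (V i t * V j t) *\<^sub>R d_osc_field j x (osc_field i x))"
      by (simp add: sum_split0[of "\<lambda>j. \<Sum>i\<le>n. (V i t * V j t) *\<^sub>R (if j = 0 then 0 else d_osc_field j x (osc_field i x))"])
    also have "\<dots> = (\<Sum>j=1..n. U j t *\<^sub>R d_osc_field j x (vel t x))"
    proof (rule sum.cong)
      fix j assume j: "j \<in> {1..n}"
      show "(\<Sum>i\<le>n. (V i t * V j t) *\<^sub>R d_osc_field j x (osc_field i x)) = U j t *\<^sub>R d_osc_field j x (vel t x)"
        unfolding vel_eq linear_sum[OF linear_d_osc_field[OF q j]] linear_scale[OF linear_d_osc_field[OF q j]]
        using j by (simp add: scaleR_sum_right V_def[of j] mult.commute)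
    qed simp
    finally show ?thesis .
  qed
  have S5: "(\<Sum>i\<le>n. \<Sum>j\<le>n. (V i t * V j t) *\<^sub>R (if i = 0 \<and> j \<noteq> 0 then (lam j * dgain x * eta_rate x) *\<^sub>R Y j (pos x) else 0))
     = (\<Sum>j=1..n. U j t *\<^sub>R (lam j * dgain x * eta_rate x) *\<^sub>R Y j (pos x))"
    by (simp add: sum_split0 V_def)
  have S3: "(\<Sum>i\<le>n. \<Sum>j\<le>n. (V i t * V j t) *\<^sub>R christoffel (pos x) (osc_field i x) (osc_field j x)) = christoffel (pos x) (vel t x) (vel t x)"
    by (intro bilinear_double_sum linear_christoffel linear_christoffel_left)
  have S3': "(\<Sum>i\<le>n. \<Sum>j\<le>n. (V i t * V j t) *\<^sub>R proj_deriv (pos x) (osc_field i x) (osc_field j x)) = proj_deriv (pos x) (vel t x) (vel t x)"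
    by (intro bilinear_double_sum linear_proj_deriv linear_proj_deriv_left q)
  show ?thesis
    unfolding mode_acc_def acc_def scaleR_add_right scaleR_diff_right sum.distrib sum_subtractf S1 S2 S3 S3' S4 S5
    by (simp add: algebra_simps)
qed

lemma sum_mode_field:
  assumes x: "x \<in> M"
  shows "(\<Sum>ij\<in>modes. mode ij t *\<^sub>R mode_field ij x) = ((vel t x, acc t x), eta_rate x)"
proof -
  have 1: "(\<Sum>ij\<in>modes. f ij) = (\<Sum>i\<le>n. \<Sum>j\<le>n. f (i, j))" for f :: "nat \<times> nat \<Rightarrow> 'c::comm_monoid_add"
    unfolding modes_def by (simp add: sum.cartesian_product)
  have "fst (fst (\<Sum>ij\<in>modes. mode ij t *\<^sub>R mode_field ij x)) = vel t x"
  proof -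
    have "(\<Sum>j\<le>n. (V i t * V j t) *\<^sub>R (if j = 0 then osc_field i x else 0)) = V i t *\<^sub>R osc_field i x" for i
      by (simp add: sum_split0 V_def[of 0])
    then show ?thesis
      unfolding fst_sum 1 mode_def mode_field_def fst_scaleR fst_conv snd_conv vel_eq by simp
  qed
  moreover have "snd (fst (\<Sum>ij\<in>modes. mode ij t *\<^sub>R mode_field ij x)) = acc t x"
    unfolding fst_sum snd_sum 1 by (simp add: mode_def mode_field_def sum_mode_acc[OF x])
  moreover have "snd (\<Sum>ij\<in>modes. mode ij t *\<^sub>R mode_field ij x) = eta_rate x"
    unfolding snd_sum 1 by (simp add: mode_def mode_field_def sum_split0 V_def)
  ultimately show ?thesis by (simp only: prod_eq_iff fst_conv snd_conv simp_thms)
qed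

subsection \<open>Local Lipschitz continuity\<close>

lemma lip_pos: "locally_lipschitz_on M pos" and lip_tvel: "locally_lipschitz_on M tvel" and lip_eta: "locally_lipschitz_on M eta"
  unfolding pos_def[abs_def] tvel_def[abs_def] eta_def[abs_def]
  by (intro bounded_linear_locally_lipschitz bounded_linear_compose[OF bounded_linear_fst bounded_linear_fst]
     bounded_linear_compose[OF bounded_linear_snd bounded_linear_fst] bounded_linear_snd)+

lemma pos_in: "pos ` M \<subseteq> Q" by (auto simp: state_space_iff)

lemma lip_smooth:
  fixes f :: "'a \<Rightarrow> 'b::euclidean_space"
  shows "smooth_map_on Q f \<Longrightarrow> locally_lipschitz_on M (\<lambda>x. f (pos x))"
  by (rule locally_lipschitz_on_compose[OF lip_pos smooth_imp_locally_lipschitz pos_in])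

lemma lip_Y: "i \<le> n \<Longrightarrow> locally_lipschitz_on M (\<lambda>x. Y i (pos x))"
  by (intro lip_smooth VF_smooth Y)

lemma smooth_real: "smooth_map_on UNIV \<alpha>" "smooth_map_on UNIV (deriv \<alpha>)"
proof -
  show "smooth_map_on UNIV \<alpha>" by (rule smooth_on_open_imp_map_on[OF \<alpha>]) simp
  have "deriv \<alpha> s = frechet_derivative \<alpha> (at s) 1" for s
  proof (rule DERIV_imp_deriv)
    have "((\<lambda>s. \<alpha> s) has_vector_derivative frechet_derivative \<alpha> (at s) 1) (at s)"
      using has_derivative_along_curve[OF smooth_on_open_has_derivative[OF \<alpha>], of "\<lambda>s. s" s 1]
      by (auto intro!: derivative_eq_intros)
    then show "(\<alpha> has_real_derivative frechet_derivative \<alpha> (at s) 1) (at s)"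
      by (simp add: has_real_derivative_iff_has_vector_derivative)
  qed
  then have "deriv \<alpha> = (\<lambda>s. frechet_derivative \<alpha> (at s) 1)" by auto
  then show "smooth_map_on UNIV (deriv \<alpha>)"
    using smooth_on_open_imp_map_on[OF smooth_on_open_frechet[OF \<alpha>, of 1]] by simp
qed

lemma alpha_deriv: "(\<alpha> has_real_derivative deriv \<alpha> s) (at s)"
proof -
  have "\<alpha> differentiable (at s)"
    using smooth_on_open_has_derivative[OF \<alpha>, of s] by (auto simp: differentiable_def)
  then show ?thesis using DERIV_deriv_iff_real_differentiable by blast
qed

lemma lip_diff: "locally_lipschitz_on M (\<lambda>x. \<psi> (pos x) - eta x)"
  by (intro locally_lipschitz_on_diff lip_smooth \<psi> lip_eta)

lemma lip_gain: "locally_lipschitz_on M gain" and lip_dgain: "locally_lipschitz_on M dgain"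
  unfolding gain_def[abs_def] dgain_def[abs_def]
  by (rule locally_lipschitz_on_compose[OF lip_diff smooth_imp_locally_lipschitz[OF smooth_real(1)]]
      locally_lipschitz_on_compose[OF lip_diff smooth_imp_locally_lipschitz[OF smooth_real(2)]], simp)+

lemma lip_eta_rate: "locally_lipschitz_on M eta_rate"
  unfolding eta_rate_def[abs_def]
  by (intro locally_lipschitz_on_add locally_lipschitz_on_mult locally_lipschitz_on_const lip_eta lip_smooth \<psi>)

lemma lip_osc_field: "i \<le> n \<Longrightarrow> locally_lipschitz_on M (osc_field i)"
proof (cases "i = 0")
  case True
  then show ?thesis using lip_tvel by (simp add: osc_field_def[abs_def] tvel_def[abs_def])
next
  case False
  then show "i \<le> n \<Longrightarrow> ?thesis"
    unfolding osc_field_def[abs_def]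
    by (simp, intro locally_lipschitz_on_scaleR locally_lipschitz_on_mult locally_lipschitz_on_const lip_gain lip_Y)
qed

lemma lip_deriv_on:
  fixes f :: "'a \<Rightarrow> 'b::euclidean_space"
  assumes "smooth_map_on Q f" "i \<le> n"
  shows "locally_lipschitz_on M (\<lambda>x. deriv_on f (pos x) (osc_field i x))"
  by (rule locally_lipschitz_deriv_on[OF assms(1) lip_pos _ lip_osc_field[OF assms(2)] osc_field_tangent[OF _ assms(2)]])
    (auto simp: state_space_iff)

lemma lip_R:
  assumes "i \<le> n"
  shows "locally_lipschitz_on M (\<lambda>x. R (pos x) (osc_field i x))"
proof -
  have "locally_lipschitz_on (tangent_bundle Q) (\<lambda>(q, v). R q v)"
    using R unfolding smooth_endomorphism_field_def by (blast intro: smooth_imp_locally_lipschitz)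
  from locally_lipschitz_on_compose[OF locally_lipschitz_on_Pair[OF lip_pos lip_osc_field[OF assms]] this]
  show ?thesis using osc_field_tangent[OF _ assms] by (force simp: tangent_bundle_def state_space_iff)
qed

lemma lip_mode_acc:
  assumes ij: "i \<le> n" "j \<le> n"
  shows "locally_lipschitz_on M (mode_acc i j)"
proof -
  have G: "locally_lipschitz_on M drift"
    unfolding drift_def[abs_def] power2_eq_square
    by (intro locally_lipschitz_on_add locally_lipschitz_on_sum locally_lipschitz_on_scaleR
        locally_lipschitz_on_mult locally_lipschitz_on_const lip_gain lip_Y) auto
  have C: "locally_lipschitz_on M (\<lambda>x. christoffel (pos x) (osc_field i x) (osc_field j x))"
    unfolding christoffel_def
    by (intro locally_lipschitz_on_sum locally_lipschitz_on_scaleR locally_lipschitz_on_inner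
        locally_lipschitz_on_mult locally_lipschitz_on_const lip_osc_field ij finite_Basis lip_smooth VF_smooth nabla_VF VF_proj)
  have D: "locally_lipschitz_on M (\<lambda>x. proj_deriv (pos x) (osc_field i x) (osc_field j x))"
    unfolding proj_deriv_def
    by (intro locally_lipschitz_on_sum locally_lipschitz_on_scaleR locally_lipschitz_on_inner
        locally_lipschitz_on_const lip_osc_field ij finite_Basis lip_deriv_on smooth_tangent_proj)
  have E: "locally_lipschitz_on M (\<lambda>x. d_osc_field j x (osc_field i x))"
    unfolding d_osc_field_def
    by (intro locally_lipschitz_on_add locally_lipschitz_on_scaleR locally_lipschitz_on_mult
        locally_lipschitz_on_const lip_dgain lip_gain lip_Y ij lip_deriv_on \<psi> VF_smooth Y)
  have H: "locally_lipschitz_on M (\<lambda>x. (lam j * dgain x * eta_rate x) *\<^sub>R Y j (pos x))"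
    by (intro locally_lipschitz_on_scaleR locally_lipschitz_on_mult locally_lipschitz_on_const lip_dgain lip_eta_rate lip_Y ij)
  have if': "locally_lipschitz_on M (\<lambda>x. if b then f x else g x)"
    if "locally_lipschitz_on M f" "locally_lipschitz_on M g" for b and f g :: "('a \<times> 'a) \<times> real \<Rightarrow> 'a"
    using that by (cases b) auto
  show ?thesis
    unfolding mode_acc_def[abs_def]
    by (intro locally_lipschitz_on_add locally_lipschitz_on_diff if' G C D E H lip_R locally_lipschitz_on_const ij)
qed

lemma lip_mode_field: "ij \<in> modes \<Longrightarrow> locally_lipschitz_on M (mode_field ij)"
proof -
  assume "ij \<in> modes"
  then have ij: "fst ij \<le> n" "snd ij \<le> n" by (auto simp: modes_def)
  have if': "locally_lipschitz_on M (\<lambda>x. if b then f x else g x)"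
    if "locally_lipschitz_on M f" "locally_lipschitz_on M g" for b and f g :: "('a \<times> 'a) \<times> real \<Rightarrow> 'b::metric_space"
    using that by (cases b) auto
  show ?thesis
    unfolding mode_field_def[abs_def]
    by (intro locally_lipschitz_on_Pair if' lip_osc_field lip_mode_acc ij lip_eta_rate locally_lipschitz_on_const)
qed

end

section \<open>Null sets under scaling; absolute continuity under composition\<close>

lemma AE_lebesgue_scale:
  fixes P :: "real \<Rightarrow> bool"
  assumes "AE t in lebesgue. P t" "c \<noteq> 0"
  shows "AE t in lebesgue. P (c * t)"
proof -
  obtain N where N: "negligible N" "{t. \<not> P t} \<subseteq> N"
    using assms(1) unfolding eventually_ae_filter_negligible by blast
  have "negligible ((\<lambda>t. inverse c * t) ` N)"
    by (rule negligible_differentiable_image_negligible[OF order_refl N(1)])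
      (intro linear_imp_differentiable_on, simp add: linear_iff algebra_simps)
  moreover have "{t. \<not> P (c * t)} \<subseteq> (\<lambda>t. inverse c * t) ` N"
  proof
    fix t assume "t \<in> {t. \<not> P (c * t)}"
    then have "c * t \<in> N" using N(2) by auto
    then show "t \<in> (\<lambda>t. inverse c * t) ` N" using assms(2) by (intro image_eqI[of _ _ "c * t"]) auto
  qed
  ultimately show ?thesis unfolding eventually_ae_filter_negligible by blast
qed

lemma abs_cont_of_bounded_derivative:
  fixes y :: "real \<Rightarrow> 'b::real_normed_vector"
  assumes "\<And>t. t \<in> {a..b} \<Longrightarrow> (y has_vector_derivative y' t) (at t)" "continuous_on {a..b} y'"
  shows "abs_cont_on_interval a b y"
proof -
  have "bounded (y' ` {a..b})" by (intro compact_imp_bounded compact_continuous_image assms) auto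
  then obtain B where B: "B > 0" "\<And>t. t \<in> {a..b} \<Longrightarrow> norm (y' t) \<le> B" unfolding bounded_pos by auto
  have lip: "norm (y s - y t) \<le> B * norm (s - t)" if "s \<in> {a..b}" "t \<in> {a..b}" for s t
  proof (rule differentiable_bound[OF convex_real_interval(5)[of a b] _ _ that, where f'="\<lambda>t r. r *\<^sub>R y' t"])
    show "(y has_derivative (\<lambda>r. r *\<^sub>R y' x)) (at x within {a..b})" if "x \<in> {a..b}" for x
      using assms(1)[OF that] unfolding has_vector_derivative_def by (rule has_derivative_at_withinI)
    show "onorm (\<lambda>r. r *\<^sub>R y' x) \<le> B" if "x \<in> {a..b}" for x
      using B(2)[OF that] by (intro onorm_le) (simp add: mult.commute[of B] mult_left_mono)
  qed
  show ?thesis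
  proof (rule abs_cont_compare[OF abs_cont_ident, of B])
    fix s t assume "s \<in> {a..b}" "t \<in> {a..b}"
    then have "dist (y s) (y t) \<le> B * \<bar>t - s\<bar>" using lip[of s t] by (simp add: dist_norm abs_minus_commute)
    also have "\<dots> \<le> B * (dist s t + \<bar>t - s\<bar>)" using B(1) by (intro mult_left_mono) auto
    finally show "dist (y s) (y t) \<le> B * (dist s t + \<bar>t - s\<bar>)" .
  qed (use B in auto)
qed

text \<open>The graph of \<open>f\<close> over a compact interval is compact, so one Lipschitz
  constant of \<open>F\<close> serves. Time is an argument of \<open>F\<close> because the change of
  variables depends on it.\<close>

lemma abs_cont_locally_lipschitz:
  fixes f :: "real \<Rightarrow> 'b::metric_space"
  assumes f: "abs_cont_on_interval a b f" and M: "\<And>t. t \<in> {a..b} \<Longrightarrow> f t \<in> M"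
    and F: "locally_lipschitz_on (UNIV \<times> M) F"
  shows "abs_cont_on_interval a b (\<lambda>t. F (t, f t))"
proof -
  have "compact ((\<lambda>t. (t, f t)) ` {a..b})"
    by (intro compact_continuous_image continuous_intros abs_cont_continuous f) auto
  moreover have "(\<lambda>t. (t, f t)) ` {a..b} \<subseteq> UNIV \<times> M" using M by auto
  ultimately obtain L where L: "L-lipschitz_on ((\<lambda>t. (t, f t)) ` {a..b}) F"
    using locally_lipschitz_on_compact[OF F] by blast
  have L0: "L \<ge> 0" by (rule lipschitz_on_nonneg[OF L])
  show ?thesis
  proof (rule abs_cont_compare[OF f L0])
    fix s t assume st: "s \<in> {a..b}" "t \<in> {a..b}"
    then have "dist (F (s, f s)) (F (t, f t)) \<le> L * dist (s, f s) (t, f t)"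
      by (intro lipschitz_onD[OF L]) auto
    also have "dist (s, f s) (t, f t) \<le> dist s t + dist (f s) (f t)"
      unfolding dist_Pair_Pair by (rule sqrt_sum_squares_le_sum) auto
    finally show "dist (F (s, f s)) (F (t, f t)) \<le> L * (dist (f s) (f t) + \<bar>t - s\<bar>)"
      using L0 by (simp add: dist_real_def abs_minus_commute add.commute mult_left_mono)
  qed
qed

section \<open>Invariance of the state space\<close>

context control_system
begin

lemma osc_field_cong: "j \<in> {1..n} \<Longrightarrow> pos x = pos y \<Longrightarrow> eta x = eta y \<Longrightarrow> osc_field j x = osc_field j y"
  by (auto simp: osc_field_def gain_def)

lemma osc_vel_cong: "pos x = pos y \<Longrightarrow> eta x = eta y \<Longrightarrow> osc_vel t x = osc_vel t y"
  unfolding osc_vel_def by (intro sum.cong refl arg_cong2[where f=scaleR] osc_field_cong)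

lemma d_osc_field_cong: "pos x = pos y \<Longrightarrow> eta x = eta y \<Longrightarrow> d_osc_field j x = d_osc_field j y"
  by (auto simp: d_osc_field_def gain_def dgain_def)

lemma drift_cong: "pos x = pos y \<Longrightarrow> eta x = eta y \<Longrightarrow> drift x = drift y"
  by (auto simp: drift_def gain_def)

lemma dgain_cong: "pos x = pos y \<Longrightarrow> eta x = eta y \<Longrightarrow> dgain x = dgain y" and eta_rate_cong: "pos x = pos y \<Longrightarrow> eta x = eta y \<Longrightarrow> eta_rate x = eta_rate y"
  by (auto simp: dgain_def eta_rate_def)

lemma osc_field_along_curve:
  assumes j: "j \<in> {1..n}" and q: "pos (x t) \<in> Q" "\<forall>\<^sub>F s in nhds t. pos (x s) \<in> Q"
    "((\<lambda>s. pos (x s)) has_vector_derivative w) (at t)" and e: "((\<lambda>s. eta (x s)) has_real_derivative e) (at t)"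
  shows "((\<lambda>s. osc_field j (x s)) has_vector_derivative d_osc_field j (x t) w - (lam j * dgain (x t) * e) *\<^sub>R Y j (pos (x t))) (at t)"
proof -
  have "((\<lambda>s. \<psi> (pos (x s))) has_real_derivative deriv_on \<psi> (pos (x t)) w) (at t)"
    using deriv_on_along_curve[OF \<psi>, of "\<lambda>s. pos (x s)"] q
    by (simp add: has_real_derivative_iff_has_vector_derivative)
  from DERIV_diff[OF this e]
  have "((\<lambda>s. \<psi> (pos (x s)) - eta (x s)) has_real_derivative deriv_on \<psi> (pos (x t)) w - e) (at t)" .
  from DERIV_chain2[OF alpha_deriv this]
  have "((\<lambda>s. gain (x s)) has_real_derivative dgain (x t) * (deriv_on \<psi> (pos (x t)) w - e)) (at t)"
    by (simp add: gain_def dgain_def)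
  then have a: "((\<lambda>s. lam j * gain (x s)) has_real_derivative lam j * (dgain (x t) * (deriv_on \<psi> (pos (x t)) w - e))) (at t)"
    by (rule DERIV_cmult)
  have "((\<lambda>s. Y j (pos (x s))) has_vector_derivative deriv_on (Y j) (pos (x t)) w) (at t)"
    by (rule deriv_on_along_curve[OF VF_smooth[OF Y_VF[OF j]], of "\<lambda>s. pos (x s)"]) (fact q)+
  from has_vector_derivative_scaleR[OF a this]
  have "((\<lambda>s. (lam j * gain (x s)) *\<^sub>R Y j (pos (x s))) has_vector_derivative
     (lam j * gain (x t)) *\<^sub>R deriv_on (Y j) (pos (x t)) w
     + (lam j * (dgain (x t) * (deriv_on \<psi> (pos (x t)) w - e))) *\<^sub>R Y j (pos (x t))) (at t)" .
  then show ?thesis using j by (simp add: osc_field_def d_osc_field_def algebra_simps)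
qed

text \<open>The coefficients are left general for two uses: constant in time for
  \<open>tangent_curve\<close>, and \<open>U j (om * s)\<close> for
  \<open>osc_vel_along_curve\<close>.\<close>

lemma weighted_sum_along_curve:
  assumes q: "pos (x t) \<in> Q" "\<forall>\<^sub>F s in nhds t. pos (x s) \<in> Q"
    "((\<lambda>s. pos (x s)) has_vector_derivative w) (at t)" and e: "((\<lambda>s. eta (x s)) has_real_derivative e) (at t)"
    and c: "\<And>j. j \<in> {1..n} \<Longrightarrow> (c j has_real_derivative c' j) (at t)"
  shows "((\<lambda>s. \<Sum>j=1..n. c j s *\<^sub>R osc_field j (x s)) has_vector_derivative
    (\<Sum>j=1..n. c j t *\<^sub>R (d_osc_field j (x t) w - (lam j * dgain (x t) * e) *\<^sub>R Y j (pos (x t)))) + (\<Sum>j=1..n. c' j *\<^sub>R osc_field j (x t))) (at t)"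
  unfolding sum.distrib[symmetric]
  by (intro has_vector_derivative_sum has_vector_derivative_scaleR c osc_field_along_curve q e)

text \<open>The phase \<open>t\<close> is frozen. Over a curve in \<open>Q\<close> with velocity
  \<open>v\<close>, the line v + s g is projected back onto the tangent spaces, which contributes
  \<open>proj_deriv\<close>; then the oscillating velocity along the curve is subtracted, which
  contributes the sum in \<open>acc\<close>.\<close>

lemma tangent_curve:
  assumes x: "x \<in> M"
  shows "\<exists>c. c 0 = x \<and> (\<forall>\<^sub>F s in nhds 0. c s \<in> M) \<and>
    (c has_vector_derivative ((vel t x, acc t x), eta_rate x)) (at (0::real))"
proof -
  define q where "q = pos x"
  define v where "v = vel t x"
  have q: "q \<in> Q" using x by (simp add: q_def state_space_iff)
  have vT: "v \<in> TS q" using vel_tangent[OF x] by (simp add: v_def q_def)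
  then obtain cq where "smooth_curve_through Q q v cq" unfolding tangent_space_def by blast
  note cq = smooth_curve_throughD[OF this]
  \<comment> \<open>The part of \<open>acc\<close> that is tangent to \<open>Q\<close> and does not
    come from differentiating the oscillating fields; being tangent, it survives the projection in
    \<open>Vc\<close>.\<close>
  define g where "g = drift x - R q v - christoffel q v v"
  have gT: "g \<in> TS q"
    unfolding g_def drift_def q_def[symmetric]
    using q vT by (intro subspace_diff subspace_add subspace_sum subspace_scale subspace_tangent
      christoffel_in R_tangent VF_tangent[OF Y]) auto
  define Vc where "Vc s = P (cq s) (v + s *\<^sub>R g)" for s
  have "((\<lambda>s. v + s *\<^sub>R g) has_vector_derivative g) (at 0)"
    by (auto intro!: derivative_eq_intros)
  from proj_deriv_along_curve[OF _ cq(2,3) this]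
  have Vc: "(Vc has_vector_derivative g + proj_deriv q v v) (at 0)"
    using q cq(1) tangent_proj_id[OF q gT] by (simp add: Vc_def[abs_def])
  define e where "e s = eta x + s * eta_rate x" for s
  have e: "(e has_real_derivative eta_rate x) (at 0)"
    unfolding e_def[abs_def] by (auto intro!: derivative_eq_intros)
  \<comment> \<open>The velocity slot can be filled with 0, since \<open>osc_field j\<close> for j
    \<ge> 1 depends only on position and \<open>eta\<close>.\<close>
  define y where "y s = ((cq s, 0 :: 'a), e s)" for s
  have y0: "pos (y 0) = pos x" "eta (y 0) = eta x" by (simp_all add: y_def cq(1) e_def q_def)
  define Wc where "Wc s = (\<Sum>j=1..n. U j t *\<^sub>R osc_field j (y s))" for s
  have "(Wc has_vector_derivative (\<Sum>j=1..n. U j t *\<^sub>R (d_osc_field j (y 0) v - (lam j * dgain (y 0) * eta_rate x) *\<^sub>R Y j (pos (y 0))))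
      + (\<Sum>j=1..n. 0 *\<^sub>R osc_field j (y 0))) (at 0)"
    unfolding Wc_def[abs_def]
    by (rule weighted_sum_along_curve) (use q cq e in \<open>auto simp: y_def\<close>)
  then have Wc: "(Wc has_vector_derivative (\<Sum>j=1..n. U j t *\<^sub>R (d_osc_field j x v - (lam j * dgain x * eta_rate x) *\<^sub>R Y j q))) (at 0)"
    using y0 d_osc_field_cong[OF y0] dgain_cong[OF y0] by (simp add: q_def)
  define c where "c s = ((cq s, Vc s - Wc s), e s)" for s
  have "c 0 = x"
  proof -
    have "Vc 0 = v" using tangent_proj_id[OF q vT] by (simp add: Vc_def cq(1))
    moreover have "Wc 0 = osc_vel t x" using osc_vel_cong[OF y0] by (simp add: Wc_def osc_vel_def)
    ultimately have "c 0 = ((pos x, tvel x), eta x)"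
      by (simp add: c_def cq(1) e_def v_def vel_def q_def)
    then show ?thesis using state_sel[of x] by simp
  qed
  moreover have "\<forall>\<^sub>F s in nhds 0. c s \<in> M"
    using cq(2)
  proof eventually_elim
    case (elim s)
    have "Wc s \<in> TS (cq s)"
      unfolding Wc_def
    proof (intro subspace_sum subspace_scale subspace_tangent elim)
      fix j assume j: "j \<in> {1..n}"
      then show "osc_field j (y s) \<in> TS (cq s)"
        using subspace_scale[OF subspace_tangent[OF elim] VF_tangent[OF Y_VF[OF j] elim]]
        by (auto simp: osc_field_def y_def)
    qed
    then show ?case
      using elim subspace_diff[OF subspace_tangent[OF elim] tangent_proj_in[OF elim]]
      by (auto simp: state_space_iff c_def Vc_def)
  qed
  moreover have "(c has_vector_derivative ((v, g + proj_deriv q v v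
      - (\<Sum>j=1..n. U j t *\<^sub>R (d_osc_field j x v - (lam j * dgain x * eta_rate x) *\<^sub>R Y j q))), eta_rate x)) (at 0)"
    unfolding c_def[abs_def]
    using e by (intro has_vector_derivative_Pair cq(3) has_vector_derivative_diff Vc Wc)
      (simp add: has_real_derivative_iff_has_vector_derivative)
  ultimately show ?thesis
    by (intro exI[of _ c]) (simp add: acc_def g_def v_def[symmetric] q_def[symmetric])
qed

lemma closed_M: "closed M"
  unfolding state_space_def by (intro closed_Times closed_tangent_bundle closed_UNIV)

lemma oscillating: "oscillating_system M modes mode mode_prim mode_avg mode_field"
proof
  show "closed M" by (rule closed_M)
  show "finite modes" by (simp add: modes_def)
  fix ij assume ij: "ij \<in> modes"
  show "locally_lipschitz_on M (mode_field ij)" by (rule lip_mode_field[OF ij])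
  show "continuous_on UNIV (mode ij)" by (rule mode_cont[OF ij])
  then show "bounded (range (mode ij))" by (rule periodic_continuous_bounded[of "mode ij" T, OF _ mode_periodic[OF ij] T])
  show "(mode_prim ij has_real_derivative mode ij t - mode_avg ij) (at t)" for t by (rule mode_prim(1)[OF ij])
  show "bounded (range (mode_prim ij))" by (rule mode_prim(2)[OF ij])
next
  fix \<tau> x assume "x \<in> M"
  then show "\<exists>c. c 0 = x \<and> (\<forall>\<^sub>F s in nhds 0. c s \<in> M) \<and> (c has_vector_derivative (\<Sum>ij\<in>modes. mode ij \<tau> *\<^sub>R mode_field ij x)) (at 0)"
    using tangent_curve sum_mode_field by simp
qed

end

sublocale control_system \<subseteq> oscillating_system "state_space Q" modes mode mode_prim mode_avg mode_field
  by (rule oscillating)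

context control_system
begin

lemma rhs_eq: "x \<in> M \<Longrightarrow> rhs t x = ((vel t x, acc t x), eta_rate x)"
  unfolding rhs_def by (rule sum_mode_field)

subsection \<open>The averaged system\<close>

lemma deriv_on_split:
  assumes E: "E \<in> VF" and q: "q \<in> Q" and w: "w \<in> TS q"
  shows "deriv_on E q w = P q (deriv_on E q w) + proj_deriv q w (E q)"
proof -
  obtain c where "smooth_curve_through Q q w c" using w unfolding tangent_space_def by blast
  note c = smooth_curve_throughD[OF this]
  have "((\<lambda>s. E (c s)) has_vector_derivative deriv_on E q w) (at 0)"
    using deriv_on_along_curve[OF VF_smooth[OF E], of c 0 w] c q by simp
  moreover have "\<forall>\<^sub>F s in nhds 0. c s \<in> Q \<and> E (c s) \<in> TS (c s)"
    using c(2) by eventually_elim (use VF_tangent[OF E] in auto)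
  ultimately show ?thesis
    using tangent_field_derivative[of c 0 "\<lambda>s. E (c s)" w "deriv_on E q w"] c q by simp
qed

text \<open>The derivative of \<open>Y i\<close> along itself splits into a tangential and a normal
  part. The normal part cancels against \<open>proj_deriv\<close>; the tangential part and the
  Christoffel term together are \<open>nabla\<close>. The \<alpha>\<alpha>' term comes from
  differentiating the gain.\<close>

lemma mode_acc_diag:
  assumes x: "x \<in> M" and i: "i \<in> {1..n}"
  shows "mode_acc i i x = - ((lam i * gain x)\<^sup>2 *\<^sub>R nabla (Y i) (Y i) (pos x))
     - ((lam i)\<^sup>2 * gain x * dgain x * lie_derivative Q (Y i) \<psi> (pos x)) *\<^sub>R Y i (pos x)"
proof -
  define q where "q = pos x"
  define y where "y = Y i q"
  define b where "b = lam i * gain x"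
  have q: "q \<in> Q" using x by (simp add: q_def state_space_iff)
  have yT: "y \<in> TS q" unfolding y_def by (rule VF_tangent[OF Y_VF[OF i] q])
  have osc_field: "osc_field i x = b *\<^sub>R y" using i by (simp add: osc_field_def b_def y_def q_def)
  have lie: "lie_derivative Q (Y i) \<psi> q = deriv_on \<psi> q y"
    unfolding y_def by (rule lie_derivative_eq[where X="Y i", OF \<psi> q yT[unfolded y_def]])
  have nab: "nabla (Y i) (Y i) q = christoffel q y y + P q (deriv_on (Y i) q y)"
    unfolding y_def by (rule nabla_eq[OF Y_VF[OF i] Y_VF[OF i] q])
  have split: "deriv_on (Y i) q y = P q (deriv_on (Y i) q y) + proj_deriv q y y"
    using deriv_on_split[OF Y_VF[OF i] q yT] by (simp add: y_def)
  have chr: "christoffel q (b *\<^sub>R y) (b *\<^sub>R y) = (b * b) *\<^sub>R christoffel q y y"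
    using linear_scale[OF linear_christoffel] linear_scale[OF linear_christoffel_left] by simp
  have pd: "proj_deriv q (b *\<^sub>R y) (b *\<^sub>R y) = (b * b) *\<^sub>R proj_deriv q y y"
    using linear_scale[OF linear_proj_deriv] linear_scale[OF linear_proj_deriv_left[OF q]] by simp
  have dz: "d_osc_field i x (b *\<^sub>R y) = (lam i * dgain x * (b * deriv_on \<psi> q y)) *\<^sub>R y + (b * b) *\<^sub>R deriv_on (Y i) q y"
    unfolding d_osc_field_def q_def[symmetric] y_def[symmetric] b_def[symmetric]
    using linear_scale[OF linear_deriv_on[OF \<psi> q]] linear_scale[OF linear_deriv_on[OF VF_smooth[OF Y_VF[OF i]] q]]
    by simp
  have "mode_acc i i x = - ((b * b) *\<^sub>R christoffel q y y) + (b * b) *\<^sub>R proj_deriv q y y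
     - ((lam i * dgain x * (b * deriv_on \<psi> q y)) *\<^sub>R y + (b * b) *\<^sub>R deriv_on (Y i) q y)"
    unfolding mode_acc_def q_def[symmetric] osc_field chr pd dz using i by simp
  also have "(b * b) *\<^sub>R deriv_on (Y i) q y = (b * b) *\<^sub>R P q (deriv_on (Y i) q y) + (b * b) *\<^sub>R proj_deriv q y y"
    by (subst split) (simp add: scaleR_add_right)
  finally show ?thesis
    unfolding q_def[symmetric] lie nab y_def[symmetric] b_def[symmetric]
    by (simp add: power2_eq_square scaleR_add_right b_def mult_ac)
qed

text \<open>Only diagonal modes survive averaging. Mode (0, 0) carries drift, damping and the
  conversion to ambient derivatives; the others are given by \<open>mode_acc_diag\<close>, where the
  factor 1/2 meets \<open>symmetric_product\<close> of a field with itself, which is twice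
  \<open>nabla\<close>.\<close>

lemma avg_eq:
  assumes x: "x \<in> M"
  shows "avg x = ((tvel x, av_acceleration Q nabla n Y R \<psi> \<alpha> lam mu x
      - christoffel (pos x) (tvel x) (tvel x) + proj_deriv (pos x) (tvel x) (tvel x)), eta_rate x)"
proof -
  have "avg x = (\<Sum>i\<le>n. \<Sum>j\<le>n. mode_avg (i, j) *\<^sub>R mode_field (i, j) x)"
    unfolding avg_def by (simp add: modes_def sum.cartesian_product)
  also have "\<dots> = (\<Sum>i\<le>n. mode_field (i, i) x)"
  proof (rule sum.cong)
    fix i assume "i \<in> {..n}"
    then have "(\<Sum>j\<le>n. mode_avg (i, j) *\<^sub>R mode_field (i, j) x) = (\<Sum>j\<le>n. if j = i then mode_field (i, j) x else 0)"
      by (intro sum.cong) (auto simp: mode_avg_def)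
    also have "\<dots> = mode_field (i, i) x" using \<open>i \<in> {..n}\<close> by simp
    finally show "(\<Sum>j\<le>n. mode_avg (i, j) *\<^sub>R mode_field (i, j) x) = mode_field (i, i) x" .
  qed simp
  finally have avg: "avg x = mode_field (0, 0) x + (\<Sum>i=1..n. mode_field (i, i) x)" by (simp only: sum_split0)
  have mode_field: "(\<Sum>i=1..n. mode_field (i, i) x) = ((0, \<Sum>i=1..n. mode_acc i i x), 0)"
  proof -
    have "(\<Sum>i=1..n. mode_field (i, i) x) = (\<Sum>i=1..n. ((0, mode_acc i i x), 0))"
      by (intro sum.cong) (auto simp: mode_field_def)
    then show ?thesis by (simp add: prod_eq_iff fst_sum snd_sum)
  qed
  have "(\<Sum>i=1..n. mode_acc i i x) = (\<Sum>i=1..n. - ((lam i * gain x)\<^sup>2 *\<^sub>R nabla (Y i) (Y i) (pos x))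
     - ((lam i)\<^sup>2 * gain x * dgain x * lie_derivative Q (Y i) \<psi> (pos x)) *\<^sub>R Y i (pos x))"
    by (intro sum.cong refl mode_acc_diag[OF x])
  also have "\<dots> = - ((gain x)\<^sup>2 *\<^sub>R (\<Sum>i=1..n. (lam i)\<^sup>2 *\<^sub>R nabla (Y i) (Y i) (pos x)))
     - (gain x * dgain x) *\<^sub>R (\<Sum>i=1..n. ((lam i)\<^sup>2 * lie_derivative Q (Y i) \<psi> (pos x)) *\<^sub>R Y i (pos x))"
    unfolding sum_subtractf sum_negf scaleR_sum_right by (simp add: power_mult_distrib mult_ac)
  finally have sumF: "(\<Sum>i=1..n. mode_acc i i x) = \<dots>" .
  have half: "(1 / 2 * (gain x)\<^sup>2) *\<^sub>R (\<Sum>i=1..n. (lam i)\<^sup>2 *\<^sub>R symmetric_product nabla (Y i) (Y i) (pos x))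
     = (gain x)\<^sup>2 *\<^sub>R (\<Sum>i=1..n. (lam i)\<^sup>2 *\<^sub>R nabla (Y i) (Y i) (pos x))"
    unfolding symmetric_product_def scaleR_sum_right
    by (intro sum.cong refl) (simp flip: scaleR_2)
  have av: "av_acceleration Q nabla n Y R \<psi> \<alpha> lam mu x = drift x - R (pos x) (tvel x) + (\<Sum>i=1..n. mode_acc i i x)"
  proof -
    obtain q v e where xe: "x = ((q, v), e)" by (metis prod.collapse)
    have "(\<Sum>i=1..n. (mu i * (gain x)\<^sup>2) *\<^sub>R Y i q) = (gain x)\<^sup>2 *\<^sub>R (\<Sum>i=1..n. mu i *\<^sub>R Y i q)"
      by (simp add: scaleR_sum_right mult.commute)
    then show ?thesis
      unfolding sumF half[symmetric] drift_def unfolding gain_def dgain_def xe by simp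
  qed
  show ?thesis
    unfolding avg mode_field av by (simp add: mode_field_def mode_acc_def osc_field_def)
qed

lemma averaged_solution:
  assumes J: "open J" and x: "classical_solution Q nabla h \<psi> (\<lambda>t. av_acceleration Q nabla n Y R \<psi> \<alpha> lam mu) J x"
  shows "solution_on M (\<lambda>_. avg) J x"
  unfolding solution_on_def
proof
  fix t assume t: "t \<in> J"
  have xM: "x s \<in> M" if "s \<in> J" for s using x that by (auto simp: classical_solution_def)
  have sol: "((\<lambda>s. pos (x s)) has_vector_derivative tvel (x t)) (at t)"
    "has_covariant_derivative Q nabla (\<lambda>s. pos (x s)) (\<lambda>s. tvel (x s)) (av_acceleration Q nabla n Y R \<psi> \<alpha> lam mu (x t)) t"
    "((\<lambda>s. eta (x s)) has_real_derivative eta_rate (x t)) (at t)"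
    using x t by (auto simp: classical_solution_def solves_at_def Let_def pos_def[symmetric] tvel_def[symmetric] eta_def[symmetric] eta_rate_def)
  have ev: "\<forall>\<^sub>F s in nhds t. s \<in> J" using J t eventually_nhds by blast
  have ev2: "\<forall>\<^sub>F s in nhds t. pos (x s) \<in> Q \<and> tvel (x s) \<in> TS (pos (x s))"
    using ev by eventually_elim (use xM state_space_iff in auto)
  have "((\<lambda>s. tvel (x s)) has_vector_derivative av_acceleration Q nabla n Y R \<psi> \<alpha> lam mu (x t)
      - christoffel (pos (x t)) (tvel (x t)) (tvel (x t)) + proj_deriv (pos (x t)) (tvel (x t)) (tvel (x t))) (at t)"
    using has_covariant_derivativeD[OF _ ev2 sol(1,2)] xM[OF t] by (simp add: state_space_iff)
  from has_vector_derivative_Pair[OF has_vector_derivative_Pair[OF sol(1) this]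
      sol(3)[unfolded has_real_derivative_iff_has_vector_derivative]]
  show "x t \<in> M \<and> (x has_vector_derivative avg (x t)) (at t)"
    using xM[OF t] by (simp add: avg_eq state_sel[symmetric])
qed

subsection \<open>The closed-loop system in the new variables\<close>

abbreviation "new_vars \<equiv> change_of_variables n Y \<psi> \<alpha> U lam"
abbreviation "cl \<equiv> cl_acceleration n Y R \<psi> \<alpha> u lam mu"

text \<open>The inverse of \<open>new_vars\<close>. It is explicit because \<open>osc_vel\<close>
  depends only on position and \<open>eta\<close>, which neither map changes.\<close>

definition old_vars :: "real \<Rightarrow> real \<Rightarrow> ('a \<times> 'a) \<times> real \<Rightarrow> ('a \<times> 'a) \<times> real" where
  "old_vars om t x = ((pos x, vel (om * t) x), eta x)"

lemma new_vars_eq: "new_vars om t x = ((pos x, tvel x - osc_vel (om * t) x), eta x)"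
proof -
  obtain q v e where xe: "x = ((q, v), e)" by (metis prod.collapse)
  have "osc_vel (om * t) x = (\<Sum>i=1..n. (U i (om * t) * lam i * \<alpha> (\<psi> q - e)) *\<^sub>R Y i q)"
    unfolding osc_vel_def by (intro sum.cong) (auto simp: osc_field_def gain_def xe)
  then show ?thesis by (simp add: xe)
qed

lemma new_vars_sel: "pos (new_vars om t x) = pos x" "eta (new_vars om t x) = eta x" "tvel (new_vars om t x) = tvel x - osc_vel (om * t) x"
  by (simp_all add: new_vars_eq)

lemma old_vars_sel: "pos (old_vars om t x) = pos x" "eta (old_vars om t x) = eta x" "tvel (old_vars om t x) = vel (om * t) x"
  by (simp_all add: old_vars_def)

lemma vel_new_vars: "vel (om * t) (new_vars om t x) = tvel x"
  using osc_vel_cong[OF new_vars_sel(1,2)] by (simp add: vel_def new_vars_sel)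

lemma new_vars_in: "x \<in> M \<Longrightarrow> new_vars om t x \<in> M"
  using osc_vel_tangent[of x "om * t"] subspace_diff[OF subspace_tangent]
  by (auto simp: state_space_iff new_vars_sel)

lemma old_vars_in: "x \<in> M \<Longrightarrow> old_vars om t x \<in> M"
  using vel_tangent[of x "om * t"] by (auto simp: state_space_iff old_vars_sel)

lemma new_vars_old_vars: "new_vars om t (old_vars om t x) = x"
  using osc_vel_cong[OF old_vars_sel(1,2)] state_sel[of x] by (simp add: new_vars_eq old_vars_sel vel_def)

lemma old_vars_new_vars: "old_vars om t (new_vars om t x) = x"
  using state_sel[of x] by (simp add: old_vars_def vel_new_vars new_vars_sel)

lemma cl_eq: "cl om t x = drift x - R (pos x) (tvel x) + (\<Sum>j=1..n. (om * u j (om * t)) *\<^sub>R osc_field j x)"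
proof -
  obtain q v e where xe: "x = ((q, v), e)" by (metis prod.collapse)
  have "(\<Sum>j=1..n. (om * u j (om * t)) *\<^sub>R osc_field j x) = (\<Sum>i=1..n. (om * u i (om * t) * lam i * \<alpha> (\<psi> q - e)) *\<^sub>R Y i q)"
    by (intro sum.cong) (auto simp: osc_field_def gain_def xe mult.assoc)
  then show ?thesis by (simp add: drift_def gain_def xe algebra_simps)
qed

text \<open>The second sum is the forcing term of \<open>cl_eq\<close>: this is the cancellation for
  which the change of variables is made. It takes place only at times where \<open>U\<close> has
  derivative \<open>u\<close>.\<close>

lemma osc_vel_along_curve:
  assumes q: "pos (x t) \<in> Q" "\<forall>\<^sub>F s in nhds t. pos (x s) \<in> Q"
    "((\<lambda>s. pos (x s)) has_vector_derivative w) (at t)" and e: "((\<lambda>s. eta (x s)) has_real_derivative e) (at t)"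
    and U: "\<And>j. j \<in> {1..n} \<Longrightarrow> (U j has_real_derivative u j (om * t)) (at (om * t))"
  shows "((\<lambda>s. osc_vel (om * s) (x s)) has_vector_derivative
    (\<Sum>j=1..n. U j (om * t) *\<^sub>R (d_osc_field j (x t) w - (lam j * dgain (x t) * e) *\<^sub>R Y j (pos (x t))))
      + (\<Sum>j=1..n. (om * u j (om * t)) *\<^sub>R osc_field j (x t))) (at t)"
  unfolding osc_vel_def
proof (rule weighted_sum_along_curve[OF q e])
  fix j assume j: "j \<in> {1..n}"
  have "((\<lambda>s. om * s) has_real_derivative om) (at t)" by (auto intro!: derivative_eq_intros)
  from DERIV_chain2[OF U[OF j] this]
  show "((\<lambda>s. U j (om * s)) has_real_derivative om * u j (om * t)) (at t)" by (simp add: mult.commute)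
qed

lemma acc_new_vars:
  "acc (om * t) (new_vars om t x) = drift x - R (pos x) (tvel x) - christoffel (pos x) (tvel x) (tvel x)
     + proj_deriv (pos x) (tvel x) (tvel x)
     - (\<Sum>j=1..n. U j (om * t) *\<^sub>R (d_osc_field j x (tvel x) - (lam j * dgain x * eta_rate x) *\<^sub>R Y j (pos x)))"
  unfolding acc_def vel_new_vars
  using drift_cong[OF new_vars_sel(1,2)] d_osc_field_cong[OF new_vars_sel(1,2)] dgain_cong[OF new_vars_sel(1,2)] eta_rate_cong[OF new_vars_sel(1,2)]
  by (simp add: new_vars_sel)

lemma solves_at_imp_derivative:
  assumes J: "open J" "t \<in> J" and xM: "\<And>s. s \<in> J \<Longrightarrow> x s \<in> M"
    and sol: "solves_at Q nabla h \<psi> (cl om) x t"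
    and U: "\<And>j. j \<in> {1..n} \<Longrightarrow> (U j has_real_derivative u j (om * t)) (at (om * t))"
  shows "((\<lambda>s. new_vars om s (x s)) has_vector_derivative rhs (om * t) (new_vars om t (x t))) (at t)"
proof -
  have sol: "((\<lambda>s. pos (x s)) has_vector_derivative tvel (x t)) (at t)"
    "has_covariant_derivative Q nabla (\<lambda>s. pos (x s)) (\<lambda>s. tvel (x s)) (cl om t (x t)) t"
    "((\<lambda>s. eta (x s)) has_real_derivative eta_rate (x t)) (at t)"
    using sol by (auto simp: solves_at_def Let_def pos_def[symmetric] tvel_def[symmetric] eta_def[symmetric] eta_rate_def)
  have ev: "\<forall>\<^sub>F s in nhds t. s \<in> J" using J eventually_nhds by blast
  have ev2: "\<forall>\<^sub>F s in nhds t. pos (x s) \<in> Q \<and> tvel (x s) \<in> TS (pos (x s))"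
    using ev by eventually_elim (use xM state_space_iff in auto)
  then have ev1: "\<forall>\<^sub>F s in nhds t. pos (x s) \<in> Q" by (rule eventually_mono) simp
  have q: "pos (x t) \<in> Q" using xM[OF J(2)] by (simp add: state_space_iff)
  have "((\<lambda>s. tvel (x s)) has_vector_derivative cl om t (x t)
      - christoffel (pos (x t)) (tvel (x t)) (tvel (x t)) + proj_deriv (pos (x t)) (tvel (x t)) (tvel (x t))) (at t)"
    by (rule has_covariant_derivativeD[OF q ev2 sol(1,2)])
  from has_vector_derivative_diff[OF this osc_vel_along_curve[OF q ev1 sol(1) sol(3) U]]
  have "((\<lambda>s. tvel (x s) - osc_vel (om * s) (x s)) has_vector_derivative acc (om * t) (new_vars om t (x t))) (at t)"
    unfolding cl_eq acc_new_vars by (simp add: algebra_simps)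
  from has_vector_derivative_Pair[OF has_vector_derivative_Pair[OF sol(1) this]
      sol(3)[unfolded has_real_derivative_iff_has_vector_derivative]]
  show ?thesis
    unfolding rhs_eq[OF new_vars_in[OF xM[OF J(2)]]] vel_new_vars
    using eta_rate_cong[OF new_vars_sel(1,2)] by (simp add: new_vars_eq)
qed

lemma derivative_imp_solves_at:
  assumes J: "open J" "t \<in> J" and xM: "\<And>s. s \<in> J \<Longrightarrow> x s \<in> M"
    and der: "((\<lambda>s. new_vars om s (x s)) has_vector_derivative rhs (om * t) (new_vars om t (x t))) (at t)"
    and U: "\<And>j. j \<in> {1..n} \<Longrightarrow> (U j has_real_derivative u j (om * t)) (at (om * t))"
  shows "solves_at Q nabla h \<psi> (cl om) x t"
proof -
  have q: "pos (x t) \<in> Q" using xM[OF J(2)] by (simp add: state_space_iff)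
  have ev: "\<forall>\<^sub>F s in nhds t. s \<in> J" using J eventually_nhds by blast
  have ev2: "\<forall>\<^sub>F s in nhds t. pos (x s) \<in> Q \<and> tvel (x s) \<in> TS (pos (x s))"
    using ev by eventually_elim (use xM state_space_iff in auto)
  then have ev1: "\<forall>\<^sub>F s in nhds t. pos (x s) \<in> Q" by (rule eventually_mono) simp
  have r: "rhs (om * t) (new_vars om t (x t)) = ((tvel (x t), acc (om * t) (new_vars om t (x t))), eta_rate (x t))"
    using rhs_eq[OF new_vars_in[OF xM[OF J(2)]]] vel_new_vars eta_rate_cong[OF new_vars_sel(1,2)] by simp
  note der = der[unfolded r]
  have d1: "((\<lambda>s. pos (x s)) has_vector_derivative tvel (x t)) (at t)"
    using bounded_linear.has_vector_derivative[OF bounded_linear_compose[OF bounded_linear_fst bounded_linear_fst] der]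
    by (simp add: new_vars_eq)
  have d2: "((\<lambda>s. tvel (x s) - osc_vel (om * s) (x s)) has_vector_derivative acc (om * t) (new_vars om t (x t))) (at t)"
    using bounded_linear.has_vector_derivative[OF bounded_linear_compose[OF bounded_linear_snd bounded_linear_fst] der]
    by (simp add: new_vars_eq)
  have d3: "((\<lambda>s. eta (x s)) has_real_derivative eta_rate (x t)) (at t)"
    using bounded_linear.has_vector_derivative[OF bounded_linear_snd der]
    by (simp add: has_real_derivative_iff_has_vector_derivative new_vars_eq)
  define V' where "V' = cl om t (x t) - christoffel (pos (x t)) (tvel (x t)) (tvel (x t)) + proj_deriv (pos (x t)) (tvel (x t)) (tvel (x t))"
  have V': "((\<lambda>s. tvel (x s)) has_vector_derivative V') (at t)"
    using has_vector_derivative_add[OF d2 osc_vel_along_curve[OF q ev1 d1 d3 U]]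
    unfolding V'_def cl_eq acc_new_vars by (simp add: algebra_simps)
  \<comment> \<open>\<open>V'\<close> was written down from the acceleration of the closed loop.
    Since its normal part has to be \<open>proj_deriv\<close>, what remains is that P V' plus the
    Christoffel term is this acceleration.\<close>
  have "V' = P (pos (x t)) V' + proj_deriv (pos (x t)) (tvel (x t)) (tvel (x t))"
    by (rule tangent_field_derivative[OF q ev2 d1 V'])
  then have "P (pos (x t)) V' + christoffel (pos (x t)) (tvel (x t)) (tvel (x t)) = cl om t (x t)"
    by (simp add: V'_def algebra_simps)
  then have "has_covariant_derivative Q nabla (\<lambda>s. pos (x s)) (\<lambda>s. tvel (x s)) (cl om t (x t)) t"
    using has_covariant_derivativeI[OF q ev2 d1 V'] by simp
  then show ?thesis
    using d1 d3 by (simp add: solves_at_def Let_def pos_def[symmetric] tvel_def[symmetric] eta_def[symmetric] eta_rate_def)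
qed

lemma lip_U: "j \<in> {1..n} \<Longrightarrow> locally_lipschitz_on X (U j)"
  using U_lipschitz[of j] lipschitz_on_subset[of _ UNIV "U j"] unfolding locally_lipschitz_on_def
  by (metis subset_UNIV zero_less_one)

lemma lip_osc_vel: "locally_lipschitz_on (UNIV \<times> M) (\<lambda>z. osc_vel (om * fst z) (snd z))"
proof -
  have f: "locally_lipschitz_on (UNIV \<times> M) (\<lambda>z. om * fst z)"
    by (intro bounded_linear_locally_lipschitz bounded_linear_compose[OF bounded_linear_mult_right bounded_linear_fst])
  have s: "locally_lipschitz_on (UNIV \<times> M) (snd :: real \<times> (('a \<times> 'a) \<times> real) \<Rightarrow> _)"
    by (intro bounded_linear_locally_lipschitz bounded_linear_snd)
  show ?thesis
    unfolding osc_vel_def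
  proof (intro locally_lipschitz_on_sum locally_lipschitz_on_scaleR finite_atLeastAtMost)
    fix j assume j: "j \<in> {1..n}"
    show "locally_lipschitz_on (UNIV \<times> M) (\<lambda>z. U j (om * fst z))"
      by (rule locally_lipschitz_on_compose[OF f lip_U[OF j, of UNIV]]) simp
    show "locally_lipschitz_on (UNIV \<times> M) (\<lambda>z :: real \<times> _. osc_field j (snd z))"
      using locally_lipschitz_on_compose[OF s lip_osc_field[of j]] j by auto
  qed
qed

text \<open>Lipschitz continuity jointly in time and state is what lets absolute continuity pass
  between a curve and its image in the other variables.\<close>

lemma lip_new_vars: "locally_lipschitz_on (UNIV \<times> M) (\<lambda>z. new_vars om (fst z) (snd z))"
  and lip_old_vars: "locally_lipschitz_on (UNIV \<times> M) (\<lambda>z. old_vars om (fst z) (snd z))"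
proof -
  have s: "locally_lipschitz_on (UNIV \<times> M) (snd :: real \<times> (('a \<times> 'a) \<times> real) \<Rightarrow> _)"
    by (intro bounded_linear_locally_lipschitz bounded_linear_snd)
  have sM: "snd ` (UNIV \<times> M) \<subseteq> M" by auto
  note c = locally_lipschitz_on_compose[OF s lip_pos sM] locally_lipschitz_on_compose[OF s lip_tvel sM]
    locally_lipschitz_on_compose[OF s lip_eta sM]
  show "locally_lipschitz_on (UNIV \<times> M) (\<lambda>z. new_vars om (fst z) (snd z))"
    unfolding new_vars_eq by (intro locally_lipschitz_on_Pair locally_lipschitz_on_diff c lip_osc_vel)
  show "locally_lipschitz_on (UNIV \<times> M) (\<lambda>z. old_vars om (fst z) (snd z))"
    unfolding old_vars_def vel_def by (intro locally_lipschitz_on_Pair locally_lipschitz_on_add c lip_osc_vel)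
qed

lemma U_deriv_AE:
  assumes "om \<noteq> 0"
  shows "AE t in lebesgue. \<forall>j\<in>{1..n}. (U j has_real_derivative u j (om * t)) (at (om * t))"
proof (rule AE_finite_allI)
  fix j assume "j \<in> {1..n}"
  then show "AE t in lebesgue. (U j has_real_derivative u j (om * t)) (at (om * t))"
    by (intro AE_lebesgue_scale[OF indefinite_integral_has_derivative_AE assms] U_integral)
qed simp

lemma rhs_continuous_along:
  assumes "continuous_on X y" "\<And>t. t \<in> X \<Longrightarrow> y t \<in> M"
  shows "continuous_on X (\<lambda>t. rhs (om * t) (y t))"
  unfolding rhs_def
proof (intro continuous_intros)
  fix ij assume ij: "ij \<in> modes"
  show "continuous_on X (\<lambda>t. mode ij (om * t))"
    by (rule continuous_on_compose2[OF mode_cont[OF ij]]) (auto intro: continuous_intros)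
  show "continuous_on X (\<lambda>t. mode_field ij (y t))"
    by (rule continuous_on_compose2[OF locally_lipschitz_on_continuous[OF lip_mode_field[OF ij]] assms(1)])
      (use assms in auto)
qed

text \<open>In the new variables only \<open>U\<close> enters, so the right-hand side is continuous
  along the curve and an absolutely continuous almost everywhere solution is differentiable at every
  time. Conversely, the original equation is recovered at the times where \<open>U\<close> has
  derivative \<open>u\<close>, that is almost everywhere.\<close>

theorem caratheodory_iff:
  assumes om: "om > 0" and J: "open J" "is_interval J"
  shows "caratheodory_solution Q nabla h \<psi> (cl om) J x \<longleftrightarrow>
    (\<forall>t\<in>J. x t \<in> M) \<and> solution_on M (\<lambda>t. rhs (om * t)) J (\<lambda>t. new_vars om t (x t))" (is "?L \<longleftrightarrow> ?R")
proof
  have om0: "om \<noteq> 0" using om by simp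
  assume L: ?L
  then have xM: "\<And>t. t \<in> J \<Longrightarrow> x t \<in> M" and ac: "\<And>a b. {a..b} \<subseteq> J \<Longrightarrow> abs_cont_on_interval a b x"
    and ae: "AE t in lebesgue. t \<in> J \<longrightarrow> solves_at Q nabla h \<psi> (cl om) x t"
    by (auto simp: caratheodory_solution_def)
  define y where "y t = new_vars om t (x t)" for t
  have yM: "y t \<in> M" if "t \<in> J" for t using xM[OF that] new_vars_in by (simp add: y_def)
  have acy: "abs_cont_on_interval a b y" if "{a..b} \<subseteq> J" for a b
  proof -
    have "x t \<in> M" if "t \<in> {a..b}" for t using that \<open>{a..b} \<subseteq> J\<close> xM by blast
    from abs_cont_locally_lipschitz[OF ac[OF that] this lip_new_vars, of om]
    show ?thesis by (simp add: y_def[abs_def])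
  qed
  have yc: "continuous_on J y"
  proof (rule continuous_at_imp_continuous_on, rule ballI)
    fix t assume "t \<in> J"
    then obtain r where r: "r > 0" "cball t r \<subseteq> J" using J(1) open_contains_cball by blast
    then have "continuous_on {t - r..t + r} y" by (intro abs_cont_continuous acy) (simp add: cball_eq_atLeastAtMost)
    then show "isCont y t" using r(1) by (intro continuous_on_interior[of "{t - r..t + r}"]) auto
  qed
  have ae': "AE t in lebesgue. t \<in> J \<longrightarrow> (y has_vector_derivative rhs (om * t) (y t)) (at t)"
    using ae U_deriv_AE[OF om0]
  proof eventually_elim
    case (elim t)
    then show ?case
      using solves_at_imp_derivative[OF J(1) _ xM, where t=t and om=om] unfolding y_def[abs_def] by auto
  qed
  have "(y has_vector_derivative rhs (om * t) (y t)) (at t)" if "t \<in> J" for t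
    by (rule abs_cont_imp_has_vector_derivative[OF J acy ae'])
      (use that rhs_continuous_along[OF yc yM] in auto)
  then have "solution_on M (\<lambda>t. rhs (om * t)) J y" using yM by (simp add: solution_on_def)
  then show ?R using xM by (simp add: y_def[abs_def])
next
  have om0: "om \<noteq> 0" using om by simp
  assume ?R
  then have xM: "\<And>t. t \<in> J \<Longrightarrow> x t \<in> M" and y: "solution_on M (\<lambda>t. rhs (om * t)) J (\<lambda>t. new_vars om t (x t))" by auto
  define y where "y t = new_vars om t (x t)" for t
  have yM: "\<And>t. t \<in> J \<Longrightarrow> y t \<in> M" and yd: "\<And>t. t \<in> J \<Longrightarrow> (y has_vector_derivative rhs (om * t) (y t)) (at t)"
    using y unfolding solution_on_def y_def[abs_def] by auto
  have yc: "continuous_on J y"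
    using yd by (meson continuous_at_imp_continuous_on has_vector_derivative_continuous)
  have "abs_cont_on_interval a b x" if ab: "{a..b} \<subseteq> J" for a b
  proof -
    have "abs_cont_on_interval a b y"
      by (rule abs_cont_of_bounded_derivative[of _ _ _ "\<lambda>t. rhs (om * t) (y t)"])
        (use ab yd yM in \<open>auto intro!: rhs_continuous_along continuous_on_subset[OF yc]\<close>)
    moreover have "y t \<in> M" if "t \<in> {a..b}" for t using that ab yM by blast
    ultimately show ?thesis
      using abs_cont_locally_lipschitz[of a b y M "\<lambda>z. old_vars om (fst z) (snd z)"] lip_old_vars
      by (simp add: y_def old_vars_new_vars)
  qed
  moreover have "AE t in lebesgue. t \<in> J \<longrightarrow> solves_at Q nabla h \<psi> (cl om) x t"
    using U_deriv_AE[OF om0]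
  proof eventually_elim
    case (elim t)
    then show ?case
      using derivative_imp_solves_at[OF J(1) _ xM, where t=t and om=om] yd[of t] unfolding y_def[abs_def] by auto
  qed
  ultimately show ?L using xM unfolding caratheodory_solution_def by auto
qed

end

section \<open>Transfer of the stability notions\<close>

context control_system
begin

theorem practical_asymptotic_stability:
  assumes K: "compact K" "K \<noteq> {}" and S: "neighborhood_in M K S"
    and stable: "uniformly_asymptotically_stable M
       (classical_solution Q nabla h \<psi> (\<lambda>t. av_acceleration Q nabla n Y R \<psi> \<alpha> lam mu)) S K"
  shows "practically_uniformly_asymptotically_stable M
       (\<lambda>om. caratheodory_solution Q nabla h \<psi> (cl om)) new_vars S K"
proof -
  have SM: "S \<subseteq> M" using S by (simp add: neighborhood_in_def)
  \<comment> \<open>Compactness of \<open>K\<close> turns the topological neighbourhood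
    \<open>S\<close> into a metric one, as the averaging results expect.\<close>
  obtain r0 where r0: "r0 > 0" "\<forall>x\<in>M. infdist x K \<le> r0 \<longrightarrow> x \<in> S"
  proof -
    obtain N where N: "openin (top_of_set M) N" "K \<subseteq> N" "N \<subseteq> S" using S by (auto simp: neighborhood_in_def)
    then obtain O' where O': "open O'" "N = M \<inter> O'" by (auto simp: openin_open)
    obtain r where "r > 0" "{x. infdist x K \<le> r} \<subseteq> O'"
      using compact_in_open_separated[OF K(2,1) O'(1)] N O' by blast
    then show ?thesis using that[of r] N O' by blast
  qed
  have transfer: "\<exists>z. z t0 = x0 \<and> solution_on M (\<lambda>_. avg) {t0..} z \<and> Pr z"
    if "max_solution_satisfies (classical_solution Q nabla h \<psi> (\<lambda>t. av_acceleration Q nabla n Y R \<psi> \<alpha> lam mu)) t0 x0 Pr"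
    for t0 x0 Pr
  proof -
    from that obtain J x where x: "maximal_solution (classical_solution Q nabla h \<psi> (\<lambda>t. av_acceleration Q nabla n Y R \<psi> \<alpha> lam mu)) t0 x0 J x"
      "{t0..} \<subseteq> J" "Pr x" unfolding max_solution_satisfies_def by blast
    then have "solution_on M (\<lambda>_. avg) J x" "x t0 = x0"
      by (auto simp: maximal_solution_def intro: averaged_solution)
    then show ?thesis using x solution_on_subset by blast
  qed
  note st = stable[unfolded uniformly_asymptotically_stable_def]
  have H1: "\<forall>\<epsilon>>0. \<exists>\<delta>>0. \<forall>t0. \<forall>x0\<in>M. infdist x0 K \<le> \<delta> \<longrightarrow>
      (\<exists>z. z t0 = x0 \<and> solution_on M (\<lambda>_. avg) {t0..} z \<and> (\<forall>t\<ge>t0. infdist (z t) K \<le> \<epsilon>))"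
  proof (intro allI impI)
    fix \<epsilon> :: real assume "\<epsilon> > 0"
    from st[THEN conjunct1, THEN spec, THEN mp, OF \<open>\<epsilon> > 0\<close>] obtain \<delta> where "\<delta> > 0" and *: "\<forall>t0. \<forall>x0\<in>M. infdist x0 K \<le> \<delta> \<longrightarrow>
      max_solution_satisfies (classical_solution Q nabla h \<psi> (\<lambda>t. av_acceleration Q nabla n Y R \<psi> \<alpha> lam mu)) t0 x0
        (\<lambda>x. \<forall>t\<ge>t0. infdist (x t) K \<le> \<epsilon>)"
      by (elim exE conjE)
    show "\<exists>\<delta>>0. \<forall>t0. \<forall>x0\<in>M. infdist x0 K \<le> \<delta> \<longrightarrow>
      (\<exists>z. z t0 = x0 \<and> solution_on M (\<lambda>_. avg) {t0..} z \<and> (\<forall>t\<ge>t0. infdist (z t) K \<le> \<epsilon>))"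
      by (intro exI[of _ \<delta>] conjI allI ballI impI transfer *[rule_format] \<open>\<delta> > 0\<close>)
  qed
  have H2: "\<forall>r>0. \<forall>\<epsilon>>0. \<exists>\<Delta>>0. \<exists>\<rho>>0. \<forall>t0. \<forall>x0\<in>S. infdist x0 K \<le> r \<longrightarrow>
      (\<exists>z. z t0 = x0 \<and> solution_on M (\<lambda>_. avg) {t0..} z \<and> (\<forall>t\<ge>t0. infdist (z t) K \<le> \<rho>) \<and>
        (\<forall>t\<ge>t0 + \<Delta>. infdist (z t) K \<le> \<epsilon>))"
  proof (intro allI impI)
    fix r \<epsilon> :: real assume "r > 0" "\<epsilon> > 0"
    from st[THEN conjunct2, THEN spec, THEN mp, OF \<open>r > 0\<close>, THEN spec, THEN mp, OF \<open>\<epsilon> > 0\<close>]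
    obtain \<Delta> \<rho> where "\<Delta> > 0" "\<rho> > 0" and *: "\<forall>t0. \<forall>x0\<in>S. infdist x0 K \<le> r \<longrightarrow>
      max_solution_satisfies (classical_solution Q nabla h \<psi> (\<lambda>t. av_acceleration Q nabla n Y R \<psi> \<alpha> lam mu)) t0 x0
        (\<lambda>x. (\<forall>t\<ge>t0. infdist (x t) K \<le> \<rho>) \<and> (\<forall>t\<ge>t0 + \<Delta>. infdist (x t) K \<le> \<epsilon>))"
      by (elim exE conjE)
    show "\<exists>\<Delta>>0. \<exists>\<rho>>0. \<forall>t0. \<forall>x0\<in>S. infdist x0 K \<le> r \<longrightarrow>
      (\<exists>z. z t0 = x0 \<and> solution_on M (\<lambda>_. avg) {t0..} z \<and> (\<forall>t\<ge>t0. infdist (z t) K \<le> \<rho>) \<and>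
        (\<forall>t\<ge>t0 + \<Delta>. infdist (z t) K \<le> \<epsilon>))"
      by (intro exI[of _ \<Delta>] exI[of _ \<rho>] conjI allI ballI impI transfer *[rule_format] \<open>\<Delta> > 0\<close> \<open>\<rho> > 0\<close>)
  qed
  \<comment> \<open>\<open>new_vars\<close> maps \<open>M\<close> onto \<open>M\<close>, with
    preimages supplied by \<open>old_vars\<close>, so \<open>inv_into\<close> is a right
    inverse.\<close>
  have inv: "inv_into M (new_vars om t0) x0 \<in> M" "new_vars om t0 (inv_into M (new_vars om t0) x0) = x0" if "x0 \<in> M" for om t0 x0
  proof -
    have "x0 \<in> new_vars om t0 ` M" using that old_vars_in new_vars_old_vars by (metis imageI)
    then show "inv_into M (new_vars om t0) x0 \<in> M" "new_vars om t0 (inv_into M (new_vars om t0) x0) = x0"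
      by (auto intro: inv_into_into f_inv_into_f)
  qed
  have lift: "max_solution_satisfies (caratheodory_solution Q nabla h \<psi> (cl om)) t0 (inv_into M (new_vars om t0) x0)
       (\<lambda>x. \<forall>t\<ge>t0. Pr t (new_vars om t (x t)))"
    if "om > 0" "x0 \<in> M" "e > 0" "y t0 = x0" "solution_on M (\<lambda>t. rhs (om * t)) {t0 - e<..} y" "\<And>t. t \<ge> t0 \<Longrightarrow> Pr t (y t)"
    for om t0 x0 e y Pr
  proof (rule max_solution_satisfies_via[where M=M and g="\<lambda>t. rhs (om * t)" and \<xi>="old_vars om" and y=y and e=e])
    show "lipschitz_on_compacts M (\<lambda>t. rhs (om * t))" by (rule rhs_lipschitz_compact)
    show "caratheodory_solution Q nabla h \<psi> (cl om) J x \<longleftrightarrow>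
        (\<forall>t\<in>J. x t \<in> M) \<and> solution_on M (\<lambda>t. rhs (om * t)) J (\<lambda>t. new_vars om t (x t))"
      if "open J" "is_interval J" for J x
      by (rule caratheodory_iff[OF \<open>om > 0\<close> that])
  qed (use that inv in \<open>auto simp: new_vars_old_vars old_vars_new_vars old_vars_in\<close>)
  show ?thesis
    unfolding practically_uniformly_asymptotically_stable_def
  proof (intro conjI allI impI)
    fix \<epsilon> :: real assume "\<epsilon> > 0"
    from practical_stability[OF K(1,2) r0 H1 H2 this]
    obtain om0 \<delta> where 1: "om0 > 0" "\<delta> > 0" "\<forall>om\<ge>om0. \<forall>t0. \<forall>x0\<in>M. infdist x0 K \<le> \<delta> \<longrightarrow>
      (\<exists>e>0. \<exists>y. y t0 = x0 \<and> solution_on M (\<lambda>t. rhs (om * t)) {t0 - e<..} y \<and> (\<forall>t\<ge>t0. infdist (y t) K \<le> \<epsilon>))"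
      by (elim exE conjE)
    have "max_solution_satisfies (caratheodory_solution Q nabla h \<psi> (cl om)) t0 (inv_into M (new_vars om t0) x0)
        (\<lambda>x. \<forall>t\<ge>t0. infdist (new_vars om t (x t)) K \<le> \<epsilon>)"
      if asm: "om \<ge> om0" "x0 \<in> M" "infdist x0 K \<le> \<delta>" for om t0 x0
    proof -
      obtain e y where y: "e > 0" "y t0 = x0" "solution_on M (\<lambda>t. rhs (om * t)) {t0 - e<..} y"
        "\<forall>t\<ge>t0. infdist (y t) K \<le> \<epsilon>" using 1(3)[rule_format, OF asm] by blast
      show ?thesis
        by (rule lift[of om x0 e y t0 "\<lambda>t z. infdist z K \<le> \<epsilon>", OF _ that(2) y(1-3)]) (use that 1 y(4) in auto)
    qed
    then show "\<exists>om0>0. \<exists>\<delta>>0. \<forall>om\<ge>om0. \<forall>t0. \<forall>x0\<in>M. infdist x0 K \<le> \<delta> \<longrightarrow>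
      max_solution_satisfies (caratheodory_solution Q nabla h \<psi> (cl om)) t0 (inv_into M (new_vars om t0) x0)
        (\<lambda>x. \<forall>t\<ge>t0. infdist (new_vars om t (x t)) K \<le> \<epsilon>)"
      using 1 by (intro exI[of _ om0] exI[of _ \<delta>] conjI) auto
  next
    fix r \<epsilon> :: real assume "r > 0" "\<epsilon> > 0"
    from practical_attractivity[OF K(1,2) r0 SM H1 H2 this]
    obtain om0 \<Delta> \<rho> where 1: "om0 > 0" "\<Delta> > 0" "\<rho> > 0" "\<forall>om\<ge>om0. \<forall>t0. \<forall>x0\<in>S. infdist x0 K \<le> r \<longrightarrow>
      (\<exists>e>0. \<exists>y. y t0 = x0 \<and> solution_on M (\<lambda>t. rhs (om * t)) {t0 - e<..} y \<and>
        (\<forall>t\<ge>t0. infdist (y t) K \<le> \<rho>) \<and> (\<forall>t\<ge>t0 + \<Delta>. infdist (y t) K \<le> \<epsilon>))"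
      by (elim exE conjE)
    have "max_solution_satisfies (caratheodory_solution Q nabla h \<psi> (cl om)) t0 (inv_into M (new_vars om t0) x0)
        (\<lambda>x. (\<forall>t\<ge>t0. infdist (new_vars om t (x t)) K \<le> \<rho>) \<and> (\<forall>t\<ge>t0 + \<Delta>. infdist (new_vars om t (x t)) K \<le> \<epsilon>))"
      if asm: "om \<ge> om0" "x0 \<in> S" "infdist x0 K \<le> r" for om t0 x0
    proof -
      obtain e y where y: "e > 0" "y t0 = x0" "solution_on M (\<lambda>t. rhs (om * t)) {t0 - e<..} y"
        "\<forall>t\<ge>t0. infdist (y t) K \<le> \<rho>" "\<forall>t\<ge>t0 + \<Delta>. infdist (y t) K \<le> \<epsilon>" using 1(4)[rule_format, OF asm] by blast
      have "max_solution_satisfies (caratheodory_solution Q nabla h \<psi> (cl om)) t0 (inv_into M (new_vars om t0) x0)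
        (\<lambda>x. \<forall>t\<ge>t0. infdist (new_vars om t (x t)) K \<le> \<rho> \<and> (t \<ge> t0 + \<Delta> \<longrightarrow> infdist (new_vars om t (x t)) K \<le> \<epsilon>))"
        by (rule lift[of om x0 e y t0 "\<lambda>t z. infdist z K \<le> \<rho> \<and> (t \<ge> t0 + \<Delta> \<longrightarrow> infdist z K \<le> \<epsilon>)", OF _ _ y(1-3)])
          (use that 1 y(4,5) SM in auto)
      \<comment> \<open>To fit \<open>lift\<close>, both bounds were merged into one property of
        time and state; they are separated again, using \<Delta> > 0.\<close>
      moreover have "(\<forall>t\<ge>t0. Pr t \<and> (t \<ge> t0 + \<Delta> \<longrightarrow> Pr' t)) \<longleftrightarrow> (\<forall>t\<ge>t0. Pr t) \<and> (\<forall>t\<ge>t0 + \<Delta>. Pr' t)" for Pr Pr' :: "real \<Rightarrow> bool"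
        using 1(2) by force
      ultimately show ?thesis by simp
    qed
    then show "\<exists>om0>0. \<exists>\<Delta>>0. \<exists>\<rho>>0. \<forall>om\<ge>om0. \<forall>t0. \<forall>x0\<in>S. infdist x0 K \<le> r \<longrightarrow>
      max_solution_satisfies (caratheodory_solution Q nabla h \<psi> (cl om)) t0 (inv_into M (new_vars om t0) x0)
        (\<lambda>x. (\<forall>t\<ge>t0. infdist (new_vars om t (x t)) K \<le> \<rho>) \<and> (\<forall>t\<ge>t0 + \<Delta>. infdist (new_vars om t (x t)) K \<le> \<epsilon>))"
      using 1 by (intro exI[of _ om0] exI[of _ \<Delta>] exI[of _ \<rho>] conjI) auto
  qed
qed

end

theorem corollary1:
  fixes Q :: "'a::euclidean_space set"
    and k n :: nat
    and nabla :: "('a \<Rightarrow> 'a) \<Rightarrow> ('a \<Rightarrow> 'a) \<Rightarrow> 'a \<Rightarrow> 'a"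
    and Y :: "nat \<Rightarrow> 'a \<Rightarrow> 'a"
    and R :: "'a \<Rightarrow> 'a \<Rightarrow> 'a"
    and \<psi> :: "'a \<Rightarrow> real"
    and \<alpha> :: "real \<Rightarrow> real"
    and u U :: "nat \<Rightarrow> real \<Rightarrow> real"
    and lam mu :: "nat \<Rightarrow> real"
    and T h :: real
    and K S :: "(('a \<times> 'a) \<times> real) set"
  assumes "embedded_submanifold k Q" and "closed Q"
    and "affine_connection Q nabla"
    and "\<And>i. i \<le> n \<Longrightarrow> Y i \<in> smooth_vector_fields Q"
    and "smooth_endomorphism_field Q R"
    and "smooth_map_on Q \<psi>"
    and "smooth_on_open UNIV \<alpha>"
    and "\<And>s. \<alpha> s * deriv \<alpha> s > 0"
    and "strict_mono (\<lambda>s. \<alpha> s * deriv \<alpha> s)"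
    and "T > 0"
    and "\<And>i. i \<in> {1..n} \<Longrightarrow> u i \<in> borel_measurable lebesgue"
    and "\<And>i. i \<in> {1..n} \<Longrightarrow> bounded (range (u i))"
    and "\<And>i t. i \<in> {1..n} \<Longrightarrow> u i (t + T) = u i t"
    and "\<And>i. i \<in> {1..n} \<Longrightarrow> (u i has_integral 0) {0..T}"
    and "\<And>i. i \<in> {1..n} \<Longrightarrow> zero_mean_antiderivative T (u i) (U i)"
    and "\<And>i j. i \<in> {1..n} \<Longrightarrow> j \<in> {1..n} \<Longrightarrow>
           1 / T * integral {0..T} (\<lambda>\<tau>. U i \<tau> * U j \<tau>) = (if i = j then 1 else 0)"
    and "h > 0"
    and "K \<noteq> {}" and "compact K" and "K \<subseteq> state_space Q"
    and "neighborhood_in (state_space Q) K S"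
    and "uniformly_asymptotically_stable (state_space Q)
           (classical_solution Q nabla h \<psi> (\<lambda>t. av_acceleration Q nabla n Y R \<psi> \<alpha> lam mu)) S K"
  shows "practically_uniformly_asymptotically_stable (state_space Q)
           (\<lambda>\<omega>. caratheodory_solution Q nabla h \<psi> (cl_acceleration n Y R \<psi> \<alpha> u lam mu \<omega>))
           (change_of_variables n Y \<psi> \<alpha> U lam) S K"
proof -
  interpret control_system Q k nabla n Y R \<psi> \<alpha> u U lam mu T h
    by unfold_locales (fact assms)+
  show ?thesis
    by (rule practical_asymptotic_stability) (fact assms)+
qed

end
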